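(* Let $\sigma\in(-1,1)$, $\tau\ge0$, let $g\in C^2[0,1]$ be positive, and let $\Omega_\epsilon=\Omega\cup R_\epsilon\cup L_\epsilon$, $\epsilon>0$ small, be the associated family of planar dumbbell domains (see context). Suppose that $g$ satisfies the monotonicity property (MP): there exists $\delta\in(0,1/2)$ such that $g$ is decreasing on $[0,\delta)$ and increasing on $(1-\delta,1]$. Then the family $\Omega_\epsilon$, $\epsilon>0$, satisfies the H-Condition.
   Context: **Domains.** $\Omega_L,\Omega_R\subset\mathbb R^2$ are bounded smooth domains with $\Omega_L\cap\Omega_R=\emptyset$, $\partial\Omega_L\supset\{(0,y):-1<y<1\}$, $\partial\Omega_R\supset\{(1,y):-1<y<1\}$, $(\Omega_L\cup\Omega_R)\cap([0,1]\times[-1,1])=\emptyset$. Let $\Omega=\Omega_L\cup\Omega_R$, and for small $\epsilon>0$ let $R_\epsilon=\{(x,y):0<x<1,\ 0<y<\epsilon g(x)\}$, $L_\epsilon=(\{0\}\times(0,\epsilon g(0)))\cup(\{1\}\times(0,\epsilon g(1)))$, $\Omega_\epsilon=\Omega\cup R_\epsilon\cup L_\epsilon$. **Notation.** For an open set $U$ and $f\in H^2(U)$, $[f]_{H^2_{\sigma,\tau}(U)}=\bigl|(1-\sigma)\|D^2f\|^2_{L^2(U)}+\sigma\|\Delta f\|^2_{L^2(U)}+\tau\|\nabla f\|^2_{L^2(U)}+\|f\|^2_{L^2(U)}\bigr|^{1/2}$. $H^2_{L_\epsilon}(R_\epsilon)$ is the closure in $H^2(R_\epsilon)$ of the functions in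 $C^\infty(\overline{R_\epsilon})$ vanishing in a neighbourhood of $L_\epsilon$. **H-Condition.** The family $\Omega_\epsilon$ satisfies the H-Condition if, given any functions $u_\epsilon\in H^2(\Omega_\epsilon)$ with $\|u_\epsilon\|_{H^2(\Omega_\epsilon)}\le R$ for all $\epsilon>0$ (with $R$ independent of $\epsilon$), there exist $\bar u_\epsilon\in H^2_{L_\epsilon}(R_\epsilon)$ such that (i) $\|u_\epsilon-\bar u_\epsilon\|_{L^2(R_\epsilon)}\to0$ as $\epsilon\to0$; (ii) $[\bar u_\epsilon]^2_{H^2_{\sigma,\tau}(R_\epsilon)}\le[u_\epsilon]^2_{H^2_{\sigma,\tau}(\Omega_\epsilon)}+o(1)$ as $\epsilon\to0$. *)

theory Defs
  imports "HOL-Analysis.Analysis"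
begin

section \<open>Smooth functions and smooth planar domains\<close>

definition partial_deriv :: "'a::euclidean_space \<Rightarrow> ('a \<Rightarrow> real) \<Rightarrow> 'a \<Rightarrow> real" where
  "partial_deriv b f = (\<lambda>x. frechet_derivative f (at x) b)"

primrec Ck :: "nat \<Rightarrow> ('a::euclidean_space \<Rightarrow> real) \<Rightarrow> bool" where
  "Ck 0 f \<longleftrightarrow> continuous_on UNIV f"
| "Ck (Suc k) f \<longleftrightarrow> (\<forall>x. f differentiable (at x)) \<and> (\<forall>b\<in>Basis. Ck k (partial_deriv b f))"

definition smooth :: "('a::euclidean_space \<Rightarrow> real) \<Rightarrow> bool" where
  "smooth f \<longleftrightarrow> (\<forall>k. Ck k f)"

text \<open>Locally, after an orthogonal change of coordinates \<open>T\<close>, the set is the part of the plane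
  lying strictly above the graph of a smooth function.\<close>

definition smooth_boundary :: "(real \<times> real) set \<Rightarrow> bool" where
  "smooth_boundary U \<longleftrightarrow>
     (\<forall>p\<in>frontier U. \<exists>r>0. \<exists>(T :: real \<times> real \<Rightarrow> real \<times> real) \<gamma>.
        orthogonal_transformation T \<and> smooth \<gamma> \<and>
        U \<inter> ball p r = {z \<in> ball p r. \<gamma> (fst (T z)) < snd (T z)})"

definition bounded_smooth_domain :: "(real \<times> real) set \<Rightarrow> bool" where
  "bounded_smooth_domain U \<longleftrightarrow>
     U \<noteq> {} \<and> open U \<and> connected U \<and> bounded U \<and> smooth_boundary U"

section \<open>Sobolev spaces\<close>

text \<open>Elements of \<open>L\<^sup>2(U)\<close> and \<open>H\<^sup>2(U)\<close> are represented by functions on the whole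
  space of which only the values on \<open>U\<close>, up to null sets, matter.\<close>

definition L2 :: "'a::euclidean_space set \<Rightarrow> ('a \<Rightarrow> real) set" where
  "L2 U = {f. f \<in> borel_measurable (lebesgue_on U) \<and> integrable (lebesgue_on U) (\<lambda>x. (f x)\<^sup>2)}"

definition L2_norm :: "'a::euclidean_space set \<Rightarrow> ('a \<Rightarrow> real) \<Rightarrow> real" where
  "L2_norm U f = sqrt (LINT x|lebesgue_on U. (f x)\<^sup>2)"

definition test_functions :: "'a::euclidean_space set \<Rightarrow> ('a \<Rightarrow> real) set" where
  "test_functions U =
     {\<phi>. smooth \<phi> \<and> compact (closure {x. \<phi> x \<noteq> 0}) \<and> closure {x. \<phi> x \<noteq> 0} \<subseteq> U}"

text \<open>A list \<open>bs\<close> of basis vectors stands for the iterated partial derivative in these directions.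
  The weak derivative is only used for \<open>f \<in> L\<^sup>2(U)\<close>, so that all integrals exist.\<close>

definition has_weak_deriv ::
  "'a::euclidean_space set \<Rightarrow> 'a list \<Rightarrow> ('a \<Rightarrow> real) \<Rightarrow> ('a \<Rightarrow> real) \<Rightarrow> bool" where
  "has_weak_deriv U bs f h \<longleftrightarrow>
     (\<forall>\<phi>\<in>test_functions U.
        (LINT x|lebesgue_on U. f x * foldr partial_deriv bs \<phi> x) =
        (-1) ^ length bs * (LINT x|lebesgue_on U. h x * \<phi> x))"

text \<open>For open \<open>U\<close> the chosen function is determined up to a null set, if it exists.\<close>

definition weak_deriv ::
  "'a::euclidean_space set \<Rightarrow> 'a list \<Rightarrow> ('a \<Rightarrow> real) \<Rightarrow> 'a \<Rightarrow> real" where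
  "weak_deriv U bs f = (SOME h. h \<in> L2 U \<and> has_weak_deriv U bs f h)"

definition H2 :: "'a::euclidean_space set \<Rightarrow> ('a \<Rightarrow> real) set" where
  "H2 U = {f \<in> L2 U. \<forall>bs. set bs \<subseteq> Basis \<and> length bs \<le> 2 \<longrightarrow> (\<exists>h\<in>L2 U. has_weak_deriv U bs f h)}"

definition gradient_L2_norm :: "'a::euclidean_space set \<Rightarrow> ('a \<Rightarrow> real) \<Rightarrow> real" where
  "gradient_L2_norm U f = sqrt (\<Sum>b\<in>Basis. (L2_norm U (weak_deriv U [b] f))\<^sup>2)"

definition hessian_L2_norm :: "'a::euclidean_space set \<Rightarrow> ('a \<Rightarrow> real) \<Rightarrow> real" where
  "hessian_L2_norm U f = sqrt (\<Sum>b\<in>Basis. \<Sum>c\<in>Basis. (L2_norm U (weak_deriv U [b, c] f))\<^sup>2)"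

definition laplacian :: "'a::euclidean_space set \<Rightarrow> ('a \<Rightarrow> real) \<Rightarrow> 'a \<Rightarrow> real" where
  "laplacian U f = (\<lambda>x. \<Sum>b\<in>Basis. weak_deriv U [b, b] f x)"

definition H2_norm :: "'a::euclidean_space set \<Rightarrow> ('a \<Rightarrow> real) \<Rightarrow> real" where
  "H2_norm U f =
     sqrt ((hessian_L2_norm U f)\<^sup>2 + (gradient_L2_norm U f)\<^sup>2 + (L2_norm U f)\<^sup>2)"

definition H2_bracket :: "real \<Rightarrow> real \<Rightarrow> 'a::euclidean_space set \<Rightarrow> ('a \<Rightarrow> real) \<Rightarrow> real" where
  "H2_bracket \<sigma> \<tau> U f =
     sqrt \<bar>(1 - \<sigma>) * (hessian_L2_norm U f)\<^sup>2 + \<sigma> * (L2_norm U (laplacian U f))\<^sup>2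
           + \<tau> * (gradient_L2_norm U f)\<^sup>2 + (L2_norm U f)\<^sup>2\<bar>"

text \<open>Smoothness up to the boundary means being the restriction of a smooth function on the whole
  space.  The set \<open>L\<close> need not be contained in \<open>U\<close>; it will be a part of the boundary.\<close>

definition smooth_on_closure :: "'a::euclidean_space set \<Rightarrow> ('a \<Rightarrow> real) set" where
  "smooth_on_closure U = {f. \<exists>F. smooth F \<and> (\<forall>x\<in>closure U. f x = F x)}"

definition H2_vanishing :: "'a::euclidean_space set \<Rightarrow> 'a set \<Rightarrow> ('a \<Rightarrow> real) set" where
  "H2_vanishing U L =
     {f \<in> H2 U. \<forall>e>0. \<exists>\<phi> \<in> smooth_on_closure U.
        (\<exists>N. open N \<and> L \<subseteq> N \<and> (\<forall>x \<in> N \<inter> closure U. \<phi> x = 0)) \<and>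
        \<phi> \<in> H2 U \<and> H2_norm U (\<lambda>x. f x - \<phi> x) < e}"

section \<open>Dumbbell domains\<close>

definition dumbbell_ends :: "(real \<times> real) set \<Rightarrow> (real \<times> real) set \<Rightarrow> bool" where
  "dumbbell_ends \<Omega>L \<Omega>R \<longleftrightarrow>
     bounded_smooth_domain \<Omega>L \<and> bounded_smooth_domain \<Omega>R \<and> \<Omega>L \<inter> \<Omega>R = {} \<and>
     {0} \<times> {-1<..<1} \<subseteq> frontier \<Omega>L \<and> {1} \<times> {-1<..<1} \<subseteq> frontier \<Omega>R \<and>
     (\<Omega>L \<union> \<Omega>R) \<inter> ({0..1} \<times> {-1..1}) = {}"

definition channel :: "(real \<Rightarrow> real) \<Rightarrow> real \<Rightarrow> (real \<times> real) set" where
  "channel g \<epsilon> = {(x, y). 0 < x \<and> x < 1 \<and> 0 < y \<and> y < \<epsilon> * g x}"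

definition junctions :: "(real \<Rightarrow> real) \<Rightarrow> real \<Rightarrow> (real \<times> real) set" where
  "junctions g \<epsilon> = ({0} \<times> {0<..<\<epsilon> * g 0}) \<union> ({1} \<times> {0<..<\<epsilon> * g 1})"

definition dumbbell :: "(real \<times> real) set \<Rightarrow> (real \<Rightarrow> real) \<Rightarrow> real \<Rightarrow> (real \<times> real) set" where
  "dumbbell \<Omega> g \<epsilon> = \<Omega> \<union> channel g \<epsilon> \<union> junctions g \<epsilon>"

text \<open>\<open>g \<in> C\<^sup>2[0,1]\<close>, with one-sided derivatives at the end points.\<close>

definition C2_unit_interval :: "(real \<Rightarrow> real) \<Rightarrow> bool" where
  "C2_unit_interval g \<longleftrightarrow>
     (\<exists>g' g''. (\<forall>x\<in>{0..1}. (g has_real_derivative g' x) (at x within {0..1}) \<and>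
                           (g' has_real_derivative g'' x) (at x within {0..1})) \<and>
              continuous_on {0..1} g'')"

text \<open>Monotonicity is understood in the weak sense, so strictly monotone \<open>g\<close> are included.\<close>

definition monotonicity_property :: "(real \<Rightarrow> real) \<Rightarrow> bool" where
  "monotonicity_property g \<longleftrightarrow>
     (\<exists>\<delta>. 0 < \<delta> \<and> \<delta> < 1/2 \<and> antimono_on {0..<\<delta>} g \<and> mono_on {1-\<delta><..1} g)"

text \<open>The family is indexed by \<open>0 < \<epsilon> < \<epsilon>0\<close>; the function \<open>\<rho>\<close> is the \<open>o(1)\<close> term.\<close>

definition H_condition ::
  "real \<Rightarrow> real \<Rightarrow> (real \<times> real) set \<Rightarrow> (real \<Rightarrow> real) \<Rightarrow> real \<Rightarrow> bool" where
  "H_condition \<sigma> \<tau> \<Omega> g \<epsilon>0 \<longleftrightarrow>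
     (\<forall>(u :: real \<Rightarrow> real \<times> real \<Rightarrow> real) M.
        (\<forall>\<epsilon>\<in>{0<..<\<epsilon>0}. u \<epsilon> \<in> H2 (dumbbell \<Omega> g \<epsilon>) \<and> H2_norm (dumbbell \<Omega> g \<epsilon>) (u \<epsilon>) \<le> M) \<longrightarrow>
        (\<exists>v :: real \<Rightarrow> real \<times> real \<Rightarrow> real.
           (\<forall>\<epsilon>\<in>{0<..<\<epsilon>0}. v \<epsilon> \<in> H2_vanishing (channel g \<epsilon>) (junctions g \<epsilon>)) \<and>
           ((\<lambda>\<epsilon>. L2_norm (channel g \<epsilon>) (\<lambda>z. u \<epsilon> z - v \<epsilon> z)) \<longlongrightarrow> 0) (at_right 0) \<and>
           (\<exists>\<rho>. (\<rho> \<longlongrightarrow> 0) (at_right 0) \<and>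
              (\<forall>\<epsilon>\<in>{0<..<\<epsilon>0}. (H2_bracket \<sigma> \<tau> (channel g \<epsilon>) (v \<epsilon>))\<^sup>2
                              \<le> (H2_bracket \<sigma> \<tau> (dumbbell \<Omega> g \<epsilon>) (u \<epsilon>))\<^sup>2 + \<rho> \<epsilon>))))"

end

theory Submission
  imports Defs
begin

text \<open>Let \<open>F\<close> be the affine map that stretches the channel horizontally by a length of order \<open>a\<close> into
  both ends and contracts it vertically by the factor \<open>1 - \<kappa> a\<close> about a fixed small height.  As \<open>g\<close> is
  Lipschitz and positive, a suitable \<open>\<kappa>\<close> makes \<open>F\<close> map the closed channel into a compact subset of
  the dumbbell.  Let \<open>U\<close> be a mollification of \<open>u\<close> near this compact set and \<open>v = (\<xi> U) \<circ> F\<close>, where the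
  cutoff \<open>\<xi>\<close> vanishes inside the ends at distance \<open>2 a\<close> from the junctions, so that \<open>v\<close> is smooth and vanishes
  near them.  Mollification does not increase the bracket, because its square is the integral of a sum of
  squares of linear functionals of the jet, and composition with \<open>F\<close> changes it by a factor \<open>1 + O(a)\<close>.
  The derivatives of \<open>\<xi>\<close> cost at most \<open>a\<^sup>-\<^sup>5\<close> times the integral of \<open>|U|\<^sup>2 + |\<nabla>U|\<^sup>2\<close> over a strip of height
  \<open>O(\<epsilon>)\<close> lying in a rectangle contained in the ends; integrating the one-dimensional trace inequality
  across that rectangle bounds this integral by \<open>O(\<epsilon>)\<close>.  With \<open>a\<^sup>6 = \<epsilon>\<close> all errors are \<open>O(a)\<close>.\<close>

section \<open>Calculus of smooth functions\<close>

text \<open>A cutoff inside the channel would cost a multiple of the energy near the junctions, and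
  nothing makes that energy small. In the ends, by contrast, a thin horizontal strip carries only
  O(\<epsilon>) of the function and its gradient; so the cutoff acts there and the result is pulled
  back by \<open>F\<close>. Condition (ii) has constant one in front of the energy, so no step may
  lose a fixed factor. Young's inequality is used with weight \<open>a\<close>: the main term keeps
  \<open>1 + a\<close>, every error is multiplied by about \<open>1 / a\<close>. The second
  derivative of the cutoff contributes \<open>1 / a\<^sup>4\<close> after squaring, which explains
  the fifth power; the sixth root of \<epsilon> then leaves exactly one power of \<open>a\<close>. A
  horizontal shift by at most \<open>3 * a\<close> lowers the ceiling of the channel by at most
  \<open>3 * a * \<epsilon>\<close> times the Lipschitz constant of \<open>g\<close>. The
  contraction towards half the minimal height has to gain more than this, which fixes \<kappa>.
  Compactness of the image serves twice: it leaves room for mollification, and it makes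
  \<open>v\<close> smooth up to the boundary, so that \<open>v\<close> is its own approximation in
  the closure that defines the space of vanishing functions.\<close>

lemma partial_deriv_eq: "(f has_derivative f') (at x) \<Longrightarrow> partial_deriv b f x = f' b"
  by (simp add: partial_deriv_def frechet_derivative_at[symmetric])

lemma has_derivative_partial_deriv:
  fixes f :: "'a::euclidean_space \<Rightarrow> real"
  assumes "f differentiable (at x)"
  shows "(f has_derivative (\<lambda>h. \<Sum>b\<in>Basis. (h \<bullet> b) * partial_deriv b f x)) (at x)"
proof -
  have d: "(f has_derivative frechet_derivative f (at x)) (at x)"
    using assms frechet_derivative_works by blast
  have "frechet_derivative f (at x) h = (\<Sum>b\<in>Basis. (h \<bullet> b) * partial_deriv b f x)" for h
  proof -
    have "linear (frechet_derivative f (at x))"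
      using d has_derivative_linear by blast
    then have "frechet_derivative f (at x) (\<Sum>b\<in>Basis. (h \<bullet> b) *\<^sub>R b)
        = (\<Sum>b\<in>Basis. (h \<bullet> b) *\<^sub>R frechet_derivative f (at x) b)"
      by (simp add: linear_sum linear_cmul)
    then show ?thesis
      by (simp add: euclidean_representation partial_deriv_def)
  qed
  then have "frechet_derivative f (at x) = (\<lambda>h. \<Sum>b\<in>Basis. (h \<bullet> b) * partial_deriv b f x)"
    by blast
  with d show ?thesis by simp
qed

text \<open>Derivatives are unique, so any family \<open>D\<close> obtained from differentiation
  rules may stand in for \<open>frechet_derivative\<close>; most closure properties below go through
  this rule.\<close>

lemma Ck_SucI:
  assumes "\<And>x. (f has_derivative D x) (at x)" "\<And>b. b \<in> Basis \<Longrightarrow> Ck k (\<lambda>x. D x b)"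
  shows "Ck (Suc k) f"
proof -
  have "partial_deriv b f = (\<lambda>x. D x b)" for b
    using assms(1) partial_deriv_eq by blast
  with assms show ?thesis
    by (auto simp: differentiable_def)
qed

lemma Ck_Suc_derivative:
  assumes "Ck (Suc k) f"
  shows "\<exists>D. (\<forall>x. (f has_derivative D x) (at x)) \<and> (\<forall>b\<in>Basis. Ck k (\<lambda>x. D x b))"
proof (intro exI conjI allI ballI)
  show "(f has_derivative frechet_derivative f (at x)) (at x)" for x
    using assms frechet_derivative_works by auto
  show "Ck k (\<lambda>x. frechet_derivative f (at x) b)" if "b \<in> Basis" for b
    using assms that by (simp add: partial_deriv_def)
qed

lemma Ck_continuous_on: "Ck k f \<Longrightarrow> continuous_on UNIV f"
proof (cases k)
  case (Suc j)
  assume "Ck k f"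
  then have "\<forall>x. f differentiable (at x)" using Suc by simp
  then show ?thesis
    by (simp add: continuous_at_imp_continuous_on differentiable_imp_continuous_within)
qed simp

lemma Ck_Suc_imp_Ck: "Ck (Suc k) f \<Longrightarrow> Ck k f"
proof (induction k arbitrary: f)
  case 0
  then show ?case using Ck_continuous_on by (metis Ck.simps(1))
next
  case (Suc k)
  then show ?case
    using Ck.simps(2) by blast
qed

lemma Ck_const: "Ck k (\<lambda>x. c)"
proof (induction k arbitrary: c)
  case (Suc k)
  show ?case by (rule Ck_SucI[where D = "\<lambda>_ _. 0"]) (use Suc in auto)
qed simp

lemma Ck_add: "Ck k f \<Longrightarrow> Ck k g \<Longrightarrow> Ck k (\<lambda>x. f x + g x)"
proof (induction k arbitrary: f g)
  case (Suc k)
  obtain D where D: "\<And>x. (f has_derivative D x) (at x)" "\<And>b. b \<in> Basis \<Longrightarrow> Ck k (\<lambda>x. D x b)"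
    using Ck_Suc_derivative[OF Suc.prems(1)] by blast
  obtain E where E: "\<And>x. (g has_derivative E x) (at x)" "\<And>b. b \<in> Basis \<Longrightarrow> Ck k (\<lambda>x. E x b)"
    using Ck_Suc_derivative[OF Suc.prems(2)] by blast
  show ?case
    by (rule Ck_SucI[where D = "\<lambda>x h. D x h + E x h"])
      (auto intro!: Suc.IH D E has_derivative_add)
qed (auto intro: continuous_on_add)

lemma Ck_mult: "Ck k f \<Longrightarrow> Ck k g \<Longrightarrow> Ck k (\<lambda>x. f x * g x)"
proof (induction k arbitrary: f g)
  case (Suc k)
  obtain D where D: "\<And>x. (f has_derivative D x) (at x)" "\<And>b. b \<in> Basis \<Longrightarrow> Ck k (\<lambda>x. D x b)"
    using Ck_Suc_derivative[OF Suc.prems(1)] by blast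
  obtain E where E: "\<And>x. (g has_derivative E x) (at x)" "\<And>b. b \<in> Basis \<Longrightarrow> Ck k (\<lambda>x. E x b)"
    using Ck_Suc_derivative[OF Suc.prems(2)] by blast
  have "Ck k f" "Ck k g" using Suc.prems Ck_Suc_imp_Ck by blast+
  then show ?case
    by (intro Ck_SucI[where D = "\<lambda>x h. f x * E x h + D x h * g x"])
      (auto intro!: Suc.IH D E has_derivative_mult Ck_add)
qed (auto intro: continuous_on_mult)

lemma Ck_sum: "(\<And>i. i \<in> I \<Longrightarrow> Ck k (f i)) \<Longrightarrow> Ck k (\<lambda>x. \<Sum>i\<in>I. f i x)"
  by (induction I rule: infinite_finite_induct) (auto intro!: Ck_const Ck_add)

text \<open>By the chain rule each partial derivative of the composite is a finite sum of products.
  The induction generalises over \<open>f\<close> only: \<open>f\<close> is replaced by its partial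
  derivatives, while \<open>G\<close> stays and merely loses one order.\<close>

lemma Ck_compose:
  fixes f :: "'b::euclidean_space \<Rightarrow> real" and G :: "'a::euclidean_space \<Rightarrow> 'b"
  assumes "Ck k f" "\<And>b. b \<in> Basis \<Longrightarrow> Ck k (\<lambda>x. G x \<bullet> b)"
  shows "Ck k (\<lambda>x. f (G x))"
  using assms
proof (induction k arbitrary: f)
  case 0
  have "continuous_on UNIV G"
    using 0 by (subst continuous_on_componentwise) auto
  then show ?case
    using 0 continuous_on_compose2 by (metis Ck.simps(1) subset_UNIV)
next
  case (Suc k)
  define D where "D x h = (\<Sum>b\<in>Basis. frechet_derivative (\<lambda>x. G x \<bullet> b) (at x) h *\<^sub>R b)" for x h
  have D: "(G has_derivative D x) (at x)" for x
  proof -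
    have "((\<lambda>x. G x \<bullet> b) has_derivative frechet_derivative (\<lambda>x. G x \<bullet> b) (at x)) (at x)"
      if "b \<in> Basis" for b
      using Suc.prems(2)[OF that] frechet_derivative_works by auto
    then show ?thesis
      unfolding D_def
      by (subst has_derivative_componentwise_within) (auto simp: inner_sum_left inner_Basis if_distrib cong: if_cong)
  qed
  have Dc: "Ck k (\<lambda>x. D x c \<bullet> b)" if "b \<in> Basis" "c \<in> Basis" for b c
  proof -
    have "partial_deriv c (\<lambda>x. G x \<bullet> b) = (\<lambda>x. D x c \<bullet> b)"
    proof
      fix x
      show "partial_deriv c (\<lambda>x. G x \<bullet> b) x = D x c \<bullet> b"
        by (rule partial_deriv_eq) (auto intro!: derivative_eq_intros D)
    qed
    with Suc.prems(2)[OF that(1)] that(2) show ?thesis by (auto dest!: bspec)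
  qed
  have f: "(f has_derivative (\<lambda>h. \<Sum>b\<in>Basis. (h \<bullet> b) * partial_deriv b f x)) (at x)" for x
    using Suc.prems(1) has_derivative_partial_deriv by auto
  show ?case
  proof (rule Ck_SucI)
    show "((\<lambda>x. f (G x)) has_derivative
        (\<lambda>h. \<Sum>b\<in>Basis. (D x h \<bullet> b) * partial_deriv b f (G x))) (at x)" for x
      using has_derivative_compose[OF D f] by simp
    show "Ck k (\<lambda>x. \<Sum>b\<in>Basis. (D x c \<bullet> b) * partial_deriv b f (G x))" if "c \<in> Basis" for c
    proof (rule Ck_sum)
      fix b :: 'b assume b: "b \<in> Basis"
      have "Ck k (\<lambda>x. partial_deriv b f (G x))"
      proof (rule Suc.IH)
        show "Ck k (partial_deriv b f)" using Suc.prems(1) b by simp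
        show "Ck k (\<lambda>x. G x \<bullet> b)" if "b \<in> Basis" for b
          using Suc.prems(2)[OF that] by (rule Ck_Suc_imp_Ck)
      qed
      with Dc[OF b that] show "Ck k (\<lambda>x. (D x c \<bullet> b) * partial_deriv b f (G x))"
        by (rule Ck_mult)
    qed
  qed
qed

lemma Ck_bounded_linear:
  assumes "bounded_linear f" shows "Ck k f"
proof (cases k)
  case 0
  then show ?thesis using assms by (simp add: linear_continuous_on)
next
  case (Suc j)
  show ?thesis unfolding Suc
    by (rule Ck_SucI[where D = "\<lambda>_. f"])
      (use assms bounded_linear_imp_has_derivative Ck_const in auto)
qed

section \<open>Closure properties of smooth functions and the affine chain rule\<close>

lemma smooth_const: "smooth (\<lambda>x. c)"
  and smooth_add: "smooth f \<Longrightarrow> smooth g \<Longrightarrow> smooth (\<lambda>x. f x + g x)"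
  and smooth_mult: "smooth f \<Longrightarrow> smooth g \<Longrightarrow> smooth (\<lambda>x. f x * g x)"
  and smooth_bounded_linear: "bounded_linear f \<Longrightarrow> smooth f"
  and smooth_sum: "(\<And>i. i \<in> I \<Longrightarrow> smooth (F i)) \<Longrightarrow> smooth (\<lambda>x. \<Sum>i\<in>I. F i x)"
  for f g :: "'a::euclidean_space \<Rightarrow> real"
  by (auto simp: smooth_def intro: Ck_const Ck_add Ck_mult Ck_bounded_linear Ck_sum)

lemma smooth_compose:
  fixes f :: "'b::euclidean_space \<Rightarrow> real" and G :: "'a::euclidean_space \<Rightarrow> 'b"
  assumes "smooth f" "\<And>b. b \<in> Basis \<Longrightarrow> smooth (\<lambda>x. G x \<bullet> b)"
  shows "smooth (\<lambda>x. f (G x))"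
  using assms by (auto simp: smooth_def intro: Ck_compose)

lemma smooth_compose_affine:
  fixes f :: "'b::euclidean_space \<Rightarrow> real" and A :: "'a::euclidean_space \<Rightarrow> 'b"
  assumes "smooth f" "bounded_linear A"
  shows "smooth (\<lambda>x. f (c + A x))"
proof (rule smooth_compose[OF assms(1)])
  fix b :: 'b assume "b \<in> Basis"
  have "bounded_linear (\<lambda>x. A x \<bullet> b)"
    using assms(2) bounded_linear_compose bounded_linear_inner_left by blast
  then show "smooth (\<lambda>x. (c + A x) \<bullet> b)"
    by (simp add: inner_add_left smooth_add smooth_const smooth_bounded_linear)
qed

lemma smooth_partial_deriv: "smooth f \<Longrightarrow> b \<in> Basis \<Longrightarrow> smooth (partial_deriv b f)"
  unfolding smooth_def using Ck.simps(2) by blast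

lemma smooth_differentiable: "smooth f \<Longrightarrow> f differentiable (at x)"
  unfolding smooth_def using Ck.simps(2) by blast

lemma smooth_continuous_on: "smooth f \<Longrightarrow> continuous_on A f"
  unfolding smooth_def using Ck_continuous_on continuous_on_subset by blast

lemmas smooth_has_derivative = has_derivative_partial_deriv[OF smooth_differentiable]

lemma smooth_iterated_partial_deriv:
  "smooth f \<Longrightarrow> set bs \<subseteq> Basis \<Longrightarrow> smooth (foldr partial_deriv bs f)"
  by (induction bs) (auto intro: smooth_partial_deriv)

lemma partial_deriv_mult:
  assumes "smooth f" "smooth g"
  shows "partial_deriv b (\<lambda>x. f x * g x) = (\<lambda>x. f x * partial_deriv b g x + partial_deriv b f x * g x)"
proof
  fix x
  have "(f has_derivative frechet_derivative f (at x)) (at x)"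
       "(g has_derivative frechet_derivative g (at x)) (at x)"
    using assms smooth_differentiable frechet_derivative_works by blast+
  from has_derivative_mult[OF this]
  show "partial_deriv b (\<lambda>x. f x * g x) x = f x * partial_deriv b g x + partial_deriv b f x * g x"
    by (subst partial_deriv_eq) (auto simp: partial_deriv_def)
qed

lemma partial_deriv_compose_affine:
  fixes f :: "'b::euclidean_space \<Rightarrow> real" and A :: "'a::euclidean_space \<Rightarrow> 'b"
  assumes "smooth f" "bounded_linear A" "A b = \<alpha> *\<^sub>R b'"
  shows "partial_deriv b (\<lambda>x. f (c + A x)) = (\<lambda>x. \<alpha> * partial_deriv b' f (c + A x))"
proof
  fix x
  have d: "(f has_derivative frechet_derivative f (at (c + A x))) (at (c + A x))"
    using assms(1) smooth_differentiable frechet_derivative_works by blast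
  have "((\<lambda>x. c + A x) has_derivative A) (at x)"
    using assms(2) by (auto intro!: derivative_eq_intros bounded_linear_imp_has_derivative)
  from has_derivative_compose[OF this d]
  have "partial_deriv b (\<lambda>x. f (c + A x)) x = frechet_derivative f (at (c + A x)) (\<alpha> *\<^sub>R b')"
    by (simp add: partial_deriv_eq assms(3))
  then show "partial_deriv b (\<lambda>x. f (c + A x)) x = \<alpha> * partial_deriv b' f (c + A x)"
    using linear_cmul[OF has_derivative_linear[OF d]] by (simp add: partial_deriv_def)
qed

lemma partial_deriv_cmult:
  assumes "smooth f" shows "partial_deriv b (\<lambda>x. c * f x) = (\<lambda>x. c * partial_deriv b f x)"
proof -
  have "partial_deriv b (\<lambda>x. c :: real) = (\<lambda>x. 0)"
    using partial_deriv_eq[OF has_derivative_const] by blast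
  then show ?thesis
    using partial_deriv_mult[OF smooth_const assms, of b c] by simp
qed

text \<open>Each differentiation in \<open>y\<close> brings out a factor -1. The total sign is the
  one in \<open>has_weak_deriv\<close>, and the two cancel when a reflected mollifier is used as a
  test function.\<close>

lemma iterated_partial_deriv_reflect:
  fixes f :: "'a::euclidean_space \<Rightarrow> real"
  assumes "smooth f" "set bs \<subseteq> Basis"
  shows "foldr partial_deriv bs (\<lambda>y. f (x - y)) = (\<lambda>y. (-1) ^ length bs * foldr partial_deriv bs f (x - y))"
  using assms(2)
proof (induction bs)
  case (Cons b bs)
  have s: "smooth (foldr partial_deriv bs f)"
    using Cons assms smooth_iterated_partial_deriv by auto
  have "bounded_linear (\<lambda>y::'a. - y)" by (rule bounded_linear_minus[OF bounded_linear_ident])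
  from partial_deriv_compose_affine[OF s this, of b "-1" b x] smooth_compose_affine[OF s this, of x]
  show ?case
    using Cons by (simp add: partial_deriv_cmult)
qed simp

section \<open>Supports of derivatives\<close>

lemma partial_deriv_zero_outside:
  assumes "x \<notin> closure {x. f x \<noteq> (0::real)}"
  shows "partial_deriv b f x = 0"
proof -
  have "(f has_derivative (\<lambda>h. 0)) (at x)"
  proof (rule has_derivative_transform_within_open)
    show "((\<lambda>x. 0) has_derivative (\<lambda>h. 0)) (at x)" by simp
    show "x \<in> - closure {x. f x \<noteq> 0}" using assms by auto
    show "0 = f y" if "y \<in> - closure {x. f x \<noteq> 0}" for y
      using that closure_subset[of "{x. f x \<noteq> 0}"] by auto
  qed auto
  then show ?thesis using partial_deriv_eq by blast
qed

lemma support_partial_deriv: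
  "closure {x. partial_deriv b f x \<noteq> 0} \<subseteq> closure {x. f x \<noteq> (0::real)}"
proof (rule closure_minimal)
  show "{x. partial_deriv b f x \<noteq> 0} \<subseteq> closure {x. f x \<noteq> 0}"
    using partial_deriv_zero_outside by blast
qed simp

lemma support_iterated_partial_deriv:
  "closure {x. foldr partial_deriv bs f x \<noteq> 0} \<subseteq> closure {x. f x \<noteq> (0::real)}"
proof (induction bs)
  case (Cons b bs)
  show ?case
    using support_partial_deriv[of b "foldr partial_deriv bs f"] Cons by simp
qed simp

section \<open>Bump functions and cutoffs\<close>

text \<open>Dividing by \<open>t ^ n\<close> makes the family closed under differentiation up to
  linear combinations, so one induction over the order, with \<open>n\<close> arbitrary, gives
  smoothness of the classical function exp(-1/t).\<close>

definition flat_exp :: "nat \<Rightarrow> real \<Rightarrow> real" where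
  "flat_exp n t = (if t > 0 then exp (- inverse t) / t ^ n else 0)"

lemma flat_exp_has_derivative:
  "(flat_exp n has_real_derivative flat_exp (n + 2) t - n * flat_exp (n + 1) t) (at t)"
proof (cases t "0 :: real" rule: linorder_cases)
  case less
  have "((\<lambda>t. 0) has_real_derivative 0) (at t)" by simp
  then have "(flat_exp n has_real_derivative 0) (at t)"
    by (rule has_field_derivative_transform_within_open[where S = "{..<0}"])
      (use less in \<open>auto simp: flat_exp_def\<close>)
  then show ?thesis using less by (simp add: flat_exp_def)
next
  case greater
  have pw: "((\<lambda>t. t ^ n) has_real_derivative n * t ^ n / t) (at t)"
    using DERIV_pow[of n t UNIV] greater by (cases n) auto
  have "((\<lambda>t. exp (- inverse t) / t ^ n) has_real_derivative
      exp (- inverse t) / t ^ (n + 2) - n * (exp (- inverse t) / t ^ (n + 1))) (at t)"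
    using greater by (auto intro!: DERIV_divide[OF _ pw, THEN DERIV_cong] derivative_eq_intros simp: field_simps power2_eq_square)
  then have "(flat_exp n has_real_derivative
      exp (- inverse t) / t ^ (n + 2) - n * (exp (- inverse t) / t ^ (n + 1))) (at t)"
    by (rule has_field_derivative_transform_within_open[where S = "{0<..}"])
      (use greater in \<open>auto simp: flat_exp_def\<close>)
  then show ?thesis using greater by (simp add: flat_exp_def)
next
  case equal
  \<comment> \<open>This is the right difference quotient at 0: in terms of \<open>inverse h\<close>
    an exponential beats a power. The left quotient is identically zero.\<close>
  have "((\<lambda>h. inverse h ^ (n + 1) / exp (inverse h)) \<longlongrightarrow> 0) (at_right (0::real))"
    by (rule filterlim_compose[OF tendsto_power_div_exp_0 filterlim_inverse_at_top_right])
  then have "((\<lambda>h. flat_exp n h / h) \<longlongrightarrow> 0) (at_right 0)"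
    by (rule Lim_transform_eventually)
      (auto simp: eventually_at_right_field flat_exp_def exp_minus field_simps intro!: exI[of _ 1])
  moreover have "((\<lambda>h. flat_exp n h / h) \<longlongrightarrow> 0) (at_left 0)"
    by (rule tendsto_eventually)
      (auto simp: eventually_at_left_field flat_exp_def intro!: exI[of _ "-1"])
  ultimately have "((\<lambda>h. flat_exp n h / h) \<longlongrightarrow> 0) (at 0)"
    using filterlim_split_at by blast
  then show ?thesis using equal
    by (simp add: DERIV_def flat_exp_def)
qed

lemma smooth_real_derivI:
  fixes f f' :: "real \<Rightarrow> real"
  assumes "\<And>t. (f has_real_derivative f' t) (at t)" "Ck k f'"
  shows "Ck (Suc k) f"
  using assms
  by (intro Ck_SucI[where D = "\<lambda>t h. f' t * h"]) (auto simp: has_field_derivative_def)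

lemma smooth_flat_exp: "smooth (flat_exp n)"
proof -
  have "Ck k (flat_exp n)" for k
  proof (induction k arbitrary: n)
    case 0
    then show ?case
      using flat_exp_has_derivative DERIV_isCont continuous_at_imp_continuous_on by (metis Ck.simps(1))
  next
    case (Suc k)
    have "Ck k (\<lambda>t. flat_exp (n + 2) t + (- real n) * flat_exp (n + 1) t)"
      by (intro Ck_add Ck_mult Ck_const Suc)
    then show ?case
      by (intro smooth_real_derivI[OF flat_exp_has_derivative]) simp
  qed
  then show ?thesis by (simp add: smooth_def)
qed

lemma flat_exp_nonneg: "0 \<le> flat_exp 0 t" and flat_exp_pos_iff: "0 < flat_exp 0 t \<longleftrightarrow> 0 < t"
  by (auto simp: flat_exp_def)

text \<open>The step is the normalised primitive of the bump
  \<open>flat_exp 0 t * flat_exp 0 (1 - t)\<close>, which is positive exactly on the open unit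
  interval.\<close>

lemma smooth_step_exists:
  obtains s :: "real \<Rightarrow> real" where "smooth s" "\<And>t. 0 \<le> s t" "\<And>t. s t \<le> 1"
    "\<And>t. t \<le> 0 \<Longrightarrow> s t = 0" "\<And>t. 1 \<le> t \<Longrightarrow> s t = 1"
proof -
  define \<beta> where "\<beta> t = flat_exp 0 t * flat_exp 0 (1 + (-1) * t)" for t
  have sb: "smooth \<beta>" unfolding \<beta>_def
    by (intro smooth_mult smooth_flat_exp smooth_compose_affine bounded_linear_mult_right)
  have b0: "0 \<le> \<beta> t" for t by (simp add: \<beta>_def flat_exp_nonneg)
  have cb: "continuous_on A \<beta>" for A using sb smooth_continuous_on by blast
  define I where "I = integral {0..1} \<beta>"
  have "I > 0"
  proof -
    have "I \<noteq> 0"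
    proof
      assume "I = 0"
      then have "(\<beta> has_integral 0) {0..1}"
        unfolding I_def using cb integrable_continuous_real integrable_integral by metis
      then have "\<beta> (1/2) = 0"
        using has_integral_0_cbox_imp_0[of 0 1 \<beta> "1/2"] cb b0 by (auto simp: box_real)
      then show False
        by (simp add: \<beta>_def flat_exp_def)
    qed
    moreover have "I \<ge> 0" unfolding I_def
      by (intro integral_nonneg integrable_continuous_real cb b0)
    ultimately show ?thesis by simp
  qed
  define G where "G t = (if t \<le> 0 then 0 else integral {0..t} \<beta>)" for t
  have \<beta>z: "\<beta> t = 0" if "t \<le> 0 \<or> t \<ge> 1" for t
    using that by (auto simp: \<beta>_def flat_exp_def)
  \<comment> \<open>Moving the base point from 0 to \<open>-B\<close> puts \<open>t\<close> in the
    interior of the interval, so the fundamental theorem of calculus yields a two-sided derivative,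
    also at 0.\<close>
  have Gi: "G t = integral {-B..t} \<beta>" if "t \<ge> -B" "B > 0" for t B
  proof (cases "t \<le> 0")
    case True
    have "integral {-B..t} \<beta> = integral {-B..t} (\<lambda>_. 0)"
      by (rule integral_cong) (use True \<beta>z in auto)
    then show ?thesis using True by (simp add: G_def)
  next
    case False
    have "integral {-B..0} \<beta> + integral {0..t} \<beta> = integral {-B..t} \<beta>"
      by (intro Henstock_Kurzweil_Integration.integral_combine) (use False that cb in \<open>auto intro: integrable_continuous_real\<close>)
    moreover have "integral {-B..0} \<beta> = integral {-B..0} (\<lambda>_. 0)"
      by (rule integral_cong) (use \<beta>z in auto)
    ultimately show ?thesis using False by (simp add: G_def)
  qed
  have dG: "(G has_real_derivative \<beta> t) (at t)" for t
  proof -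
    define B where "B = \<bar>t\<bar> + 1"
    have "((\<lambda>t. integral {-B..t} \<beta>) has_real_derivative \<beta> t) (at t within {-B..B})"
      by (rule integral_has_real_derivative) (use cb in \<open>auto simp: B_def\<close>)
    then have "((\<lambda>t. integral {-B..t} \<beta>) has_real_derivative \<beta> t) (at t)"
      by (subst (asm) at_within_interior) (auto simp: B_def)
    then show ?thesis
      by (rule has_field_derivative_transform_within_open[where S = "{-B<..<B}"])
        (use Gi[of B] in \<open>auto simp: B_def\<close>)
  qed
  have sG: "smooth G"
  proof -
    have "Ck (Suc k) G" for k
      using smooth_real_derivI[OF dG] sb smooth_def by blast
    then show ?thesis unfolding smooth_def using Ck_Suc_imp_Ck by blast
  qed
  have G1: "G t = I" if "t \<ge> 1" for t
  proof -
    have "integral {0..1} \<beta> + integral {1..t} \<beta> = integral {0..t} \<beta>"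
      by (intro Henstock_Kurzweil_Integration.integral_combine) (use that cb in \<open>auto intro: integrable_continuous_real\<close>)
    moreover have "integral {1..t} \<beta> = integral {1..t} (\<lambda>_. 0)"
      by (rule integral_cong) (use \<beta>z in auto)
    ultimately show ?thesis using that by (simp add: G_def I_def)
  qed
  have mono: "G x \<le> G y" if "x \<le> y" for x y
    by (rule DERIV_nonneg_imp_nondecreasing[OF that]) (use dG b0 in blast)
  have Gr: "0 \<le> G t" "G t \<le> I" for t
    using mono[of "min t 0" t] mono[of t "max t 1"] G1[of "max t 1"] by (auto simp: G_def min_def split: if_splits)
  show ?thesis
  proof
    show "smooth (\<lambda>t. inverse I * G t)" by (intro smooth_mult smooth_const sG)
    show "0 \<le> inverse I * G t" "inverse I * G t \<le> 1" for t
      using Gr[of t] \<open>I > 0\<close> by (auto simp: field_simps)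
    show "inverse I * G t = 0" if "t \<le> 0" for t using that by (simp add: G_def)
    show "inverse I * G t = 1" if "1 \<le> t" for t using G1[OF that] \<open>I > 0\<close> by simp
  qed
qed

text \<open>Only the support radius is recorded, not the scaling of one fixed kernel. Limits are
  stated uniformly over all kernels of radius at most some \<open>\<delta>0\<close>, so one kernel
  can meet several smallness demands at once.\<close>

definition mollifier :: "real \<Rightarrow> ('a::euclidean_space \<Rightarrow> real) \<Rightarrow> bool" where
  "mollifier \<delta> \<rho> \<longleftrightarrow> smooth \<rho> \<and> (\<forall>z. 0 \<le> \<rho> z) \<and> (\<forall>z. \<rho> z \<noteq> 0 \<longrightarrow> norm z < \<delta>) \<and>
     integrable lborel \<rho> \<and> (LINT z|lborel. \<rho> z) = 1"

lemma compact_support_integrable: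
  fixes f :: "'a::euclidean_space \<Rightarrow> real"
  assumes "continuous_on UNIV f" "compact K" "\<And>x. x \<notin> K \<Longrightarrow> f x = 0"
  shows "integrable lborel f"
proof -
  have "integrable lborel (\<lambda>x. indicator K x *\<^sub>R f x)"
    by (rule borel_integrable_compact[OF assms(2)]) (use assms(1) continuous_on_subset in blast)
  moreover have "(\<lambda>x. indicator K x *\<^sub>R f x) = f"
    using assms(3) by (auto simp: indicator_def fun_eq_iff)
  ultimately show ?thesis by simp
qed

lemma mollifier_exists:
  assumes "\<delta> > 0"
  obtains \<rho> :: "'a::euclidean_space \<Rightarrow> real" where "mollifier \<delta> \<rho>"
proof -
  \<comment> \<open>The argument is \<open>\<delta>\<^sup>2\<close> minus the squared norm, positive
    exactly in the ball. The coordinates are written out because the closure rules for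
    \<open>smooth\<close> concern sums and products of linear functions.\<close>
  define \<rho> :: "'a \<Rightarrow> real" where "\<rho> z = flat_exp 0 (\<delta>\<^sup>2 + (-1) * (\<Sum>b\<in>Basis. (z \<bullet> b) * (z \<bullet> b)))" for z
  have sq: "(\<Sum>b\<in>Basis. (z \<bullet> b) * (z \<bullet> b)) = (norm z)\<^sup>2" for z :: 'a
    by (subst power2_norm_eq_inner, subst euclidean_inner) simp
  have pos: "0 < \<rho> z \<longleftrightarrow> norm z < \<delta>" for z
  proof -
    have "0 < \<rho> z \<longleftrightarrow> (norm z)\<^sup>2 < \<delta>\<^sup>2" by (simp add: \<rho>_def sq flat_exp_pos_iff)
    also have "\<dots> \<longleftrightarrow> norm z < \<delta>"
      using assms power_mono_iff[of \<delta> "norm z" 2] by (simp add: not_le[symmetric])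
    finally show ?thesis .
  qed
  have nn: "0 \<le> \<rho> z" for z by (simp add: \<rho>_def flat_exp_nonneg)
  have supp: "\<rho> z \<noteq> 0 \<longleftrightarrow> norm z < \<delta>" for z
    using pos[of z] nn[of z] by linarith
  have "smooth (\<lambda>z::'a. z \<bullet> b)" for b by (rule smooth_bounded_linear[OF bounded_linear_inner_left])
  then have "smooth (\<lambda>z::'a. \<delta>\<^sup>2 + (-1) * (\<Sum>b\<in>Basis. (z \<bullet> b) * (z \<bullet> b)))"
    by (intro smooth_add smooth_mult smooth_const smooth_sum)
  then have s: "smooth \<rho>"
    unfolding \<rho>_def by - (rule smooth_compose[OF smooth_flat_exp], simp)
  have i: "integrable lborel \<rho>"
  proof (rule compact_support_integrable[where K = "cball 0 \<delta>"])
    show "\<rho> x = 0" if "x \<notin> cball 0 \<delta>" for x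
      using supp[of x] that by auto
  qed (use smooth_continuous_on[OF s] in auto)
  have "(LINT z|lborel. \<rho> z) \<noteq> 0"
  proof
    assume "(LINT z|lborel. \<rho> z) = 0"
    then have "AE z in lborel. \<rho> z = 0"
      using integral_nonneg_eq_0_iff_AE[OF i] nn by simp
    moreover have "(AE z in lborel. \<rho> z = 0) \<longleftrightarrow> emeasure lborel (ball (0::'a) \<delta>) = 0"
      by (rule AE_iff_measurable) (simp_all add: supp set_eq_iff)
    ultimately have "emeasure lborel (ball (0::'a) \<delta>) = 0"
      by blast
    then show False
      using assms open_not_negligible[of "ball (0::'a) \<delta>"]
      by (simp add: negligible_iff_null_sets null_sets_def)
  qed
  moreover have "(LINT z|lborel. \<rho> z) \<ge> 0" using nn by simp
  ultimately have I: "(LINT z|lborel. \<rho> z) > 0" by simp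
  define c where "c = inverse (LINT z|lborel. \<rho> z)"
  have "c > 0" using I by (simp add: c_def)
  then have "mollifier \<delta> (\<lambda>z. c * \<rho> z)"
    unfolding mollifier_def using s i nn I supp smooth_mult[OF smooth_const s, of c]
    by (auto simp: c_def)
  then show ?thesis by (rule that)
qed

section \<open>Convolution with a smooth kernel\<close>

text \<open>Two points at distance below 1 lie both in the ball of radius \<open>R + 1\<close>,
  where compactness applies, or both at norm at least \<open>R\<close>, where \<open>f\<close>
  vanishes.\<close>

lemma compact_support_uniformly_continuous:
  fixes f :: "'a::euclidean_space \<Rightarrow> real"
  assumes c: "continuous_on UNIV f" and z: "\<And>z. R \<le> norm z \<Longrightarrow> f z = 0" and e: "e > 0"
  shows "\<exists>d>0. \<forall>x y. norm (y - x) < d \<longrightarrow> \<bar>f y - f x\<bar> < e"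
proof -
  have "uniformly_continuous_on (cball 0 (R + 1)) f"
    using c by (intro compact_uniformly_continuous) (auto intro: continuous_on_subset)
  then obtain d where d: "d > 0" "\<And>x y. x \<in> cball 0 (R + 1) \<Longrightarrow> y \<in> cball 0 (R + 1) \<Longrightarrow> dist y x < d \<Longrightarrow> dist (f y) (f x) < e"
    unfolding uniformly_continuous_on_def using e by metis
  show ?thesis
  proof (intro exI[of _ "min d 1"] conjI allI impI)
    fix x y :: 'a assume l: "norm (y - x) < min d 1"
    show "\<bar>f y - f x\<bar> < e"
    proof (cases "norm x \<le> R + 1 \<and> norm y \<le> R + 1")
      case True
      then show ?thesis using d(2)[of x y] l by (auto simp: dist_norm)
    next
      case False
      have "\<bar>norm y - norm x\<bar> < 1" using l norm_triangle_ineq3[of y x] by linarith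
      with False have "R \<le> norm x" "R \<le> norm y" by auto
      then show ?thesis using z e by simp
    qed
  qed (use d in auto)
qed

lemma compact_support_bounded:
  fixes f :: "'a::euclidean_space \<Rightarrow> real"
  assumes c: "continuous_on UNIV f" and z: "\<And>z. R \<le> norm z \<Longrightarrow> f z = 0"
  obtains B where "B \<ge> 0" "\<And>z. \<bar>f z\<bar> \<le> B"
proof -
  have "bounded (f ` cball 0 R)"
    using c by (intro compact_imp_bounded compact_continuous_image) (auto intro: continuous_on_subset)
  then obtain B where B: "\<And>z. norm z \<le> R \<Longrightarrow> \<bar>f z\<bar> \<le> B"
    unfolding bounded_iff by fastforce
  have "\<bar>f z\<bar> \<le> max B 0" for z
  proof (cases "norm z \<le> R")
    case True
    from B[OF this] show ?thesis by linarith
  next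
    case False
    then have "f z = 0" by (intro z) simp
    then show ?thesis by simp
  qed
  with max.cobounded2 show ?thesis by (rule that)
qed

lemma support_subset_cball:
  fixes f :: "'a::euclidean_space \<Rightarrow> real"
  assumes "\<And>z. R \<le> norm z \<Longrightarrow> f z = 0"
  shows "closure {x. f x \<noteq> 0} \<subseteq> cball 0 R"
proof (rule closure_minimal)
  show "{x. f x \<noteq> 0} \<subseteq> cball 0 R"
  proof
    fix x assume "x \<in> {x. f x \<noteq> 0}"
    then have "\<not> R \<le> norm x" using assms[of x] by blast
    then show "x \<in> cball 0 R" by simp
  qed
qed simp

text \<open>The support is only known to lie in the closed ball of radius \<open>R\<close>, and the
  point has to be off it; the margin 1 is a convenient positive amount, paid once per
  derivative.\<close>

lemma smooth_zero_outside_partial_deriv: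
  fixes f :: "'a::euclidean_space \<Rightarrow> real"
  assumes "\<And>z. R \<le> norm z \<Longrightarrow> f z = 0" "R + 1 \<le> norm z"
  shows "partial_deriv b f z = 0"
proof (rule partial_deriv_zero_outside)
  have "closure {x. f x \<noteq> 0} \<subseteq> cball 0 R"
    using assms(1) by (rule support_subset_cball)
  then show "z \<notin> closure {x. f x \<noteq> 0}" using assms(2) by auto
qed

text \<open>Uniform continuity of the partial derivatives makes the first-order remainder small
  uniformly in \<open>x\<close>. This uniformity permits differentiation under the integral against
  a merely integrable function.\<close>

lemma compact_support_uniformly_differentiable:
  fixes \<psi> :: "'a::euclidean_space \<Rightarrow> real"
  assumes s: "smooth \<psi>" and z: "\<And>z. R \<le> norm z \<Longrightarrow> \<psi> z = 0" and e: "e > 0"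
  shows "\<exists>d>0. \<forall>x h. norm h < d \<longrightarrow>
     \<bar>\<psi> (x + h) - \<psi> x - (\<Sum>b\<in>Basis. (h \<bullet> b) * partial_deriv b \<psi> x)\<bar> \<le> e * norm h"
proof -
  define N where "N = real (DIM('a))"
  have "\<exists>d>0. \<forall>x y. norm (y - x) < d \<longrightarrow> \<bar>partial_deriv b \<psi> y - partial_deriv b \<psi> x\<bar> < e / N"
    if b: "b \<in> Basis" for b
  proof (rule compact_support_uniformly_continuous)
    show "continuous_on UNIV (partial_deriv b \<psi>)"
      using s b smooth_partial_deriv smooth_continuous_on by blast
    show "partial_deriv b \<psi> z = 0" if "R + 1 \<le> norm z" for z
      using smooth_zero_outside_partial_deriv z that by blast
    show "e / N > 0" using e by (simp add: N_def)
  qed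
  then obtain d where d: "\<And>b. b \<in> Basis \<Longrightarrow> d b > 0"
    "\<And>b x y. b \<in> Basis \<Longrightarrow> norm (y - x) < d b \<Longrightarrow> \<bar>partial_deriv b \<psi> y - partial_deriv b \<psi> x\<bar> < e / N"
    by metis
  define D where "D = Min (d ` Basis)"
  have D: "D > 0" "\<And>b. b \<in> Basis \<Longrightarrow> D \<le> d b" using d(1) by (auto simp: D_def)
  show ?thesis
  proof (intro exI[of _ D] conjI allI impI D(1))
    fix x h :: 'a assume h: "norm h < D"
    let ?F = "\<lambda>x h. \<Sum>b\<in>Basis. (h \<bullet> b) * partial_deriv b \<psi> x"
    have "norm (\<psi> (x + h) - \<psi> x - ?F x ((x + h) - x)) \<le> norm ((x + h) - x) * e"
    proof (rule differentiable_bound_linearization[where S = "ball x D"])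
      show "x + t *\<^sub>R (x + h - x) \<in> ball x D" if "t \<in> {0..1}" for t
      proof -
        have "t * norm h \<le> norm h" using that by (intro mult_left_le_one_le) auto
        then show ?thesis using h that by (simp add: dist_norm)
      qed
      show "(\<psi> has_derivative ?F y) (at y within ball x D)" for y
        using smooth_has_derivative[OF s] has_derivative_at_withinI by blast
      show "onorm (?F y - ?F x) \<le> e" if y: "y \<in> ball x D" for y
      proof (rule onorm_le)
        fix v :: 'a
        have "\<bar>(?F y - ?F x) v\<bar> = \<bar>\<Sum>b\<in>Basis. (v \<bullet> b) * (partial_deriv b \<psi> y - partial_deriv b \<psi> x)\<bar>"
          by (simp add: fun_diff_def sum_subtractf algebra_simps)
        also have "\<dots> \<le> (\<Sum>b\<in>Basis. \<bar>(v \<bullet> b) * (partial_deriv b \<psi> y - partial_deriv b \<psi> x)\<bar>)" by simp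
        also have "\<dots> \<le> (\<Sum>b\<in>(Basis::'a set). norm v * (e / N))"
        proof (rule sum_mono)
          fix b :: 'a assume b: "b \<in> Basis"
          have "norm (y - x) < d b" using y D(2)[OF b] by (simp add: dist_norm norm_minus_commute)
          then have "\<bar>partial_deriv b \<psi> y - partial_deriv b \<psi> x\<bar> \<le> e / N" using d(2)[OF b] less_imp_le by blast
          then show "\<bar>(v \<bullet> b) * (partial_deriv b \<psi> y - partial_deriv b \<psi> x)\<bar> \<le> norm v * (e / N)"
            unfolding abs_mult by (intro mult_mono) (use Basis_le_norm[OF b] in auto)
        qed
        also have "\<dots> = e * norm v" by (simp add: N_def)
        finally show "norm ((?F y - ?F x) v) \<le> e * norm v" by simp
      qed
      show "x \<in> ball x D" using D by simp
    qed
    then show "\<bar>\<psi> (x + h) - \<psi> x - ?F x h\<bar> \<le> e * norm h" by (simp add: mult.commute)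
  qed
qed

definition convolution :: "('a::euclidean_space \<Rightarrow> real) \<Rightarrow> ('a \<Rightarrow> real) \<Rightarrow> 'a \<Rightarrow> real" where
  "convolution f \<psi> x = (LINT y|lborel. f y * \<psi> (x - y))"

lemma borel_measurable_smooth: "smooth \<psi> \<Longrightarrow> \<psi> \<in> borel_measurable borel"
  by (intro borel_measurable_continuous_onI smooth_continuous_on)

lemma integrable_mult_bounded:
  fixes f g :: "'a::euclidean_space \<Rightarrow> real"
  assumes "integrable lborel f" "g \<in> borel_measurable borel" "\<And>z. \<bar>g z\<bar> \<le> B"
  shows "integrable lborel (\<lambda>y. f y * g y)"
proof (rule Bochner_Integration.integrable_bound)
  show "integrable lborel (\<lambda>y. B * \<bar>f y\<bar>)" using assms(1) by simp
  show "(\<lambda>y. f y * g y) \<in> borel_measurable lborel"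
    using borel_measurable_integrable[OF assms(1)] assms(2) by measurable
  show "AE y in lborel. norm (f y * g y) \<le> norm (B * \<bar>f y\<bar>)"
  proof (intro AE_I2)
    fix y
    have "0 \<le> B" using assms(3)[of y] by linarith
    then show "norm (f y * g y) \<le> norm (B * \<bar>f y\<bar>)"
      using mult_right_mono[OF assms(3)[of y] abs_ge_zero[of "f y"]] by (simp add: abs_mult mult.commute)
  qed
qed

lemma integrable_convolution_kernel:
  fixes f \<psi> :: "'a::euclidean_space \<Rightarrow> real"
  assumes "integrable lborel f" "continuous_on UNIV \<psi>" "\<And>z. R \<le> norm z \<Longrightarrow> \<psi> z = 0"
  shows "integrable lborel (\<lambda>y. f y * \<psi> (x - y))"
proof -
  obtain B where B: "\<And>z. \<bar>\<psi> z\<bar> \<le> B" using compact_support_bounded assms(2,3) by metis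
  have "(\<lambda>y. \<psi> (x - y)) \<in> borel_measurable borel"
    using assms(2) by (intro borel_measurable_continuous_onI continuous_on_compose2[OF assms(2)] continuous_intros) auto
  then show ?thesis by (rule integrable_mult_bounded[OF assms(1)]) (rule B)
qed

text \<open>The uniform remainder bound for \<psi> is integrated against the absolute value of
  \<open>f\<close>, whose integral is \<open>C\<close>; the choice \<open>e / (C + 1)\<close> also
  covers \<open>C = 0\<close>.\<close>

lemma convolution_has_derivative:
  fixes f \<psi> :: "'a::euclidean_space \<Rightarrow> real"
  assumes f: "integrable lborel f" and s: "smooth \<psi>" and z: "\<And>z. R \<le> norm z \<Longrightarrow> \<psi> z = 0"
  shows "(convolution f \<psi> has_derivative
     (\<lambda>h. \<Sum>b\<in>Basis. (h \<bullet> b) * convolution f (partial_deriv b \<psi>) x)) (at x)"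
  unfolding has_derivative_at_alt
proof (intro conjI allI impI)
  show "bounded_linear (\<lambda>h. \<Sum>b\<in>Basis. (h \<bullet> b) * convolution f (partial_deriv b \<psi>) x)"
    by (intro bounded_linear_sum bounded_linear_mult_const bounded_linear_inner_left)
  fix e :: real assume "e > 0"
  define C where "C = (LINT y|lborel. \<bar>f y\<bar>)"
  have C: "C \<ge> 0" by (simp add: C_def)
  define \<eta> where "\<eta> = e / (C + 1)"
  have "\<eta> > 0" using \<open>e > 0\<close> C by (simp add: \<eta>_def)
  then obtain d where d: "d > 0" "\<And>x h. norm h < d \<Longrightarrow>
     \<bar>\<psi> (x + h) - \<psi> x - (\<Sum>b\<in>Basis. (h \<bullet> b) * partial_deriv b \<psi> x)\<bar> \<le> \<eta> * norm h"
    using compact_support_uniformly_differentiable[OF s z] by metis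
  have i0: "integrable lborel (\<lambda>y. f y * \<psi> (x - y))" for x
    by (rule integrable_convolution_kernel[OF f _ z]) (use s smooth_continuous_on in auto)
  have i1: "integrable lborel (\<lambda>y. f y * partial_deriv b \<psi> (x - y))" if "b \<in> Basis" for b
    by (rule integrable_convolution_kernel[OF f, where R = "R + 1"])
      (use s that smooth_partial_deriv smooth_continuous_on smooth_zero_outside_partial_deriv[OF z] in auto)
  show "\<exists>d>0. \<forall>y. norm (y - x) < d \<longrightarrow> norm (convolution f \<psi> y - convolution f \<psi> x
      - (\<Sum>b\<in>Basis. ((y - x) \<bullet> b) * convolution f (partial_deriv b \<psi>) x)) \<le> e * norm (y - x)"
  proof (intro exI[of _ d] conjI allI impI d(1))
    fix x' assume l: "norm (x' - x) < d"
    define h where "h = x' - x"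
    have x': "x' = x + h" by (simp add: h_def)
    let ?E = "\<lambda>y. f y * (\<psi> (x' - y) - \<psi> (x - y) - (\<Sum>b\<in>Basis. (h \<bullet> b) * partial_deriv b \<psi> (x - y)))"
    have iS: "integrable lborel (\<lambda>y. \<Sum>b\<in>Basis. (h \<bullet> b) * (f y * partial_deriv b \<psi> (x - y)))"
      by (intro Bochner_Integration.integrable_sum Bochner_Integration.integrable_mult_right i1)
    have "(LINT y|lborel. f y * \<psi> (x' - y) - f y * \<psi> (x - y) - (\<Sum>b\<in>Basis. (h \<bullet> b) * (f y * partial_deriv b \<psi> (x - y))))
       = convolution f \<psi> x' - convolution f \<psi> x - (\<Sum>b\<in>Basis. (h \<bullet> b) * convolution f (partial_deriv b \<psi>) x)"
      using i0 i1 iS by (simp add: convolution_def)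
    moreover have eq: "f y * \<psi> (x' - y) - f y * \<psi> (x - y) - (\<Sum>b\<in>Basis. (h \<bullet> b) * (f y * partial_deriv b \<psi> (x - y))) = ?E y" for y
      by (simp add: right_diff_distrib sum_distrib_left mult.left_commute)
    moreover have "\<bar>LINT y|lborel. ?E y\<bar> \<le> (LINT y|lborel. \<bar>f y\<bar> * (\<eta> * norm h))"
    proof (rule order_trans[OF integral_abs_bound integral_mono])
      have "integrable lborel (\<lambda>y. f y * \<psi> (x' - y) - f y * \<psi> (x - y) - (\<Sum>b\<in>Basis. (h \<bullet> b) * (f y * partial_deriv b \<psi> (x - y))))"
        using i0 iS by (intro Bochner_Integration.integrable_diff) auto
      then show "integrable lborel (\<lambda>y. \<bar>?E y\<bar>)" using eq by simp
      show "integrable lborel (\<lambda>y. \<bar>f y\<bar> * (\<eta> * norm h))" using f by simp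
      fix y
      have "\<bar>\<psi> (x' - y) - \<psi> (x - y) - (\<Sum>b\<in>Basis. (h \<bullet> b) * partial_deriv b \<psi> (x - y))\<bar> \<le> \<eta> * norm h"
        using d(2)[of h "x - y"] l by (simp add: x' algebra_simps)
      then show "\<bar>?E y\<bar> \<le> \<bar>f y\<bar> * (\<eta> * norm h)"
        unfolding abs_mult by (rule mult_left_mono) simp
    qed
    moreover have "(LINT y|lborel. \<bar>f y\<bar> * (\<eta> * norm h)) = C * (\<eta> * norm h)"
      using f by (simp add: C_def)
    moreover have "C * (\<eta> * norm h) \<le> e * norm h"
    proof -
      have "C * \<eta> \<le> e" using C \<open>e > 0\<close> by (simp add: \<eta>_def field_simps)
      then show ?thesis using mult_right_mono[of "C * \<eta>" e "norm h"] by (simp add: mult.assoc)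
    qed
    ultimately show "norm (convolution f \<psi> x' - convolution f \<psi> x
      - (\<Sum>b\<in>Basis. ((x' - x) \<bullet> b) * convolution f (partial_deriv b \<psi>) x)) \<le> e * norm (x' - x)"
      unfolding h_def by (simp del: integral_mult_left_zero integral_mult_right_zero)
  qed
qed

lemma partial_deriv_convolution:
  fixes f \<psi> :: "'a::euclidean_space \<Rightarrow> real"
  assumes "integrable lborel f" "smooth \<psi>" "\<And>z. R \<le> norm z \<Longrightarrow> \<psi> z = 0" "b \<in> Basis"
  shows "partial_deriv b (convolution f \<psi>) = convolution f (partial_deriv b \<psi>)"
proof
  fix x
  show "partial_deriv b (convolution f \<psi>) x = convolution f (partial_deriv b \<psi>) x"
    using partial_deriv_eq[OF convolution_has_derivative[OF assms(1-3)], where b = b] assms(4)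
    by (simp add: inner_Basis if_distrib[of "\<lambda>t. t * _"] cong: if_cong)
qed

lemma smooth_convolution:
  fixes f \<psi> :: "'a::euclidean_space \<Rightarrow> real"
  assumes f: "integrable lborel f" and "smooth \<psi>" "\<And>z. R \<le> norm z \<Longrightarrow> \<psi> z = 0"
  shows "smooth (convolution f \<psi>)"
  unfolding smooth_def
proof
  fix k
  have d: "convolution f \<psi> differentiable (at x)"
    if "smooth \<psi>" "\<And>z. R \<le> norm z \<Longrightarrow> \<psi> z = 0" for x R and \<psi> :: "'a \<Rightarrow> real"
    using convolution_has_derivative[OF f that] unfolding differentiable_def by blast
  show "Ck k (convolution f \<psi>)" using assms(2,3)
  proof (induction k arbitrary: R \<psi>)
    case 0
    show ?case
      using differentiable_imp_continuous_within[OF d[OF 0]] by (simp add: continuous_at_imp_continuous_on)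
  next
    case (Suc k)
    have "Ck k (convolution f (partial_deriv b \<psi>))" if "b \<in> Basis" for b
    proof (rule Suc.IH)
      show "smooth (partial_deriv b \<psi>)" using smooth_partial_deriv[OF Suc.prems(1) that] .
      show "partial_deriv b \<psi> z = 0" if "R + 1 \<le> norm z" for z
        using smooth_zero_outside_partial_deriv[OF Suc.prems(2) that] .
    qed
    then show ?case
      using d[OF Suc.prems] partial_deriv_convolution[OF f Suc.prems] by simp
  qed
qed

lemma iterated_partial_deriv_convolution:
  fixes f \<psi> :: "'a::euclidean_space \<Rightarrow> real"
  assumes f: "integrable lborel f" and s: "smooth \<psi>" and z: "\<And>z. R \<le> norm z \<Longrightarrow> \<psi> z = 0"
    and "set bs \<subseteq> Basis"
  shows "foldr partial_deriv bs (convolution f \<psi>) = convolution f (foldr partial_deriv bs \<psi>)"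
  using assms(4)
proof (induction bs)
  case (Cons b bs)
  have "closure {x. foldr partial_deriv bs \<psi> x \<noteq> 0} \<subseteq> cball 0 R"
    by (rule order_trans[OF support_iterated_partial_deriv support_subset_cball[OF z]])
  then have zz: "foldr partial_deriv bs \<psi> z = 0" if "R + 1 \<le> norm z" for z
    using that closure_subset[of "{x. foldr partial_deriv bs \<psi> x \<noteq> 0}"] by force
  show ?case
    using partial_deriv_convolution[OF f smooth_iterated_partial_deriv[OF s] zz, where b = b] Cons by simp
qed simp

section \<open>Isometries of Lebesgue measure and integrals of derivatives\<close>

lemma lborel_distr_isometry:
  fixes t :: "'a::euclidean_space"
  assumes "\<bar>c\<bar> = 1"
  shows "distr lborel borel (\<lambda>x. t + c *\<^sub>R x) = lborel"
proof -
  have "c \<noteq> 0" using assms by auto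
  from lborel_affine[OF this, of t] show ?thesis
    using assms by (simp add: density_1)
qed

lemma lborel_integral_isometry:
  fixes f :: "'a::euclidean_space \<Rightarrow> real"
  assumes "f \<in> borel_measurable borel" "\<bar>c\<bar> = 1"
  shows "(LINT x|lborel. f (t + c *\<^sub>R x)) = (LINT x|lborel. f x)"
proof -
  have "(LINT x|distr lborel borel (\<lambda>x. t + c *\<^sub>R x). f x) = (LINT x|lborel. f (t + c *\<^sub>R x))"
    by (rule integral_distr) (use assms in auto)
  then show ?thesis unfolding lborel_distr_isometry[OF assms(2)] by simp
qed

lemma lborel_nn_integral_isometry:
  fixes f :: "'a::euclidean_space \<Rightarrow> ennreal"
  assumes "f \<in> borel_measurable borel" "\<bar>c\<bar> = 1"
  shows "(\<integral>\<^sup>+x. f (t + c *\<^sub>R x) \<partial>lborel) = (\<integral>\<^sup>+x. f x \<partial>lborel)"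
proof -
  have "(\<integral>\<^sup>+x. f x \<partial>distr lborel borel (\<lambda>x. t + c *\<^sub>R x)) = (\<integral>\<^sup>+x. f (t + c *\<^sub>R x) \<partial>lborel)"
    by (rule nn_integral_distr) (use assms in auto)
  then show ?thesis unfolding lborel_distr_isometry[OF assms(2)] by simp
qed

text \<open>The convolution of \<psi> with the indicator of a large ball is constant near the
  origin, namely the total integral of \<psi>, so its derivative there is zero. Differentiating
  under the integral identifies that derivative with the integral of
  \<open>partial_deriv b \<psi>\<close>.\<close>

lemma integral_partial_deriv_compact_support:
  fixes \<psi> :: "'a::euclidean_space \<Rightarrow> real"
  assumes s: "smooth \<psi>" and z: "\<And>z. R \<le> norm z \<Longrightarrow> \<psi> z = 0" and b: "b \<in> Basis"
  shows "(LINT x|lborel. partial_deriv b \<psi> x) = 0"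
proof -
  \<comment> \<open>The radius leaves \<open>\<bar>R\<bar> + 1\<close> for the support of the
    derivative and 1 for the size of \<open>x\<close>, so points \<open>y\<close> outside the ball
    contribute nothing.\<close>
  define B where "B = cball (0::'a) (\<bar>R\<bar> + 2)"
  have iB: "integrable lborel (\<lambda>x. indicator B x :: real)"
    using emeasure_lborel_cball_finite[of "0::'a" "\<bar>R\<bar> + 2"] by (simp add: B_def integrable_indicator_iff top.not_eq_extremum)
  have restr: "convolution (indicator B) \<phi> x = (LINT y|lborel. \<phi> y)"
    if x: "norm x < 1" and c: "continuous_on UNIV \<phi>" and z: "\<And>z. \<bar>R\<bar> + 1 \<le> norm z \<Longrightarrow> \<phi> z = 0" for x \<phi>
  proof -
    have "indicator B y * \<phi> (x - y) = \<phi> (x + (-1) *\<^sub>R y)" for y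
    proof (cases "y \<in> B")
      case False
      then have "\<bar>R\<bar> + 1 \<le> norm (x - y)"
        using x norm_triangle_ineq2[of y x] by (simp add: B_def norm_minus_commute)
      then show ?thesis using z False by simp
    qed simp
    then have "convolution (indicator B) \<phi> x = (LINT y|lborel. \<phi> (x + (-1) *\<^sub>R y))"
      by (simp only: convolution_def)
    also have "\<dots> = (LINT y|lborel. \<phi> y)"
      by (rule lborel_integral_isometry) (use c borel_measurable_continuous_onI in auto)
    finally show ?thesis .
  qed
  have "(convolution (indicator B) \<psi> has_derivative (\<lambda>h. 0)) (at 0)"
  proof (rule has_derivative_transform_within_open[where s = "ball 0 1"])
    show "((\<lambda>x. LINT y|lborel. \<psi> y) has_derivative (\<lambda>h. 0)) (at 0)" by simp
    show "(LINT y|lborel. \<psi> y) = convolution (indicator B) \<psi> x" if "x \<in> ball 0 1" for x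
      using restr[of x \<psi>] that smooth_continuous_on[OF s] z by auto
  qed auto
  from partial_deriv_eq[OF this, of b]
  have "convolution (indicator B) (partial_deriv b \<psi>) 0 = 0"
    using partial_deriv_convolution[OF iB s z b] by simp
  moreover have "convolution (indicator B) (partial_deriv b \<psi>) 0 = (LINT y|lborel. partial_deriv b \<psi> y)"
  proof (rule restr)
    show "partial_deriv b \<psi> y = 0" if "\<bar>R\<bar> + 1 \<le> norm y" for y
      by (rule smooth_zero_outside_partial_deriv[OF z]) (use that in auto)
    show "continuous_on UNIV (partial_deriv b \<psi>)"
      using smooth_continuous_on smooth_partial_deriv s b by blast
  qed simp
  ultimately show ?thesis by simp
qed

section \<open>Mollification in \<open>L\<^sup>2\<close>\<close>

lemma mollifier_smooth: "mollifier \<delta> \<rho> \<Longrightarrow> smooth \<rho>"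
  and mollifier_nonneg: "mollifier \<delta> \<rho> \<Longrightarrow> 0 \<le> \<rho> z"
  and mollifier_continuous: "mollifier \<delta> \<rho> \<Longrightarrow> continuous_on UNIV \<rho>"
  and mollifier_zero: "mollifier \<delta> \<rho> \<Longrightarrow> \<delta> \<le> norm z \<Longrightarrow> \<rho> z = 0"
  by (auto simp: mollifier_def smooth_continuous_on)

lemma mollifier_measurable: "mollifier \<delta> \<rho> \<Longrightarrow> \<rho> \<in> borel_measurable borel"
  by (simp add: borel_measurable_smooth mollifier_smooth)

lemma mollifier_reflected:
  fixes \<rho> :: "'a::euclidean_space \<Rightarrow> real"
  assumes "mollifier \<delta> \<rho>"
  shows "integrable lborel (\<lambda>y. \<rho> (x - y))" "(LINT y|lborel. \<rho> (x - y)) = 1"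
proof -
  have "(LINT y|lborel. \<rho> (x + (-1) *\<^sub>R y)) = (LINT y|lborel. \<rho> y)"
    by (rule lborel_integral_isometry) (use assms mollifier_measurable in auto)
  then show 1: "(LINT y|lborel. \<rho> (x - y)) = 1"
    using assms by (simp add: mollifier_def)
  show "integrable lborel (\<lambda>y. \<rho> (x - y))"
    using 1 not_integrable_integral_eq by fastforce
qed

lemma nn_integral_mollifier_shift:
  fixes \<rho> :: "'a::euclidean_space \<Rightarrow> real"
  assumes "mollifier \<delta> \<rho>"
  shows "(\<integral>\<^sup>+x. ennreal (\<rho> (x - y)) \<partial>lborel) = 1"
proof -
  have "(\<integral>\<^sup>+x. ennreal (\<rho> (- y + 1 *\<^sub>R x)) \<partial>lborel) = (\<integral>\<^sup>+x. ennreal (\<rho> x) \<partial>lborel)"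
    by (rule lborel_nn_integral_isometry[of "\<lambda>x. ennreal (\<rho> x)"]) (use mollifier_measurable[OF assms] in auto)
  also have "\<dots> = ennreal (LINT x|lborel. \<rho> x)"
    by (rule nn_integral_eq_integral) (use assms in \<open>auto simp: mollifier_def\<close>)
  also have "\<dots> = 1" using assms by (simp add: mollifier_def)
  finally show ?thesis by simp
qed

text \<open>Jensen's inequality for the probability density \<open>\<rho> (x - y)\<close>, in the
  form that the variance of \<open>f\<close> about its mean \<open>c\<close> is nonnegative.\<close>

lemma convolution_square_le:
  fixes f :: "'a::euclidean_space \<Rightarrow> real"
  assumes m: "mollifier \<delta> \<rho>" and f: "integrable lborel f" and f2: "integrable lborel (\<lambda>x. (f x)\<^sup>2)"
  shows "(convolution f \<rho> x)\<^sup>2 \<le> convolution (\<lambda>y. (f y)\<^sup>2) \<rho> x"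
proof -
  define c where "c = convolution f \<rho> x"
  note ker = integrable_convolution_kernel[OF _ mollifier_continuous[OF m] mollifier_zero[OF m], where x = x]
  have i: "integrable lborel (\<lambda>y. f y * \<rho> (x - y))" "integrable lborel (\<lambda>y. (f y)\<^sup>2 * \<rho> (x - y))"
    using ker f f2 by blast+
  note r = mollifier_reflected[OF m, of x]
  have "0 \<le> (LINT y|lborel. (f y - c)\<^sup>2 * \<rho> (x - y))"
    using mollifier_nonneg[OF m] by (intro integral_nonneg_AE) auto
  also have "(\<lambda>y. (f y - c)\<^sup>2 * \<rho> (x - y)) =
      (\<lambda>y. (f y)\<^sup>2 * \<rho> (x - y) - 2 * c * (f y * \<rho> (x - y)) + c\<^sup>2 * \<rho> (x - y))"
    by (simp add: fun_eq_iff power2_eq_square algebra_simps)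
  also have "(LINT y|lborel. \<dots> y) = convolution (\<lambda>y. (f y)\<^sup>2) \<rho> x - 2 * c * c + c\<^sup>2 * 1"
  proof -
    have "(LINT y|lborel. f y * \<rho> (x - y)) = c" by (simp add: c_def convolution_def)
    then show ?thesis
      using i r by (simp add: convolution_def)
  qed
  finally show ?thesis unfolding c_def[symmetric] by (simp add: power2_eq_square)
qed

text \<open>Jensen's inequality is integrated in \<open>x\<close>, and Tonelli's theorem moves the
  integration onto the kernel, which has mass one. The constant 1 matters: the bracket must not grow
  under mollification.\<close>

lemma convolution_contraction:
  fixes f :: "'a::euclidean_space \<Rightarrow> real"
  assumes m: "mollifier \<delta> \<rho>" and f: "integrable lborel f" and f2: "integrable lborel (\<lambda>x. (f x)\<^sup>2)"
  shows "integrable lborel (\<lambda>x. (convolution f \<rho> x)\<^sup>2)"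
    and "(LINT x|lborel. (convolution f \<rho> x)\<^sup>2) \<le> (LINT x|lborel. (f x)\<^sup>2)"
proof -
  have fm [measurable]: "f \<in> borel_measurable borel"
    using borel_measurable_integrable[OF f] by simp
  have rm [measurable]: "\<rho> \<in> borel_measurable borel" by (rule mollifier_measurable[OF m])
  have cm [measurable]: "convolution f \<rho> \<in> borel_measurable borel"
    using smooth_convolution[OF f mollifier_smooth[OF m] mollifier_zero[OF m]] borel_measurable_smooth by blast
  have "(\<integral>\<^sup>+x. ennreal ((convolution f \<rho> x)\<^sup>2) \<partial>lborel)
      \<le> (\<integral>\<^sup>+x. ennreal (convolution (\<lambda>y. (f y)\<^sup>2) \<rho> x) \<partial>lborel)"
    by (intro nn_integral_mono ennreal_leI convolution_square_le[OF m f f2])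
  also have "\<dots> = (\<integral>\<^sup>+x. \<integral>\<^sup>+y. ennreal ((f y)\<^sup>2 * \<rho> (x - y)) \<partial>lborel \<partial>lborel)"
  proof (intro nn_integral_cong)
    fix x
    have "integrable lborel (\<lambda>y. (f y)\<^sup>2 * \<rho> (x - y))"
      by (rule integrable_convolution_kernel[OF f2 mollifier_continuous[OF m] mollifier_zero[OF m]])
    then show "ennreal (convolution (\<lambda>y. (f y)\<^sup>2) \<rho> x) = (\<integral>\<^sup>+y. ennreal ((f y)\<^sup>2 * \<rho> (x - y)) \<partial>lborel)"
      unfolding convolution_def
      by (intro nn_integral_eq_integral[symmetric]) (auto simp: mollifier_nonneg[OF m])
  qed
  also have "\<dots> = (\<integral>\<^sup>+y. \<integral>\<^sup>+x. ennreal ((f y)\<^sup>2 * \<rho> (x - y)) \<partial>lborel \<partial>lborel)"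
    by (rule lborel_pair.Fubini'[where f = "\<lambda>y x. ennreal ((f y)\<^sup>2 * \<rho> (x - y))"]) measurable
  also have "\<dots> = (\<integral>\<^sup>+y. ennreal ((f y)\<^sup>2) * (\<integral>\<^sup>+x. ennreal (\<rho> (x - y)) \<partial>lborel) \<partial>lborel)"
    by (intro nn_integral_cong, subst nn_integral_cmult[symmetric])
      (auto simp: ennreal_mult'' mollifier_nonneg[OF m])
  also have "\<dots> = (\<integral>\<^sup>+y. ennreal ((f y)\<^sup>2) \<partial>lborel)"
    by (simp add: nn_integral_mollifier_shift[OF m])
  also have "\<dots> = ennreal (LINT y|lborel. (f y)\<^sup>2)"
    by (rule nn_integral_eq_integral[OF f2]) simp
  finally have le: "(\<integral>\<^sup>+x. ennreal ((convolution f \<rho> x)\<^sup>2) \<partial>lborel) \<le> ennreal (LINT y|lborel. (f y)\<^sup>2)" .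
  show i: "integrable lborel (\<lambda>x. (convolution f \<rho> x)\<^sup>2)"
    by (rule integrableI_bounded) (use le in \<open>auto simp: order_le_less_trans\<close>)
  have "ennreal (LINT x|lborel. (convolution f \<rho> x)\<^sup>2) \<le> ennreal (LINT y|lborel. (f y)\<^sup>2)"
    using le by (subst nn_integral_eq_integral[OF i, symmetric]) auto
  then show "(LINT x|lborel. (convolution f \<rho> x)\<^sup>2) \<le> (LINT x|lborel. (f x)\<^sup>2)"
    by (simp add: ennreal_le_iff)
qed

lemma integrable_of_square_integrable:
  fixes f :: "'a::euclidean_space \<Rightarrow> real"
  assumes [measurable]: "f \<in> borel_measurable borel" and f2: "integrable lborel (\<lambda>x. (f x)\<^sup>2)"
    and z: "\<And>x. R \<le> norm x \<Longrightarrow> f x = 0"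
  shows "integrable lborel f"
proof (rule Bochner_Integration.integrable_bound)
  have "integrable lborel (\<lambda>x. indicator (cball (0::'a) R) x :: real)"
    using emeasure_lborel_cball_finite[of "0::'a" R] by (simp add: integrable_indicator_iff top.not_eq_extremum)
  then show "integrable lborel (\<lambda>x. (f x)\<^sup>2 + indicator (cball 0 R) x)"
    using f2 by simp
  show "AE x in lborel. norm (f x) \<le> norm ((f x)\<^sup>2 + indicator (cball 0 R) x)"
  proof (intro AE_I2)
    fix x
    have "\<bar>f x\<bar> \<le> (f x)\<^sup>2 + 1"
      using zero_le_power2[of "\<bar>f x\<bar> - 1"] by (simp add: power2_diff)
    then show "norm (f x) \<le> norm ((f x)\<^sup>2 + indicator (cball 0 R) x)"
      using z[of x] by (cases "norm x \<le> R") (auto simp: indicator_def)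
  qed
qed simp

lemma integrable_square_add:
  fixes f g :: "'a \<Rightarrow> real"
  assumes [measurable]: "f \<in> borel_measurable M" "g \<in> borel_measurable M"
    and "integrable M (\<lambda>x. (f x)\<^sup>2)" "integrable M (\<lambda>x. (g x)\<^sup>2)"
  shows "integrable M (\<lambda>x. (f x + g x)\<^sup>2)" "integrable M (\<lambda>x. (f x - g x)\<^sup>2)"
proof -
  have le: "(a + b)\<^sup>2 \<le> 2 * a\<^sup>2 + 2 * b\<^sup>2" "(a - b)\<^sup>2 \<le> 2 * a\<^sup>2 + 2 * b\<^sup>2" for a b :: real
    using zero_le_power2[of "a - b"] zero_le_power2[of "a + b"] by (simp_all add: power2_eq_square algebra_simps)
  have i: "integrable M (\<lambda>x. 2 * (f x)\<^sup>2 + 2 * (g x)\<^sup>2)" using assms by simp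
  show "integrable M (\<lambda>x. (f x + g x)\<^sup>2)"
    by (rule Bochner_Integration.integrable_bound[OF i]) (use le(1) in auto)
  show "integrable M (\<lambda>x. (f x - g x)\<^sup>2)"
    by (rule Bochner_Integration.integrable_bound[OF i]) (use le(2) in auto)
qed

text \<open>Truncation at a height \<open>B\<close> reduces to bounded functions; these are almost
  everywhere limits of continuous ones, and dominated convergence applies once the latter are
  truncated and cut off too. Each of the two errors below \<open>\<eta> / 4\<close> is doubled when
  the square of the sum is split.\<close>

lemma L2_continuous_dense:
  fixes f :: "'a::euclidean_space \<Rightarrow> real"
  assumes fm [measurable]: "f \<in> borel_measurable borel" and f2: "integrable lborel (\<lambda>x. (f x)\<^sup>2)"
    and z: "\<And>x. R \<le> norm x \<Longrightarrow> f x = 0" and e: "\<eta> > 0"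
  obtains \<phi> where "continuous_on UNIV \<phi>" "\<And>x. R + 1 \<le> norm x \<Longrightarrow> \<phi> x = 0"
    "integrable lborel (\<lambda>x. (f x - \<phi> x)\<^sup>2)" "(LINT x|lborel. (f x - \<phi> x)\<^sup>2) < \<eta>"
proof -
  define T where "T B t = max (- real B) (min (real B) t)" for B :: nat and t :: real
  have T_le: "(t - T B t)\<^sup>2 \<le> t\<^sup>2" for t B
    by (rule abs_le_square_iff[THEN iffD1]) (auto simp: T_def)
  have Tm [measurable]: "(\<lambda>x. T B (f x)) \<in> borel_measurable borel" for B
    unfolding T_def by measurable
  have Tb: "\<bar>T B t\<bar> \<le> real B" for B t by (auto simp: T_def)
  have "(\<lambda>B. LINT x|lborel. (f x - T B (f x))\<^sup>2) \<longlonglongrightarrow> (LINT x|(lborel::'a measure). 0)"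
  proof (rule integral_dominated_convergence[OF _ _ f2])
    show "AE x in lborel. (\<lambda>B. (f x - T B (f x))\<^sup>2) \<longlonglongrightarrow> 0"
    proof (intro AE_I2 tendsto_eventually)
      fix x
      show "eventually (\<lambda>B. (f x - T B (f x))\<^sup>2 = 0) sequentially"
        unfolding eventually_sequentially
      proof (intro exI allI impI)
        fix B assume "nat \<lceil>\<bar>f x\<bar>\<rceil> \<le> B"
        then have "\<bar>f x\<bar> \<le> real B" by linarith
        then have "T B (f x) = f x" unfolding T_def by linarith
          then show "(f x - T B (f x))\<^sup>2 = 0" by simp
      qed
    qed
    show "AE x in lborel. norm ((f x - T B (f x))\<^sup>2) \<le> (f x)\<^sup>2" for B
      using T_le by simp
  qed measurable
  then have "eventually (\<lambda>B. (LINT x|lborel. (f x - T B (f x))\<^sup>2) < \<eta> / 4) sequentially"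
    using e by (intro order_tendstoD(2)) auto
  then obtain B where B: "(LINT x|lborel. (f x - T B (f x))\<^sup>2) < \<eta> / 4"
    unfolding eventually_sequentially by blast
  define h where "h x = T B (f x)" for x
  have hm [measurable]: "h \<in> borel_measurable borel" unfolding h_def by measurable
  have hz: "h x = 0" if "R \<le> norm x" for x using z[OF that] by (simp add: h_def T_def)
  have i1: "integrable lborel (\<lambda>x. (f x - h x)\<^sup>2)"
    by (rule Bochner_Integration.integrable_bound[OF f2]) (use T_le in \<open>auto simp: h_def\<close>)
  have "h \<in> borel_measurable lebesgue" using hm by (intro measurable_completion) simp
  then have "h measurable_on UNIV" by (rule lebesgue_measurable_imp_measurable_on_real) simp
  then obtain N g where N: "negligible N" and gc: "\<And>n. continuous_on UNIV (g n)"
    and g: "\<And>x. x \<notin> N \<Longrightarrow> (\<lambda>n. g n x) \<longlonglongrightarrow> h x"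
    unfolding measurable_on_def by auto
  \<comment> \<open>A continuous tent, 1 where \<open>h\<close> can be nonzero and 0 from norm
    \<open>R + 1\<close> on. Together with \<open>T B\<close> it gives all \<open>k n\<close> one
    integrable bound without disturbing the limit, because the values of \<open>h\<close> are fixed
    by \<open>T B\<close>.\<close>
  define \<theta> where "\<theta> x = max 0 (min 1 (R + 1 - norm x))" for x :: 'a
  define k where "k n x = \<theta> x * T B (g n x)" for n x
  have kc: "continuous_on UNIV (k n)" for n
    unfolding k_def \<theta>_def T_def by (intro continuous_intros gc)
  have km [measurable]: "k n \<in> borel_measurable borel" for n
    using kc borel_measurable_continuous_onI by blast
  have \<theta>: "0 \<le> \<theta> x" "\<theta> x \<le> 1" for x by (auto simp: \<theta>_def)
  have kz: "k n x = 0" if "R + 1 \<le> norm x" for n x using that by (simp add: k_def \<theta>_def)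
  have kb: "\<bar>k n x\<bar> \<le> real B" for n x
    using mult_mono[of "\<theta> x" 1 "\<bar>T B (g n x)\<bar>" "real B"] \<theta>[of x] Tb[of B "g n x"] by (simp add: k_def abs_mult)
  have dom: "(h x - k n x)\<^sup>2 \<le> (2 * real B)\<^sup>2 * indicator (cball 0 (R + 1)) x" for n x
  proof (cases "norm x \<le> R + 1")
    case True
    have "\<bar>h x - k n x\<bar> \<le> \<bar>2 * real B\<bar>" using Tb[of B "f x"] kb[of n x] unfolding h_def by linarith
    then have "(h x - k n x)\<^sup>2 \<le> (2 * real B)\<^sup>2" by (rule abs_le_square_iff[THEN iffD1])
    then show ?thesis using True by (simp add: indicator_def)
  next
    case False
    then show ?thesis using hz[of x] kz[of x n] by (simp add: indicator_def)
  qed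
  have iw: "integrable lborel (\<lambda>x. (2 * real B)\<^sup>2 * indicator (cball (0::'a) (R + 1)) x)"
    using emeasure_lborel_cball_finite[of "0::'a" "R + 1"] by (simp add: integrable_indicator_iff top.not_eq_extremum)
  have i2: "integrable lborel (\<lambda>x. (h x - k n x)\<^sup>2)" for n
    by (rule Bochner_Integration.integrable_bound[OF iw]) (use dom in auto)
  have "(\<lambda>n. LINT x|lborel. (h x - k n x)\<^sup>2) \<longlonglongrightarrow> (LINT x|(lborel::'a measure). 0)"
  proof (rule integral_dominated_convergence[OF _ _ iw])
    have "AE x in lborel. x \<notin> N"
      using N by (auto simp: negligible_iff_null_sets intro: AE_not_in AE_completion_iff[THEN iffD1])
    then show "AE x in lborel. (\<lambda>n. (h x - k n x)\<^sup>2) \<longlonglongrightarrow> 0"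
    proof eventually_elim
      case (elim x)
      have "T B (h x) = h x" using Tb[of B "f x"] by (auto simp: h_def T_def)
      moreover have "(\<lambda>n. T B (g n x)) \<longlonglongrightarrow> T B (h x)"
        unfolding T_def by (intro tendsto_intros g elim)
      ultimately have "(\<lambda>n. k n x) \<longlonglongrightarrow> \<theta> x * h x"
        unfolding k_def by (intro tendsto_intros) simp
      moreover have "\<theta> x * h x = h x"
        using hz[of x] by (cases "R \<le> norm x") (auto simp: \<theta>_def)
      ultimately have "(\<lambda>n. (h x - k n x)\<^sup>2) \<longlonglongrightarrow> (h x - h x)\<^sup>2"
        by (intro tendsto_intros) simp
      then show ?case by simp
    qed
    show "AE x in lborel. norm ((h x - k n x)\<^sup>2) \<le> (2 * real B)\<^sup>2 * indicator (cball 0 (R + 1)) x" for n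
      using dom by simp
  qed measurable
  then have "eventually (\<lambda>n. (LINT x|lborel. (h x - k n x)\<^sup>2) < \<eta> / 4) sequentially"
    using e by (intro order_tendstoD(2)) auto
  then obtain n where n: "(LINT x|lborel. (h x - k n x)\<^sup>2) < \<eta> / 4"
    unfolding eventually_sequentially by blast
  have le: "(f x - k n x)\<^sup>2 \<le> 2 * (f x - h x)\<^sup>2 + 2 * (h x - k n x)\<^sup>2" for x
    using zero_le_power2[of "(f x - h x) - (h x - k n x)"] by (simp add: power2_eq_square algebra_simps)
  have iu: "integrable lborel (\<lambda>x. 2 * (f x - h x)\<^sup>2 + 2 * (h x - k n x)\<^sup>2)"
    using i1 i2 by simp
  have i3: "integrable lborel (\<lambda>x. (f x - k n x)\<^sup>2)"
    by (rule Bochner_Integration.integrable_bound[OF iu]) (use le in auto)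
  have "(LINT x|lborel. (f x - k n x)\<^sup>2) \<le> (LINT x|lborel. 2 * (f x - h x)\<^sup>2 + 2 * (h x - k n x)\<^sup>2)"
    by (rule integral_mono[OF i3 iu le])
  also have "\<dots> = 2 * (LINT x|lborel. (f x - h x)\<^sup>2) + 2 * (LINT x|lborel. (h x - k n x)\<^sup>2)"
    using i1 i2 by simp
  also have "\<dots> < \<eta>" using B n by (simp add: h_def)
  finally have "(LINT x|lborel. (f x - k n x)\<^sup>2) < \<eta>" .
  from that[OF kc kz i3 this] show ?thesis .
qed

lemma convolution_converges_uniformly:
  fixes \<phi> :: "'a::euclidean_space \<Rightarrow> real"
  assumes c: "continuous_on UNIV \<phi>" and z: "\<And>x. R \<le> norm x \<Longrightarrow> \<phi> x = 0" and e: "e > 0"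
  shows "\<exists>\<delta>0>0. \<forall>\<delta>\<le>\<delta>0. \<forall>\<rho>. mollifier \<delta> \<rho> \<longrightarrow> (\<forall>x. \<bar>\<phi> x - convolution \<phi> \<rho> x\<bar> \<le> e)"
proof -
  obtain d where d: "d > 0" "\<And>x y. norm (y - x) < d \<Longrightarrow> \<bar>\<phi> y - \<phi> x\<bar> < e"
    using compact_support_uniformly_continuous[OF c z e] by metis
  have fi: "integrable lborel \<phi>"
    by (rule compact_support_integrable[OF c, where K = "cball 0 R"]) (use z in auto)
  show ?thesis
  proof (intro exI[of _ d] conjI allI impI d(1))
    fix \<delta> x and \<rho> :: "'a \<Rightarrow> real" assume \<delta>: "\<delta> \<le> d" and m: "mollifier \<delta> \<rho>"
    note r = mollifier_reflected[OF m, of x]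
    have i: "integrable lborel (\<lambda>y. \<phi> y * \<rho> (x - y))"
      by (rule integrable_convolution_kernel[OF fi mollifier_continuous[OF m] mollifier_zero[OF m]])
    have "\<phi> x - convolution \<phi> \<rho> x = (LINT y|lborel. \<phi> x * \<rho> (x - y) - \<phi> y * \<rho> (x - y))"
      using i r by (simp add: convolution_def)
    also have "\<bar>\<dots>\<bar> \<le> (LINT y|lborel. e * \<rho> (x - y))"
    proof (rule order_trans[OF integral_abs_bound integral_mono])
      show "integrable lborel (\<lambda>y. \<bar>\<phi> x * \<rho> (x - y) - \<phi> y * \<rho> (x - y)\<bar>)"
        using i r by simp
      show "integrable lborel (\<lambda>y. e * \<rho> (x - y))" using r by simp
      fix y
      show "\<bar>\<phi> x * \<rho> (x - y) - \<phi> y * \<rho> (x - y)\<bar> \<le> e * \<rho> (x - y)"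
      proof (cases "norm (x - y) < \<delta>")
        case True
        then have "\<bar>\<phi> x - \<phi> y\<bar> \<le> e" using d(2)[of x y] \<delta> by auto
        then have "\<bar>\<phi> x - \<phi> y\<bar> * \<rho> (x - y) \<le> e * \<rho> (x - y)"
          using mollifier_nonneg[OF m] by (rule mult_right_mono)
        then show ?thesis
          using mollifier_nonneg[OF m, of "x - y"] by (simp add: left_diff_distrib[symmetric] abs_mult)
      next
        case False
        then show ?thesis using mollifier_zero[OF m, of "x - y"] by simp
      qed
    qed
    also have "\<dots> = e" using r by simp
    finally show "\<bar>\<phi> x - convolution \<phi> \<rho> x\<bar> \<le> e" .
  qed
qed

lemma convolution_zero_outside:
  fixes \<phi> :: "'a::euclidean_space \<Rightarrow> real"
  assumes m: "mollifier \<delta> \<rho>" and z: "\<And>x. R \<le> norm x \<Longrightarrow> \<phi> x = 0" and x: "R + \<delta> \<le> norm x"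
  shows "convolution \<phi> \<rho> x = 0"
proof -
  have "\<phi> y * \<rho> (x - y) = 0" for y
  proof (cases "R \<le> norm y")
    case False
    then have "\<delta> \<le> norm (x - y)" using x norm_triangle_ineq2[of x y] by linarith
    then show ?thesis using mollifier_zero[OF m] by simp
  qed (use z in simp)
  then show ?thesis unfolding convolution_def by (simp only: Bochner_Integration.integral_zero)
qed

text \<open>With a continuous \<phi> close to \<open>f\<close> the difference is
  \<open>d - q + p\<close>, where \<open>d = f - \<phi>\<close>, \<open>q\<close> is the
  mollification of \<open>d\<close>, and \<open>p\<close> is the mollification error of \<phi>. The
  first two are small by density and contraction, the third uniformly on a fixed ball.\<close>

lemma convolution_converges_L2:
  fixes f :: "'a::euclidean_space \<Rightarrow> real"
  assumes fm: "f \<in> borel_measurable borel" and f2: "integrable lborel (\<lambda>x. (f x)\<^sup>2)"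
    and z: "\<And>x. R \<le> norm x \<Longrightarrow> f x = 0" and e: "\<eta> > 0"
  shows "\<exists>\<delta>0>0. \<forall>\<delta>\<le>\<delta>0. \<forall>\<rho>. mollifier \<delta> \<rho> \<longrightarrow>
     integrable lborel (\<lambda>x. (f x - convolution f \<rho> x)\<^sup>2) \<and>
     (LINT x|lborel. (f x - convolution f \<rho> x)\<^sup>2) < \<eta>"
proof -
  have f: "integrable lborel f" by (rule integrable_of_square_integrable[OF fm f2 z])
  obtain \<phi> where c: "continuous_on UNIV \<phi>" and \<phi>z: "\<And>x. R + 1 \<le> norm x \<Longrightarrow> \<phi> x = 0"
    and d2: "integrable lborel (\<lambda>x. (f x - \<phi> x)\<^sup>2)" and dl: "(LINT x|lborel. (f x - \<phi> x)\<^sup>2) < \<eta> / 9"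
    by (rule L2_continuous_dense[OF fm f2 z, where \<eta> = "\<eta> / 9"]) (use e in auto)
  have \<phi>i: "integrable lborel \<phi>"
    by (rule compact_support_integrable[OF c, where K = "cball 0 (R + 1)"]) (use \<phi>z in auto)
  define d where "d x = f x - \<phi> x" for x
  have di: "integrable lborel d" unfolding d_def using f \<phi>i by simp
  have d2: "integrable lborel (\<lambda>x. (d x)\<^sup>2)" and dl: "(LINT x|lborel. (d x)\<^sup>2) < \<eta> / 9"
    using d2 dl by (simp_all add: d_def)
  define V where "V = measure lborel (cball (0::'a) (R + 2))"
  have V: "V \<ge> 0" by (simp add: V_def)
  \<comment> \<open>Chosen so that \<open>e\<^sup>2\<close> times the volume of the ball is at most
    \<open>\<eta> / 18\<close>; the three parts then sum to less than
    \<open>3 * (\<eta> / 9 + \<eta> / 9 + \<eta> / 18)\<close>, which is below \<eta>.\<close>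
  define e where "e = sqrt (\<eta> / (18 * (V + 1)))"
  have e0: "e > 0" using V assms(4) by (simp add: e_def)
  have "V * \<eta> \<le> \<eta> * (V + 1)" using assms(4) by (simp add: algebra_simps)
  then have eV: "e\<^sup>2 * V \<le> \<eta> / 18" using V assms(4) by (simp add: e_def field_simps)
  obtain \<delta>0 where \<delta>0: "\<delta>0 > 0" "\<And>\<delta> \<rho> x. \<delta> \<le> \<delta>0 \<Longrightarrow> mollifier \<delta> \<rho> \<Longrightarrow> \<bar>\<phi> x - convolution \<phi> \<rho> x\<bar> \<le> e"
    using convolution_converges_uniformly[OF c \<phi>z e0] by metis
  show ?thesis
  proof (intro exI[of _ "min \<delta>0 1"] conjI allI impI)
    show "min \<delta>0 1 > 0" using \<delta>0 by simp
    fix \<delta> and \<rho> :: "'a \<Rightarrow> real" assume \<delta>: "\<delta> \<le> min \<delta>0 1" and m: "mollifier \<delta> \<rho>"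
    note ker = integrable_convolution_kernel[OF _ mollifier_continuous[OF m] mollifier_zero[OF m]]
    define p where "p x = \<phi> x - convolution \<phi> \<rho> x" for x
    define q where "q x = convolution d \<rho> x" for x
    have dec: "f x - convolution f \<rho> x = d x - q x + p x" for x
      using ker[OF f, where x = x] ker[OF \<phi>i, where x = x]
      by (simp add: d_def p_def q_def convolution_def left_diff_distrib)
    note s = smooth_convolution[OF _ mollifier_smooth[OF m] mollifier_zero[OF m]]
    have qm [measurable]: "q \<in> borel_measurable borel"
      unfolding q_def using s[OF di] borel_measurable_smooth by blast
    have dm [measurable]: "d \<in> borel_measurable borel" using borel_measurable_integrable[OF di] by simp
    have pm [measurable]: "p \<in> borel_measurable borel"
      unfolding p_def using s[OF \<phi>i] borel_measurable_smooth borel_measurable_continuous_onI[OF c]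
      by (intro borel_measurable_diff) auto
    have q2: "integrable lborel (\<lambda>x. (q x)\<^sup>2)" "(LINT x|lborel. (q x)\<^sup>2) < \<eta> / 9"
      using convolution_contraction[OF m di d2] dl unfolding q_def by auto
    have pb: "(p x)\<^sup>2 \<le> e\<^sup>2 * indicator (cball 0 (R + 2)) x" for x
    proof (cases "norm x \<le> R + 2")
      case True
      then show ?thesis using \<delta>0(2)[OF _ m, of x] \<delta> e0
        by (simp add: p_def power2_le_iff_abs_le)
    next
      case False
      then have "p x = 0"
        using convolution_zero_outside[OF m \<phi>z, where x = x] \<phi>z[of x] \<delta> by (simp add: p_def)
      then show ?thesis by simp
    qed
    have iw: "integrable lborel (\<lambda>x. e\<^sup>2 * indicator (cball (0::'a) (R + 2)) x)"
      using emeasure_lborel_cball_finite[of "0::'a" "R + 2"] by (simp add: integrable_indicator_iff top.not_eq_extremum)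
    have p2: "integrable lborel (\<lambda>x. (p x)\<^sup>2)"
      by (rule Bochner_Integration.integrable_bound[OF iw]) (use pb in auto)
    have "(LINT x|lborel. (p x)\<^sup>2) \<le> (LINT x|lborel. e\<^sup>2 * indicator (cball (0::'a) (R + 2)) x)"
      by (rule integral_mono[OF p2 iw pb])
    also have "\<dots> = e\<^sup>2 * V" by (simp add: V_def)
    finally have pl: "(LINT x|lborel. (p x)\<^sup>2) \<le> \<eta> / 18" using eV by linarith
    have le: "(d x - q x + p x)\<^sup>2 \<le> 3 * (d x)\<^sup>2 + 3 * (q x)\<^sup>2 + 3 * (p x)\<^sup>2" for x
      using zero_le_power2[of "d x + q x"] zero_le_power2[of "d x - p x"] zero_le_power2[of "q x + p x"]
      by (simp add: power2_eq_square algebra_simps)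
    have iu: "integrable lborel (\<lambda>x. 3 * (d x)\<^sup>2 + 3 * (q x)\<^sup>2 + 3 * (p x)\<^sup>2)" using d2 q2 p2 by simp
    show i3: "integrable lborel (\<lambda>x. (f x - convolution f \<rho> x)\<^sup>2)"
      unfolding dec by (rule Bochner_Integration.integrable_bound[OF iu]) (use le in auto)
    have "(LINT x|lborel. (f x - convolution f \<rho> x)\<^sup>2) \<le> (LINT x|lborel. 3 * (d x)\<^sup>2 + 3 * (q x)\<^sup>2 + 3 * (p x)\<^sup>2)"
      using i3 unfolding dec by (rule integral_mono[OF _ iu le])
    also have "\<dots> = 3 * (LINT x|lborel. (d x)\<^sup>2) + 3 * (LINT x|lborel. (q x)\<^sup>2) + 3 * (LINT x|lborel. (p x)\<^sup>2)"
      using d2 q2 p2 by simp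
    also have "\<dots> < \<eta>" using dl q2(2) pl assms(4) by linarith
    finally show "(LINT x|lborel. (f x - convolution f \<rho> x)\<^sup>2) < \<eta>" .
  qed
qed

section \<open>Weak derivatives\<close>

text \<open>Elements of \<open>L\<^sup>2(U)\<close> are only Lebesgue measurable, whereas Tonelli's theorem for convolutions
  asks for Borel measurability; hence the passage to a Borel function extended by zero.\<close>

definition borel_rep :: "'a::euclidean_space set \<Rightarrow> ('a \<Rightarrow> real) \<Rightarrow> ('a \<Rightarrow> real) \<Rightarrow> bool" where
  "borel_rep U f f0 \<longleftrightarrow> f0 \<in> borel_measurable borel \<and> (\<forall>x. x \<notin> U \<longrightarrow> f0 x = 0) \<and>
     (AE x in lborel. x \<in> U \<longrightarrow> f x = f0 x)"

lemma borel_rep_integral: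
  assumes U: "open U" and f: "f \<in> borel_measurable (lebesgue_on U)" and r: "borel_rep U f f0"
  shows "integrable (lebesgue_on U) f \<longleftrightarrow> integrable lborel f0"
    and "(LINT x|lebesgue_on U. f x) = (LINT x|lborel. f0 x)"
proof -
  have Us: "U \<inter> space lebesgue \<in> sets lebesgue"
    using U by (simp add: borel_open)
  have m1: "(\<lambda>x. indicator U x *\<^sub>R f x) \<in> borel_measurable lebesgue"
    using f borel_measurable_restrict_space_iff[OF Us] by blast
  have m2: "f0 \<in> borel_measurable lborel" using r by (simp add: borel_rep_def)
  have m3: "f0 \<in> borel_measurable lebesgue" using m2 measurable_completion by blast
  have ae: "AE x in lebesgue. indicator U x *\<^sub>R f x = f0 x"
    using r unfolding borel_rep_def by (intro AE_completion) (auto elim!: eventually_mono simp: indicator_def)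
  show "integrable (lebesgue_on U) f \<longleftrightarrow> integrable lborel f0"
    unfolding integrable_restrict_space[OF Us] integrable_cong_AE[OF m1 m3 ae]
    by (rule integrable_completion[OF m2])
  show "(LINT x|lebesgue_on U. f x) = (LINT x|lborel. f0 x)"
    unfolding integral_restrict_space[OF Us] integral_cong_AE[OF m1 m3 ae]
    by (rule integral_completion[OF m2])
qed

lemma borel_rep_exists:
  assumes U: "open U" and f: "f \<in> borel_measurable (lebesgue_on U)"
  obtains f0 where "borel_rep U f f0"
proof -
  have Us: "U \<inter> space lebesgue \<in> sets lebesgue" using U by (simp add: borel_open)
  have "(\<lambda>x. indicator U x *\<^sub>R f x) \<in> borel_measurable lebesgue"
    using f borel_measurable_restrict_space_iff[OF Us] by blast
  from completion_ex_borel_measurable_real[OF this]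
  obtain g where g: "g \<in> borel_measurable lborel" "AE x in lborel. indicator U x *\<^sub>R f x = g x" by blast
  have "borel_rep U f (\<lambda>x. indicator U x * g x)"
    unfolding borel_rep_def
  proof (intro conjI)
    have [measurable]: "U \<in> sets borel" "g \<in> borel_measurable borel" using U g(1) by auto
    show "(\<lambda>x. indicator U x * g x) \<in> borel_measurable borel" by measurable
    show "AE x in lborel. x \<in> U \<longrightarrow> f x = indicator U x * g x"
      using g(2) by eventually_elim auto
  qed auto
  then show ?thesis by (rule that)
qed

lemma borel_rep_square: "borel_rep U f f0 \<Longrightarrow> borel_rep U (\<lambda>x. (f x)\<^sup>2) (\<lambda>x. (f0 x)\<^sup>2)"
  unfolding borel_rep_def by (auto elim!: eventually_mono)

lemma borel_rep_mult:
  "borel_rep U f f0 \<Longrightarrow> \<psi> \<in> borel_measurable borel \<Longrightarrow> borel_rep U (\<lambda>x. f x * \<psi> x) (\<lambda>x. f0 x * \<psi> x)"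
  unfolding borel_rep_def by (auto elim!: eventually_mono)

lemma borel_rep_add:
  "borel_rep U f f0 \<Longrightarrow> borel_rep U g g0 \<Longrightarrow> borel_rep U (\<lambda>x. f x + g x) (\<lambda>x. f0 x + g0 x)"
  unfolding borel_rep_def by (auto elim!: eventually_elim2)

lemma borel_rep_diff:
  "borel_rep U f f0 \<Longrightarrow> borel_rep U g g0 \<Longrightarrow> borel_rep U (\<lambda>x. f x - g x) (\<lambda>x. f0 x - g0 x)"
  unfolding borel_rep_def by (auto elim!: eventually_elim2)

lemma borel_measurable_lebesgue_on_of_borel:
  fixes \<psi> :: "'a::euclidean_space \<Rightarrow> real"
  assumes "\<psi> \<in> borel_measurable borel"
  shows "\<psi> \<in> borel_measurable (lebesgue_on U)"
proof -
  have "\<psi> \<in> borel_measurable lebesgue"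
    using assms by (intro measurable_completion) simp
  then show ?thesis by (rule measurable_restrict_space1)
qed

lemma L2_borel_rep:
  assumes U: "open U" and f: "f \<in> L2 U" and r: "borel_rep U f f0"
  shows "f0 \<in> borel_measurable borel" "integrable lborel (\<lambda>x. (f0 x)\<^sup>2)" "(L2_norm U f)\<^sup>2 = (LINT x|lborel. (f0 x)\<^sup>2)"
proof -
  have m: "(\<lambda>x. (f x)\<^sup>2) \<in> borel_measurable (lebesgue_on U)" using f by (auto simp: L2_def intro: borel_measurable_power)
  note * = borel_rep_integral[OF U m borel_rep_square[OF r]]
  show "f0 \<in> borel_measurable borel" using r by (simp add: borel_rep_def)
  show "integrable lborel (\<lambda>x. (f0 x)\<^sup>2)" using * f by (simp add: L2_def)
  show "(L2_norm U f)\<^sup>2 = (LINT x|lborel. (f0 x)\<^sup>2)"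
    unfolding L2_norm_def *(2)[symmetric] by (intro real_sqrt_pow2 integral_nonneg_AE) auto
qed

lemma L2_borel_rep_integrable:
  assumes "open U" "U \<subseteq> ball 0 R" "f \<in> L2 U" "borel_rep U f f0"
  shows "integrable lborel f0"
proof (rule integrable_of_square_integrable[OF L2_borel_rep(1,2)[OF assms(1,3,4)]])
  show "f0 x = 0" if "R \<le> norm x" for x
  proof -
    have "x \<notin> U" using assms(2) that by auto
    then show ?thesis using assms(4) by (simp add: borel_rep_def)
  qed
qed

lemma L2_integral_mult:
  assumes U: "open U" and f: "f \<in> L2 U" and r: "borel_rep U f f0" and [measurable]: "\<psi> \<in> borel_measurable borel"
  shows "(LINT x|lebesgue_on U. f x * \<psi> x) = (LINT x|lborel. f0 x * \<psi> x)"
proof -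
  have "(\<lambda>x. f x * \<psi> x) \<in> borel_measurable (lebesgue_on U)"
    using f borel_measurable_lebesgue_on_of_borel[OF assms(4)]
    by (intro borel_measurable_times) (auto simp: L2_def)
  then show ?thesis by (rule borel_rep_integral(2)[OF U _ borel_rep_mult[OF r assms(4)]])
qed

lemma L2_add_diff:
  assumes "f \<in> L2 U" "g \<in> L2 U"
  shows "(\<lambda>x. f x + g x) \<in> L2 U" "(\<lambda>x. f x - g x) \<in> L2 U"
  using assms integrable_square_add[of f "lebesgue_on U" g] by (auto simp: L2_def)

lemma mollifier_test_function:
  fixes \<rho> :: "'a::euclidean_space \<Rightarrow> real"
  assumes m: "mollifier \<delta> \<rho>" and "cball x \<delta> \<subseteq> U"
  shows "(\<lambda>y. \<rho> (x - y)) \<in> test_functions U"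
proof -
  have s: "smooth (\<lambda>y. \<rho> (x - y))"
    using smooth_compose_affine[OF mollifier_smooth[OF m] bounded_linear_minus[OF bounded_linear_ident], of x] by simp
  have c: "closure {y. \<rho> (x - y) \<noteq> 0} \<subseteq> cball x \<delta>"
  proof (rule closure_minimal)
    show "{y. \<rho> (x - y) \<noteq> 0} \<subseteq> cball x \<delta>"
      using m by (auto simp: mollifier_def dist_norm intro: less_imp_le)
  qed simp
  then have "compact (closure {y. \<rho> (x - y) \<noteq> 0})"
    using closed_Int_compact[OF closed_closure compact_cball] by (metis inf.absorb1)
  with s c assms(2) show ?thesis by (auto simp: test_functions_def)
qed

lemma test_function_zero_outside:
  fixes \<phi> :: "'a::euclidean_space \<Rightarrow> real"
  assumes "\<phi> \<in> test_functions U"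
  obtains R where "\<And>bs z. R \<le> norm z \<Longrightarrow> foldr partial_deriv bs \<phi> z = 0"
    "\<And>bs z. z \<notin> U \<Longrightarrow> foldr partial_deriv bs \<phi> z = 0"
proof -
  let ?K = "closure {x. \<phi> x \<noteq> 0}"
  have K: "compact ?K" "?K \<subseteq> U" using assms by (auto simp: test_functions_def)
  then obtain B where B: "\<And>x. x \<in> ?K \<Longrightarrow> norm x \<le> B"
    using compact_imp_bounded bounded_iff by metis
  have z: "foldr partial_deriv bs \<phi> z = 0" if "z \<notin> ?K" for bs and z :: 'a
    using that support_iterated_partial_deriv[of bs \<phi>] closure_subset[of "{x. foldr partial_deriv bs \<phi> x \<noteq> 0}"] by blast
  show ?thesis
  proof (rule that[of "B + 1"])
    fix bs and z :: 'a assume "B + 1 \<le> norm z"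
    then have "z \<notin> ?K" using B[of z] by force
    then show "foldr partial_deriv bs \<phi> z = 0" by (rule z)
  next
    fix bs and z :: 'a assume "z \<notin> U"
    then have "z \<notin> ?K" using K by blast
    then show "foldr partial_deriv bs \<phi> z = 0" by (rule z)
  qed
qed

text \<open>The reflected kernel is an admissible test function when the ball about \<open>x\<close>
  fits into \<open>U\<close>. Testing with it produces the sign \<open>(-1) ^ length bs\<close> on
  both sides, and what remains turns weak derivatives into classical ones.\<close>

lemma iterated_partial_deriv_mollified:
  fixes \<rho> :: "'a::euclidean_space \<Rightarrow> real"
  assumes U: "open U" "U \<subseteq> ball 0 R" and f: "f \<in> L2 U" "borel_rep U f f0" and h: "h \<in> L2 U" "borel_rep U h h0"
    and w: "has_weak_deriv U bs f h" and bs: "set bs \<subseteq> Basis"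
    and m: "mollifier \<delta> \<rho>" and x: "cball x \<delta> \<subseteq> U"
  shows "foldr partial_deriv bs (convolution f0 \<rho>) x = convolution h0 \<rho> x"
proof -
  let ?\<phi> = "\<lambda>y. \<rho> (x - y)"
  let ?s = "(-1) ^ length bs :: real"
  have t: "?\<phi> \<in> test_functions U" by (rule mollifier_test_function[OF m x])
  have s: "smooth ?\<phi>" using t by (simp add: test_functions_def)
  note f0 = L2_borel_rep_integrable[OF U f]
  have "(LINT y|lebesgue_on U. f y * foldr partial_deriv bs ?\<phi> y) = ?s * (LINT y|lebesgue_on U. h y * ?\<phi> y)"
    using w t unfolding has_weak_deriv_def by blast
  then have "(LINT y|lborel. f0 y * foldr partial_deriv bs ?\<phi> y) = ?s * (LINT y|lborel. h0 y * ?\<phi> y)"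
    using L2_integral_mult[OF U(1) f, of "foldr partial_deriv bs ?\<phi>"] L2_integral_mult[OF U(1) h, of ?\<phi>]
      borel_measurable_smooth[OF s] borel_measurable_smooth[OF smooth_iterated_partial_deriv[OF s bs]] by simp
  moreover have "(LINT y|lborel. f0 y * foldr partial_deriv bs ?\<phi> y) = ?s * convolution f0 (foldr partial_deriv bs \<rho>) x"
    unfolding convolution_def iterated_partial_deriv_reflect[OF mollifier_smooth[OF m] bs]
  proof -
    have eq: "c * (?s * d) = ?s * (c * d)" for c d :: real by simp
    show "(LINT y|lborel. f0 y * (?s * foldr partial_deriv bs \<rho> (x - y)))
        = ?s * (LINT y|lborel. f0 y * foldr partial_deriv bs \<rho> (x - y))"
      unfolding eq by simp
  qed
  ultimately have "?s * convolution f0 (foldr partial_deriv bs \<rho>) x = ?s * convolution h0 \<rho> x"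
    by (simp add: convolution_def)
  then show ?thesis
    using iterated_partial_deriv_convolution[OF f0 mollifier_smooth[OF m] mollifier_zero[OF m] bs] by simp
qed

lemma mollifier_room:
  fixes K :: "'a::euclidean_space set"
  assumes "compact K" "open U" "K \<subseteq> U"
  obtains d where "d > 0" "\<And>x. x \<in> K \<Longrightarrow> cball x d \<subseteq> U"
proof (cases "K = {}")
  case False
  have "\<exists>d>0. \<forall>x\<in>K. \<forall>y\<in>- U. d \<le> dist x y"
    by (rule separate_compact_closed) (use assms in auto)
  then obtain d where d: "d > 0" "\<And>x y. x \<in> K \<Longrightarrow> y \<notin> U \<Longrightarrow> d \<le> dist x y"
    by auto
  show ?thesis
  proof (rule that[of "d / 2"])
    show "cball x (d / 2) \<subseteq> U" if "x \<in> K" for x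
    proof
      fix y assume "y \<in> cball x (d / 2)"
      then have "dist x y < d" using d(1) by simp
      then show "y \<in> U" using d(2)[OF that, of y] by force
    qed
  qed (use d in simp)
qed (use that[of 1] in auto)

text \<open>The fundamental lemma of the calculus of variations. With reflected kernels as test
  functions, the mollifications of \<open>h0\<close> vanish on a given compact subset of
  \<open>U\<close> while converging to \<open>h0\<close> in mean square; countably many compact sets
  exhaust \<open>U\<close>.\<close>

lemma weakly_zero_imp_AE_zero:
  fixes h :: "'a::euclidean_space \<Rightarrow> real"
  assumes U: "open U" "U \<subseteq> ball 0 R" and h: "h \<in> L2 U" "borel_rep U h h0"
    and 0: "\<And>\<phi>. \<phi> \<in> test_functions U \<Longrightarrow> (LINT x|lebesgue_on U. h x * \<phi> x) = 0"
  shows "AE x in lborel. h0 x = 0"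
proof -
  note h0 = L2_borel_rep[OF U(1) h]
  have [measurable]: "h0 \<in> borel_measurable borel" by (rule h0)
  have hz: "h0 x = 0" if "R \<le> norm x" for x
  proof -
    have "x \<notin> U" using U(2) that by auto
    then show ?thesis using h(2) by (simp add: borel_rep_def)
  qed
  have K0: "AE x in lborel. x \<in> K \<longrightarrow> h0 x = 0" if K: "compact K" "K \<subseteq> U" for K
  proof -
    have [measurable]: "K \<in> sets borel" using K(1) by (simp add: borel_compact)
    have i: "integrable lborel (\<lambda>x. indicator K x * (h0 x)\<^sup>2)"
      by (rule Bochner_Integration.integrable_bound[OF h0(2)]) (auto simp: indicator_def)
    obtain d where d: "d > 0" "\<And>x. x \<in> K \<Longrightarrow> cball x d \<subseteq> U" by (rule mollifier_room[OF K(1) U(1) K(2)]) blast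
    have "(LINT x|lborel. indicator K x * (h0 x)\<^sup>2) \<le> \<eta>" if \<eta>: "\<eta> > 0" for \<eta>
    proof -
      obtain \<delta>0 where \<delta>0: "\<delta>0 > 0" "\<And>\<delta> \<rho>. \<delta> \<le> \<delta>0 \<Longrightarrow> mollifier \<delta> \<rho> \<Longrightarrow>
          integrable lborel (\<lambda>x. (h0 x - convolution h0 \<rho> x)\<^sup>2) \<and> (LINT x|lborel. (h0 x - convolution h0 \<rho> x)\<^sup>2) < \<eta>"
        using convolution_converges_L2[OF h0(1,2) hz \<eta>] by metis
      define \<delta> where "\<delta> = min d \<delta>0"
      have "\<delta> > 0" using d \<delta>0 by (simp add: \<delta>_def)
      then obtain \<rho> :: "'a \<Rightarrow> real" where m: "mollifier \<delta> \<rho>" by (rule mollifier_exists)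
      have c: "integrable lborel (\<lambda>x. (h0 x - convolution h0 \<rho> x)\<^sup>2)" "(LINT x|lborel. (h0 x - convolution h0 \<rho> x)\<^sup>2) < \<eta>"
        using \<delta>0(2)[OF _ m] by (auto simp: \<delta>_def)
      have z: "convolution h0 \<rho> x = 0" if "x \<in> K" for x
      proof -
        have "cball x \<delta> \<subseteq> U" using d(2)[OF that] by (auto simp: \<delta>_def)
        then have t: "(\<lambda>y. \<rho> (x - y)) \<in> test_functions U" by (rule mollifier_test_function[OF m])
        then have "(\<lambda>y. \<rho> (x - y)) \<in> borel_measurable borel"
          by (intro borel_measurable_smooth) (simp add: test_functions_def)
        from L2_integral_mult[OF U(1) h this] 0[OF t] show ?thesis by (simp add: convolution_def)
      qed
      have "(LINT x|lborel. indicator K x * (h0 x)\<^sup>2) \<le> (LINT x|lborel. (h0 x - convolution h0 \<rho> x)\<^sup>2)"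
        by (rule integral_mono[OF i c(1)]) (use z in \<open>auto simp: indicator_def\<close>)
      then show ?thesis using c(2) by linarith
    qed
    then have "(LINT x|lborel. indicator K x * (h0 x)\<^sup>2) \<le> 0"
      by (rule field_le_epsilon[where y = 0, simplified])
    moreover have "(LINT x|lborel. indicator K x * (h0 x)\<^sup>2) \<ge> 0"
      by (intro integral_nonneg_AE) auto
    ultimately have "(LINT x|lborel. indicator K x * (h0 x)\<^sup>2) = 0" by linarith
    then have "AE x in lborel. indicator K x * (h0 x)\<^sup>2 = 0"
      using integral_nonneg_eq_0_iff_AE[OF i] by simp
    then show ?thesis by eventually_elim (auto simp: indicator_def)
  qed
  obtain C where C: "\<And>n::nat. compact (C n)" "\<And>n. C n \<subseteq> U" "\<Union>(range C) = U"
    using open_Union_compact_subsets[OF U(1)] by metis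
  have "AE x in lborel. \<forall>n. x \<in> C n \<longrightarrow> h0 x = 0"
    unfolding AE_all_countable using K0 C by blast
  then show ?thesis
  proof eventually_elim
    case (elim x)
    show ?case
    proof (cases "x \<in> U")
      case True
      then show ?thesis using C(3) elim by blast
    next
      case False
      then show ?thesis using h(2) by (simp add: borel_rep_def)
    qed
  qed
qed

text \<open>\<open>weak_deriv\<close> is a choice known only through its defining property.
  Uniqueness up to null sets transfers a representative from an explicitly known weak derivative to
  the chosen one.\<close>

lemma has_weak_deriv_unique:
  assumes U: "open U" "U \<subseteq> ball 0 R" and h: "h1 \<in> L2 U" "h2 \<in> L2 U"
    and w: "has_weak_deriv U bs f h1" "has_weak_deriv U bs f h2"
    and r: "borel_rep U h2 g"
  shows "borel_rep U h1 g"
proof -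
  obtain g1 where g1: "borel_rep U h1 g1" using borel_rep_exists[OF U(1)] h(1) unfolding L2_def by blast
  have d: "(\<lambda>x. h1 x - h2 x) \<in> L2 U" using h by (rule L2_add_diff)
  have "AE x in lborel. g1 x - g x = 0"
  proof (rule weakly_zero_imp_AE_zero[OF U d borel_rep_diff[OF g1 r]])
    fix \<phi> assume t: "\<phi> \<in> test_functions U"
    have "smooth \<phi>" using t by (simp add: test_functions_def)
    then have \<phi>m: "\<phi> \<in> borel_measurable borel" by (rule borel_measurable_smooth)
    have "(LINT x|lebesgue_on U. h1 x * \<phi> x) = (LINT x|lebesgue_on U. h2 x * \<phi> x)"
    proof -
      have "(-1) ^ length bs * (LINT x|lebesgue_on U. h1 x * \<phi> x) = (-1) ^ length bs * (LINT x|lebesgue_on U. h2 x * \<phi> x)"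
        using bspec[OF w(1)[unfolded has_weak_deriv_def] t] bspec[OF w(2)[unfolded has_weak_deriv_def] t] by (rule trans[OF sym])
      then show ?thesis by simp
    qed
    then have eq: "(LINT x|lborel. g1 x * \<phi> x) = (LINT x|lborel. g x * \<phi> x)"
      using L2_integral_mult[OF U(1) h(1) g1 \<phi>m] L2_integral_mult[OF U(1) h(2) r \<phi>m] by simp
    obtain Q where Q: "\<And>z. Q \<le> norm z \<Longrightarrow> \<phi> z = 0"
      using test_function_zero_outside[OF t] by (metis foldr.simps(1) id_apply)
    have c: "continuous_on UNIV \<phi>" using \<open>smooth \<phi>\<close> by (rule smooth_continuous_on)
    obtain B where B: "\<And>z. \<bar>\<phi> z\<bar> \<le> B" using compact_support_bounded[OF c Q] by metis
    have "integrable lborel (\<lambda>x. g1 x * \<phi> x)" "integrable lborel (\<lambda>x. g x * \<phi> x)"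
      by (rule integrable_mult_bounded[OF L2_borel_rep_integrable[OF U h(1) g1] \<phi>m B],
          rule integrable_mult_bounded[OF L2_borel_rep_integrable[OF U h(2) r] \<phi>m B])
    then have "(LINT x|lborel. (g1 x - g x) * \<phi> x) = 0"
      using eq by (simp add: left_diff_distrib)
    then show "(LINT x|lebesgue_on U. (h1 x - h2 x) * \<phi> x) = 0"
      using L2_integral_mult[OF U(1) d borel_rep_diff[OF g1 r] \<phi>m] by simp
  qed
  moreover have "AE x in lborel. x \<in> U \<longrightarrow> h1 x = g1 x" using g1 by (simp add: borel_rep_def)
  ultimately have "AE x in lborel. x \<in> U \<longrightarrow> h1 x = g x" by eventually_elim auto
  then show ?thesis using r by (simp add: borel_rep_def)
qed

section \<open>Smooth functions as elements of the Sobolev space\<close>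

lemma borel_rep_smooth:
  assumes "open U" "smooth v"
  shows "borel_rep U v (\<lambda>x. indicator U x * v x)"
proof -
  have [measurable]: "U \<in> sets borel" "v \<in> borel_measurable borel"
    using assms borel_measurable_smooth by auto
  show ?thesis by (simp add: borel_rep_def)
qed

lemma smooth_in_L2:
  fixes v :: "'a::euclidean_space \<Rightarrow> real"
  assumes U: "open U" "U \<subseteq> ball 0 R" and v: "smooth v"
  shows "v \<in> L2 U"
proof -
  have [measurable]: "v \<in> borel_measurable borel" using v by (rule borel_measurable_smooth)
  have [measurable]: "U \<in> sets borel" using U by simp
  have "integrable lborel (\<lambda>x. indicator (cball 0 R) x *\<^sub>R (v x)\<^sup>2)"
    by (rule borel_integrable_compact) (auto intro!: continuous_intros smooth_continuous_on[OF v])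
  then have i: "integrable lborel (\<lambda>x. (indicator U x * v x)\<^sup>2)"
  proof (rule Bochner_Integration.integrable_bound)
    show "AE x in lborel. norm ((indicator U x * v x)\<^sup>2) \<le> norm (indicator (cball 0 R) x *\<^sub>R (v x)\<^sup>2)"
    proof (intro AE_I2)
      fix x
      show "norm ((indicator U x * v x)\<^sup>2) \<le> norm (indicator (cball 0 R) x *\<^sub>R (v x)\<^sup>2)"
        using U(2) by (cases "x \<in> U") (auto simp: subset_iff less_imp_le)
    qed
  qed measurable
  have m: "v \<in> borel_measurable (lebesgue_on U)" by (rule borel_measurable_lebesgue_on_of_borel) measurable
  then have "integrable (lebesgue_on U) (\<lambda>x. (v x)\<^sup>2)"
    using borel_rep_integral(1)[OF U(1) _ borel_rep_square[OF borel_rep_smooth[OF U(1) v]]] i by simp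
  with m show ?thesis by (simp add: L2_def)
qed

lemma smooth_integration_by_parts:
  fixes v \<psi> :: "'a::euclidean_space \<Rightarrow> real"
  assumes v: "smooth v" and s: "smooth \<psi>" and z: "\<And>z. R \<le> norm z \<Longrightarrow> \<psi> z = 0" and b: "b \<in> Basis"
  shows "(LINT x|lborel. v x * partial_deriv b \<psi> x) = - (LINT x|lborel. partial_deriv b v x * \<psi> x)"
proof -
  have i: "integrable lborel (\<lambda>x. v x * partial_deriv b \<psi> x)"
  proof (rule compact_support_integrable[where K = "cball 0 (R + 1)"])
    show "continuous_on UNIV (\<lambda>x. v x * partial_deriv b \<psi> x)"
      by (intro smooth_continuous_on smooth_mult v smooth_partial_deriv s b)
    show "v x * partial_deriv b \<psi> x = 0" if "x \<notin> cball 0 (R + 1)" for x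
      using smooth_zero_outside_partial_deriv[of R \<psi> x b, OF z] that by simp
  qed simp
  have j: "integrable lborel (\<lambda>x. partial_deriv b v x * \<psi> x)"
  proof (rule compact_support_integrable[where K = "cball 0 R"])
    show "continuous_on UNIV (\<lambda>x. partial_deriv b v x * \<psi> x)"
      by (intro smooth_continuous_on smooth_mult v smooth_partial_deriv s b)
    show "partial_deriv b v x * \<psi> x = 0" if "x \<notin> cball 0 R" for x
      using z[of x] that by simp
  qed simp
  have "(LINT x|lborel. partial_deriv b (\<lambda>x. v x * \<psi> x) x) = 0"
    by (rule integral_partial_deriv_compact_support[where R = R]) (use v s z b in \<open>auto intro: smooth_mult\<close>)
  then show ?thesis using i j by (simp add: partial_deriv_mult[OF v s])
qed

text \<open>The derivatives are moved over one at a time, the head of \<open>bs\<close> first, so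
  they arrive on \<open>v\<close> in reversed order. Recording this as \<open>rev bs\<close> avoids
  an appeal to the symmetry of mixed partial derivatives.\<close>

lemma smooth_iterated_integration_by_parts:
  fixes v \<phi> :: "'a::euclidean_space \<Rightarrow> real"
  assumes s: "smooth \<phi>" and z: "\<And>bs z. R \<le> norm z \<Longrightarrow> foldr partial_deriv bs \<phi> z = 0"
    and v: "smooth v" and bs: "set bs \<subseteq> Basis"
  shows "(LINT x|lborel. v x * foldr partial_deriv bs \<phi> x)
     = (-1) ^ length bs * (LINT x|lborel. foldr partial_deriv (rev bs) v x * \<phi> x)"
  using v bs
proof (induction bs arbitrary: v)
  case (Cons b bs)
  have "(LINT x|lborel. v x * partial_deriv b (foldr partial_deriv bs \<phi>) x)
      = - (LINT x|lborel. partial_deriv b v x * foldr partial_deriv bs \<phi> x)"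
    by (rule smooth_integration_by_parts[OF Cons.prems(1) smooth_iterated_partial_deriv[OF s] z])
      (use Cons.prems in auto)
  also have "\<dots> = - ((-1) ^ length bs * (LINT x|lborel. foldr partial_deriv (rev bs) (partial_deriv b v) x * \<phi> x))"
    using Cons.IH[OF smooth_partial_deriv[OF Cons.prems(1)], of b] Cons.prems by simp
  finally show ?case by simp
qed simp

lemma smooth_has_weak_deriv:
  fixes v :: "'a::euclidean_space \<Rightarrow> real"
  assumes U: "open U" and v: "smooth v" and bs: "set bs \<subseteq> Basis"
  shows "has_weak_deriv U bs v (foldr partial_deriv (rev bs) v)"
  unfolding has_weak_deriv_def
proof
  fix \<phi> assume t: "\<phi> \<in> test_functions U"
  then have s: "smooth \<phi>" by (simp add: test_functions_def)
  obtain R where R: "\<And>bs z. R \<le> norm z \<Longrightarrow> foldr partial_deriv bs \<phi> z = 0"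
    "\<And>bs z. z \<notin> U \<Longrightarrow> foldr partial_deriv bs \<phi> z = 0"
    by (rule test_function_zero_outside[OF t]) blast
  have conv: "(LINT x|lebesgue_on U. w x * foldr partial_deriv cs \<phi> x) = (LINT x|lborel. w x * foldr partial_deriv cs \<phi> x)"
    if w: "smooth w" and cs: "set cs \<subseteq> Basis" for w cs
  proof (rule borel_rep_integral(2)[OF U])
    have m: "(\<lambda>x. w x * foldr partial_deriv cs \<phi> x) \<in> borel_measurable borel"
      by (intro borel_measurable_smooth smooth_mult w smooth_iterated_partial_deriv s cs)
    then show "(\<lambda>x. w x * foldr partial_deriv cs \<phi> x) \<in> borel_measurable (lebesgue_on U)"
      by (rule borel_measurable_lebesgue_on_of_borel)
    show "borel_rep U (\<lambda>x. w x * foldr partial_deriv cs \<phi> x) (\<lambda>x. w x * foldr partial_deriv cs \<phi> x)"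
      using m R(2) by (auto simp: borel_rep_def)
  qed
  have "set (rev bs) \<subseteq> Basis" using bs by simp
  from conv[OF v bs] conv[OF smooth_iterated_partial_deriv[OF v this], of "[]"]
  show "(LINT x|lebesgue_on U. v x * foldr partial_deriv bs \<phi> x)
      = (-1) ^ length bs * (LINT x|lebesgue_on U. foldr partial_deriv (rev bs) v x * \<phi> x)"
    using smooth_iterated_integration_by_parts[OF s R(1) v bs] by simp
qed

lemma smooth_in_H2:
  fixes v :: "'a::euclidean_space \<Rightarrow> real"
  assumes U: "open U" "U \<subseteq> ball 0 R" and v: "smooth v"
  shows "v \<in> H2 U"
  unfolding H2_def
proof (intro CollectI conjI allI impI)
  show "v \<in> L2 U" by (rule smooth_in_L2[OF U v])
  fix bs :: "'a list" assume bs: "set bs \<subseteq> Basis \<and> length bs \<le> 2"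
  then have "smooth (foldr partial_deriv (rev bs) v)"
    by (intro smooth_iterated_partial_deriv[OF v]) simp
  then show "\<exists>h\<in>L2 U. has_weak_deriv U bs v h"
    using smooth_has_weak_deriv[OF U(1) v, of bs] smooth_in_L2[OF U] bs by blast
qed

lemma weak_deriv_works:
  assumes "f \<in> H2 U" "set bs \<subseteq> Basis" "length bs \<le> 2"
  shows "weak_deriv U bs f \<in> L2 U" "has_weak_deriv U bs f (weak_deriv U bs f)"
proof -
  have "\<exists>h. h \<in> L2 U \<and> has_weak_deriv U bs f h" using assms by (auto simp: H2_def)
  from someI_ex[OF this] show "weak_deriv U bs f \<in> L2 U" "has_weak_deriv U bs f (weak_deriv U bs f)"
    by (auto simp: weak_deriv_def)
qed

lemma weak_deriv_smooth:
  fixes v :: "'a::euclidean_space \<Rightarrow> real"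
  assumes U: "open U" "U \<subseteq> ball 0 R" and v: "smooth v" and bs: "set bs \<subseteq> Basis" "length bs \<le> 2"
  shows "borel_rep U (weak_deriv U bs v) (\<lambda>x. indicator U x * foldr partial_deriv (rev bs) v x)"
proof -
  have s: "smooth (foldr partial_deriv (rev bs) v)"
    by (rule smooth_iterated_partial_deriv[OF v]) (use bs in simp)
  note w = weak_deriv_works[OF smooth_in_H2[OF U v] bs]
  show ?thesis
    by (rule has_weak_deriv_unique[OF U w(1) smooth_in_L2[OF U s] w(2) smooth_has_weak_deriv[OF U(1) v bs(1)]
          borel_rep_smooth[OF U(1) s]])
qed

section \<open>The quadratic form of the bracket\<close>

abbreviation "ex \<equiv> (1 :: real, 0 :: real)"
abbreviation "ey \<equiv> (0 :: real, 1 :: real)"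

lemma Basis_plane: "(Basis :: (real \<times> real) set) = {ex, ey}"
  by (auto simp: Basis_prod_def)

lemma sum_Basis_plane: "(\<Sum>b\<in>Basis. f b) = f ex + f ey" for f :: "real \<times> real \<Rightarrow> real"
  by (simp add: Basis_plane)

text \<open>A jet lists the derivatives of order at most two at one point.  In the plane
  \<open>(1 - \<sigma>) |D\<^sup>2f|\<^sup>2 + \<sigma> (\<Delta>f)\<^sup>2\<close> is the sum of squares below, so it is nonnegative for
  \<open>-1 < \<sigma> < 1\<close>; the sum of all squares is the case \<open>\<sigma> = 0\<close>, \<open>\<tau> = 1\<close>.\<close>

definition jet_energy :: "real \<Rightarrow> real \<Rightarrow> ((real \<times> real) list \<Rightarrow> real) \<Rightarrow> real" where
  "jet_energy \<sigma> \<tau> j = (j [ex, ex] + \<sigma> * j [ey, ey])\<^sup>2 + (1 - \<sigma>\<^sup>2) * (j [ey, ey])\<^sup>2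
     + (1 - \<sigma>) * ((j [ex, ey])\<^sup>2 + (j [ey, ex])\<^sup>2) + \<tau> * ((j [ex])\<^sup>2 + (j [ey])\<^sup>2) + (j [])\<^sup>2"

definition jet_indices :: "(real \<times> real) list set" where
  "jet_indices = {[], [ex], [ey], [ex, ex], [ex, ey], [ey, ex], [ey, ey]}"

lemma jet_indices_iff: "bs \<in> jet_indices \<longleftrightarrow> set bs \<subseteq> Basis \<and> length bs \<le> 2"
proof
  show "set bs \<subseteq> Basis \<and> length bs \<le> 2" if "bs \<in> jet_indices"
    using that by (auto simp: jet_indices_def Basis_plane)
  show "bs \<in> jet_indices" if h: "set bs \<subseteq> Basis \<and> length bs \<le> 2"
  proof (cases bs)
    case (Cons b cs)
    show ?thesis
    proof (cases cs)
      case Nil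
      then show ?thesis using h Cons by (auto simp: jet_indices_def Basis_plane)
    next
      case (Cons c ds)
      then have "ds = []" using h \<open>bs = b # cs\<close> by auto
      then show ?thesis using h Cons \<open>bs = b # cs\<close> by (auto simp: jet_indices_def Basis_plane)
    qed
  qed (simp add: jet_indices_def)
qed

lemma one_minus_sq_nonneg: "-1 < \<sigma> \<Longrightarrow> \<sigma> < 1 \<Longrightarrow> 0 \<le> 1 - (\<sigma>::real)\<^sup>2"
  using abs_square_le_1[of \<sigma>] by simp

lemma jet_energy_nonneg:
  assumes "-1 < \<sigma>" "\<sigma> < 1" "0 \<le> \<tau>" shows "0 \<le> jet_energy \<sigma> \<tau> j"
  using assms one_minus_sq_nonneg[OF assms(1,2)] by (simp add: jet_energy_def)

text \<open>Young's inequality with a weight. Later \<open>a\<close> is the stretching length: the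
  leading term is multiplied by \<open>1 + a\<close> only, and the error term carries
  \<open>1 + 1 / a\<close>.\<close>

lemma square_add_le:
  fixes x y a :: real assumes "a > 0"
  shows "(x + y)\<^sup>2 \<le> (1 + a) * x\<^sup>2 + (1 + 1 / a) * y\<^sup>2"
proof -
  have "0 \<le> (a * x - y)\<^sup>2 / a" using assms by simp
  then show ?thesis using assms by (simp add: power2_eq_square field_simps)
qed

text \<open>Every summand of the energy is a nonnegative weight times the square of a linear
  functional of the jet, so the weighted Young inequality applies summand by summand.\<close>

lemma jet_energy_add_le:
  assumes s: "-1 < \<sigma>" "\<sigma> < 1" "0 \<le> \<tau>" and a: "a > 0"
  shows "jet_energy \<sigma> \<tau> (\<lambda>bs. j bs + k bs) \<le> (1 + a) * jet_energy \<sigma> \<tau> j + (1 + 1 / a) * jet_energy \<sigma> \<tau> k"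
proof -
  note q = square_add_le[OF a]
  have w: "0 \<le> 1 - \<sigma>\<^sup>2" "0 \<le> 1 - \<sigma>" using s one_minus_sq_nonneg by auto
  have 1: "(j [ex, ex] + k [ex, ex] + \<sigma> * (j [ey, ey] + k [ey, ey]))\<^sup>2
      \<le> (1 + a) * (j [ex, ex] + \<sigma> * j [ey, ey])\<^sup>2 + (1 + 1 / a) * (k [ex, ex] + \<sigma> * k [ey, ey])\<^sup>2"
    using q[of "j [ex, ex] + \<sigma> * j [ey, ey]" "k [ex, ex] + \<sigma> * k [ey, ey]"] by (simp add: algebra_simps)
  note 2 = mult_left_mono[OF q[of "j [ey, ey]" "k [ey, ey]"] w(1)]
  note 3 = mult_left_mono[OF add_mono[OF q[of "j [ex, ey]" "k [ex, ey]"] q[of "j [ey, ex]" "k [ey, ex]"]] w(2)]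
  note 4 = mult_left_mono[OF add_mono[OF q[of "j [ex]" "k [ex]"] q[of "j [ey]" "k [ey]"]] s(3)]
  note 5 = q[of "j []" "k []"]
  have "jet_energy \<sigma> \<tau> (\<lambda>bs. j bs + k bs) \<le>
      ((1 + a) * (j [ex, ex] + \<sigma> * j [ey, ey])\<^sup>2 + (1 + 1 / a) * (k [ex, ex] + \<sigma> * k [ey, ey])\<^sup>2)
      + (1 - \<sigma>\<^sup>2) * ((1 + a) * (j [ey, ey])\<^sup>2 + (1 + 1 / a) * (k [ey, ey])\<^sup>2)
      + (1 - \<sigma>) * ((1 + a) * (j [ex, ey])\<^sup>2 + (1 + 1 / a) * (k [ex, ey])\<^sup>2 + ((1 + a) * (j [ey, ex])\<^sup>2 + (1 + 1 / a) * (k [ey, ex])\<^sup>2))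
      + \<tau> * ((1 + a) * (j [ex])\<^sup>2 + (1 + 1 / a) * (k [ex])\<^sup>2 + ((1 + a) * (j [ey])\<^sup>2 + (1 + 1 / a) * (k [ey])\<^sup>2))
      + ((1 + a) * (j [])\<^sup>2 + (1 + 1 / a) * (k [])\<^sup>2)"
    unfolding jet_energy_def using 1 2 3 4 5 by (intro add_mono)
  also have "\<dots> = (1 + a) * jet_energy \<sigma> \<tau> j + (1 + 1 / a) * jet_energy \<sigma> \<tau> k"
  proof -
    have "\<And>A B::real. A * X1 + B * Y1 + w2 * (A * X2 + B * Y2) + w3 * (A * X3 + B * Y3 + (A * X4 + B * Y4))
        + w5 * (A * X5 + B * Y5 + (A * X6 + B * Y6)) + (A * X7 + B * Y7)
      = A * (X1 + w2 * X2 + w3 * (X3 + X4) + w5 * (X5 + X6) + X7) + B * (Y1 + w2 * Y2 + w3 * (Y3 + Y4) + w5 * (Y5 + Y6) + Y7)"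
      for X1 X2 X3 X4 X5 X6 X7 Y1 Y2 Y3 Y4 Y5 Y6 Y7 w2 w3 w5 :: real
      by (simp add: algebra_simps)
    then show ?thesis unfolding jet_energy_def by blast
  qed
  finally show ?thesis .
qed

lemma jet_energy_scale: "jet_energy \<sigma> \<tau> (\<lambda>bs. c * j bs) = c\<^sup>2 * jet_energy \<sigma> \<tau> j"
  by (simp add: jet_energy_def power2_eq_square algebra_simps)

lemma jet_energy_sum_squares:
  "jet_energy 0 1 j = (j [ex, ex])\<^sup>2 + (j [ey, ey])\<^sup>2 + (j [ex, ey])\<^sup>2 + (j [ey, ex])\<^sup>2 + (j [ex])\<^sup>2 + (j [ey])\<^sup>2 + (j [])\<^sup>2"
  by (simp add: jet_energy_def)

text \<open>The pure second derivatives get coefficients 2 and \<open>1 + \<sigma>\<^sup>2\<close>,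
  the mixed ones \<open>1 - \<sigma>\<close>, the gradient \<tau> and the function itself 1;
  \<open>3 + \<tau>\<close> exceeds all of these.\<close>

lemma jet_energy_le_sum_squares:
  assumes s: "-1 < \<sigma>" "\<sigma> < 1" "0 \<le> \<tau>"
  shows "jet_energy \<sigma> \<tau> j \<le> (3 + \<tau>) * jet_energy 0 1 j"
proof -
  have s1: "\<sigma>\<^sup>2 \<le> 1" using one_minus_sq_nonneg[OF s(1,2)] by simp
  have "(j [ex, ex] + \<sigma> * j [ey, ey])\<^sup>2 \<le> 2 * (j [ex, ex])\<^sup>2 + 2 * (\<sigma> * j [ey, ey])\<^sup>2"
    using square_add_le[of 1 "j [ex, ex]" "\<sigma> * j [ey, ey]"] by simp
  moreover have "\<sigma>\<^sup>2 * (j [ey, ey])\<^sup>2 \<le> 1 * (j [ey, ey])\<^sup>2" by (rule mult_right_mono[OF s1]) simp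
  moreover have "0 \<le> \<sigma>\<^sup>2 * (j [ey, ey])\<^sup>2" by simp
  moreover have "(1 - \<sigma>) * ((j [ex, ey])\<^sup>2 + (j [ey, ex])\<^sup>2) \<le> 2 * ((j [ex, ey])\<^sup>2 + (j [ey, ex])\<^sup>2)"
    by (rule mult_right_mono) (use s in auto)
  moreover have "2 * ((j [ex, ey])\<^sup>2 + (j [ey, ex])\<^sup>2) \<le> (3 + \<tau>) * ((j [ex, ey])\<^sup>2 + (j [ey, ex])\<^sup>2)"
    by (rule mult_right_mono) (use s in auto)
  moreover have "0 \<le> \<tau> * ((j [ex, ex])\<^sup>2 + (j [ey, ey])\<^sup>2 + (j [])\<^sup>2)"
    using s(3) by simp
  moreover have "0 \<le> (j [ex, ex])\<^sup>2" "0 \<le> (j [])\<^sup>2" "0 \<le> (j [ex])\<^sup>2" "0 \<le> (j [ey])\<^sup>2" by auto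
  ultimately show ?thesis
    unfolding jet_energy_sum_squares unfolding jet_energy_def
    by (simp only: power_mult_distrib algebra_simps)
qed

text \<open>For the empty word \<open>weak_deriv\<close> would be some function agreeing with
  \<open>f\<close> only up to a null set; taking \<open>f\<close> itself makes this entry match the
  term \<open>L2_norm U f\<close> of the bracket literally.\<close>

definition weak_jet :: "(real \<times> real) set \<Rightarrow> (real \<times> real \<Rightarrow> real) \<Rightarrow> (real \<times> real) list \<Rightarrow> real \<times> real \<Rightarrow> real" where
  "weak_jet U f bs = (if bs = [] then f else weak_deriv U bs f)"

lemma weak_jet_works:
  assumes "f \<in> H2 U" "bs \<in> jet_indices"
  shows "weak_jet U f bs \<in> L2 U" "has_weak_deriv U bs f (weak_jet U f bs)"
  using assms weak_deriv_works[of f U bs] jet_indices_iff[of bs]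
  by (auto simp: weak_jet_def H2_def has_weak_deriv_def)

lemma weak_jet_rep_exists:
  assumes "open U" "f \<in> H2 U"
  obtains u where "\<And>bs. bs \<in> jet_indices \<Longrightarrow> borel_rep U (weak_jet U f bs) (u bs)"
proof -
  have "\<exists>g. borel_rep U (weak_jet U f bs) g" if "bs \<in> jet_indices" for bs
    using borel_rep_exists[OF assms(1)] weak_jet_works(1)[OF assms(2) that] unfolding L2_def by blast
  then show ?thesis using that by metis
qed

lemma integrable_jet_energy:
  assumes m: "\<And>bs. bs \<in> jet_indices \<Longrightarrow> u bs \<in> borel_measurable M"
    and i: "\<And>bs. bs \<in> jet_indices \<Longrightarrow> integrable M (\<lambda>x. (u bs x)\<^sup>2)"
  shows "integrable M (\<lambda>x. jet_energy \<sigma> \<tau> (\<lambda>bs. u bs x))"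
proof -
  have m1: "u [ex, ex] \<in> borel_measurable M" "u [ey, ey] \<in> borel_measurable M" using m by (auto simp: jet_indices_def)
  have i1: "integrable M (\<lambda>x. (u [ex, ex] x)\<^sup>2)" "integrable M (\<lambda>x. (u [ey, ey] x)\<^sup>2)"
    "integrable M (\<lambda>x. (u [ex, ey] x)\<^sup>2)" "integrable M (\<lambda>x. (u [ey, ex] x)\<^sup>2)"
    "integrable M (\<lambda>x. (u [ex] x)\<^sup>2)" "integrable M (\<lambda>x. (u [ey] x)\<^sup>2)" "integrable M (\<lambda>x. (u [] x)\<^sup>2)"
    using i by (auto simp: jet_indices_def)
  have "integrable M (\<lambda>x. (u [ex, ex] x + \<sigma> * u [ey, ey] x)\<^sup>2)"
    by (rule integrable_square_add) (use m1 i1 in \<open>auto simp: power_mult_distrib\<close>)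
  then show ?thesis unfolding jet_energy_def using i1 by simp
qed

lemma integral_jet_energy:
  assumes m: "\<And>bs. bs \<in> jet_indices \<Longrightarrow> u bs \<in> borel_measurable M"
    and i: "\<And>bs. bs \<in> jet_indices \<Longrightarrow> integrable M (\<lambda>x. (u bs x)\<^sup>2)"
  shows "(LINT x|M. jet_energy \<sigma> \<tau> (\<lambda>bs. u bs x)) =
    (LINT x|M. (u [ex, ex] x + \<sigma> * u [ey, ey] x)\<^sup>2) + (1 - \<sigma>\<^sup>2) * (LINT x|M. (u [ey, ey] x)\<^sup>2)
    + (1 - \<sigma>) * ((LINT x|M. (u [ex, ey] x)\<^sup>2) + (LINT x|M. (u [ey, ex] x)\<^sup>2))
    + \<tau> * ((LINT x|M. (u [ex] x)\<^sup>2) + (LINT x|M. (u [ey] x)\<^sup>2)) + (LINT x|M. (u [] x)\<^sup>2)"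
proof -
  have m1: "u [ex, ex] \<in> borel_measurable M" "u [ey, ey] \<in> borel_measurable M" using m by (auto simp: jet_indices_def)
  have i1: "integrable M (\<lambda>x. (u [ex, ex] x)\<^sup>2)" "integrable M (\<lambda>x. (u [ey, ey] x)\<^sup>2)"
    "integrable M (\<lambda>x. (u [ex, ey] x)\<^sup>2)" "integrable M (\<lambda>x. (u [ey, ex] x)\<^sup>2)"
    "integrable M (\<lambda>x. (u [ex] x)\<^sup>2)" "integrable M (\<lambda>x. (u [ey] x)\<^sup>2)" "integrable M (\<lambda>x. (u [] x)\<^sup>2)"
    using i by (auto simp: jet_indices_def)
  have "integrable M (\<lambda>x. (u [ex, ex] x + \<sigma> * u [ey, ey] x)\<^sup>2)"
    by (rule integrable_square_add) (use m1 i1 in \<open>auto simp: power_mult_distrib\<close>)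
  then show ?thesis unfolding jet_energy_def using i1 by simp
qed

text \<open>The expression under the absolute value turns out to be the integral of a nonnegative
  energy, so both the absolute value and the root disappear.\<close>

lemma H2_bracket_square:
  assumes U: "open U" and f: "f \<in> H2 U" and u: "\<And>bs. bs \<in> jet_indices \<Longrightarrow> borel_rep U (weak_jet U f bs) (u bs)"
    and s: "-1 < \<sigma>" "\<sigma> < 1" "0 \<le> \<tau>"
  shows "(H2_bracket \<sigma> \<tau> U f)\<^sup>2 = (LINT x|lborel. jet_energy \<sigma> \<tau> (\<lambda>bs. u bs x))"
    and "integrable lborel (\<lambda>x. jet_energy \<sigma> \<tau> (\<lambda>bs. u bs x))"
proof -
  have r: "u bs \<in> borel_measurable lborel" "integrable lborel (\<lambda>x. (u bs x)\<^sup>2)"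
      "(L2_norm U (weak_jet U f bs))\<^sup>2 = (LINT x|lborel. (u bs x)\<^sup>2)" if "bs \<in> jet_indices" for bs
    using L2_borel_rep[OF U weak_jet_works(1)[OF f that] u[OF that]] by auto
  show int: "integrable lborel (\<lambda>x. jet_energy \<sigma> \<tau> (\<lambda>bs. u bs x))"
    by (rule integrable_jet_energy) (use r in auto)
  have J: "[] \<in> jet_indices" "[ex] \<in> jet_indices" "[ey] \<in> jet_indices" "[ex, ex] \<in> jet_indices"
    "[ex, ey] \<in> jet_indices" "[ey, ex] \<in> jet_indices" "[ey, ey] \<in> jet_indices"
    by (auto simp: jet_indices_def)
  have m1: "u [ex, ex] \<in> borel_measurable lborel" "u [ey, ey] \<in> borel_measurable lborel" using r J by auto
  have i1: "integrable lborel (\<lambda>x. (u [ex, ex] x)\<^sup>2)" "integrable lborel (\<lambda>x. (u [ey, ey] x)\<^sup>2)" using r J by auto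
  have hs: "(hessian_L2_norm U f)\<^sup>2 = (LINT x|lborel. (u [ex, ex] x)\<^sup>2) + (LINT x|lborel. (u [ex, ey] x)\<^sup>2)
      + ((LINT x|lborel. (u [ey, ex] x)\<^sup>2) + (LINT x|lborel. (u [ey, ey] x)\<^sup>2))"
    using r(3)[OF J(4)] r(3)[OF J(5)] r(3)[OF J(6)] r(3)[OF J(7)]
    by (simp add: hessian_L2_norm_def sum_Basis_plane weak_jet_def)
  have gr: "(gradient_L2_norm U f)\<^sup>2 = (LINT x|lborel. (u [ex] x)\<^sup>2) + (LINT x|lborel. (u [ey] x)\<^sup>2)"
    using r(3)[OF J(2)] r(3)[OF J(3)]
    by (simp add: gradient_L2_norm_def sum_Basis_plane weak_jet_def)
  have fn: "(L2_norm U f)\<^sup>2 = (LINT x|lborel. (u [] x)\<^sup>2)"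
    using r(3)[OF J(1)] by (simp add: weak_jet_def)
  have lap: "(L2_norm U (laplacian U f))\<^sup>2 = (LINT x|lborel. (u [ex, ex] x + u [ey, ey] x)\<^sup>2)"
  proof -
    have "laplacian U f = (\<lambda>x. weak_jet U f [ex, ex] x + weak_jet U f [ey, ey] x)"
      by (simp add: laplacian_def sum_Basis_plane weak_jet_def fun_eq_iff)
    then show ?thesis
      using L2_borel_rep(3)[OF U L2_add_diff(1)[OF weak_jet_works(1)[OF f J(4)] weak_jet_works(1)[OF f J(7)]]
          borel_rep_add[OF u[OF J(4)] u[OF J(7)]]] by simp
  qed
  have ic: "integrable lborel (\<lambda>x. (u [ex, ex] x + c * u [ey, ey] x)\<^sup>2)" for c
    by (rule integrable_square_add) (use m1 i1 in \<open>auto simp: power_mult_distrib\<close>)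
  define X where "X = (LINT x|lborel. (u [ex, ex] x)\<^sup>2)"
  define Y where "Y = (LINT x|lborel. (u [ey, ey] x)\<^sup>2)"
  define Z where "Z = (LINT x|lborel. (u [ex, ex] x + u [ey, ey] x)\<^sup>2)"
  \<comment> \<open>The Laplacian enters through this pointwise identity; the term with
    \<open>\<sigma>\<^sup>2 - \<sigma>\<close> then combines with the weight
    \<open>1 - \<sigma>\<^sup>2\<close> to the coefficient \<open>1 - \<sigma>\<close> of the
    Hessian.\<close>
  have comb: "(LINT x|lborel. (u [ex, ex] x + \<sigma> * u [ey, ey] x)\<^sup>2) = (1 - \<sigma>) * X + \<sigma> * Z + (\<sigma>\<^sup>2 - \<sigma>) * Y"
  proof -
    have "(\<lambda>x. (u [ex, ex] x + \<sigma> * u [ey, ey] x)\<^sup>2) = (\<lambda>x. (1 - \<sigma>) * (u [ex, ex] x)\<^sup>2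
        + \<sigma> * (u [ex, ex] x + u [ey, ey] x)\<^sup>2 + (\<sigma>\<^sup>2 - \<sigma>) * (u [ey, ey] x)\<^sup>2)"
      by (simp add: fun_eq_iff power2_eq_square algebra_simps)
    then show ?thesis using i1 ic[of 1] by (simp add: X_def Y_def Z_def)
  qed
  have ije: "(LINT x|lborel. jet_energy \<sigma> \<tau> (\<lambda>bs. u bs x)) =
    (LINT x|lborel. (u [ex, ex] x + \<sigma> * u [ey, ey] x)\<^sup>2) + (1 - \<sigma>\<^sup>2) * (LINT x|lborel. (u [ey, ey] x)\<^sup>2)
    + (1 - \<sigma>) * ((LINT x|lborel. (u [ex, ey] x)\<^sup>2) + (LINT x|lborel. (u [ey, ex] x)\<^sup>2))
    + \<tau> * ((LINT x|lborel. (u [ex] x)\<^sup>2) + (LINT x|lborel. (u [ey] x)\<^sup>2)) + (LINT x|lborel. (u [] x)\<^sup>2)"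
    by (rule integral_jet_energy) (use r in auto)
  have "(1 - \<sigma>) * (hessian_L2_norm U f)\<^sup>2 + \<sigma> * (L2_norm U (laplacian U f))\<^sup>2
      + \<tau> * (gradient_L2_norm U f)\<^sup>2 + (L2_norm U f)\<^sup>2 = (LINT x|lborel. jet_energy \<sigma> \<tau> (\<lambda>bs. u bs x))"
    unfolding hs gr fn lap ije comb X_def[symmetric] Y_def[symmetric] Z_def[symmetric]
    by (simp add: algebra_simps)
  moreover have "0 \<le> (LINT x|lborel. jet_energy \<sigma> \<tau> (\<lambda>bs. u bs x))"
    by (intro integral_nonneg_AE AE_I2 jet_energy_nonneg s)
  ultimately show "(H2_bracket \<sigma> \<tau> U f)\<^sup>2 = (LINT x|lborel. jet_energy \<sigma> \<tau> (\<lambda>bs. u bs x))"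
    by (simp add: H2_bracket_def)
qed

lemma H2_norm_eq_bracket: "H2_norm U f = H2_bracket 0 1 U f"
  by (simp add: H2_norm_def H2_bracket_def)

lemma weak_jet_smooth:
  assumes U: "open U" "U \<subseteq> ball 0 R" and v: "smooth v" and bs: "bs \<in> jet_indices"
  shows "borel_rep U (weak_jet U v bs) (\<lambda>x. indicator U x * foldr partial_deriv (rev bs) v x)"
  using weak_deriv_smooth[OF U v, of bs] borel_rep_smooth[OF U(1) v] bs jet_indices_iff[of bs]
  by (auto simp: weak_jet_def)

text \<open>Only the two mixed entries change places, and they carry equal weights; hence the order
  reversal coming from integration by parts does not affect the energy.\<close>

lemma jet_energy_rev: "jet_energy \<sigma> \<tau> (\<lambda>bs. j (rev bs)) = jet_energy \<sigma> \<tau> j"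
  by (simp add: jet_energy_def)

lemma H2_bracket_square_smooth:
  assumes U: "open U" "U \<subseteq> ball 0 R" and v: "smooth v" and s: "-1 < \<sigma>" "\<sigma> < 1" "0 \<le> \<tau>"
  shows "(H2_bracket \<sigma> \<tau> U v)\<^sup>2
    = (LINT x|lborel. indicator U x * jet_energy \<sigma> \<tau> (\<lambda>bs. foldr partial_deriv bs v x))"
    and "integrable lborel (\<lambda>x. indicator U x * jet_energy \<sigma> \<tau> (\<lambda>bs. foldr partial_deriv bs v x))"
proof -
  note * = H2_bracket_square[OF U(1) smooth_in_H2[OF U v] weak_jet_smooth[OF U v] s]
  have "jet_energy \<sigma> \<tau> (\<lambda>bs. indicator U x * foldr partial_deriv (rev bs) v x)
      = indicator U x * jet_energy \<sigma> \<tau> (\<lambda>bs. foldr partial_deriv bs v x)" for x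
    unfolding jet_energy_scale jet_energy_rev[of \<sigma> \<tau> "\<lambda>bs. foldr partial_deriv bs v x"]
    by (simp add: indicator_def)
  then show "(H2_bracket \<sigma> \<tau> U v)\<^sup>2
    = (LINT x|lborel. indicator U x * jet_energy \<sigma> \<tau> (\<lambda>bs. foldr partial_deriv bs v x))"
    "integrable lborel (\<lambda>x. indicator U x * jet_energy \<sigma> \<tau> (\<lambda>bs. foldr partial_deriv bs v x))"
    using * by simp_all
qed

text \<open>A smooth function vanishing near \<open>L\<close> approximates itself. The norm of the
  zero function still calls for a computation, because its \<open>weak_deriv\<close> is a choice
  that is zero only almost everywhere.\<close>

lemma smooth_in_H2_vanishing:
  fixes U :: "(real \<times> real) set"
  assumes U: "open U" "U \<subseteq> ball 0 R" and v: "smooth v"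
    and N: "open N" "L \<subseteq> N" "\<And>x. x \<in> N \<Longrightarrow> x \<in> closure U \<Longrightarrow> v x = 0"
  shows "v \<in> H2_vanishing U L"
proof -
  have "(H2_norm U (\<lambda>x. v x - v x))\<^sup>2 = 0"
  proof -
    have "foldr partial_deriv bs (\<lambda>x::real \<times> real. 0 :: real) = (\<lambda>x. 0)" for bs
    proof (induction bs)
      case (Cons b bs)
      then show ?case using partial_deriv_eq[OF has_derivative_const[of "0::real"]] by fastforce
    qed simp
    moreover have "smooth (\<lambda>x::real \<times> real. 0 :: real)" by (rule smooth_const)
    ultimately show ?thesis
      using H2_bracket_square_smooth(1)[OF U, of "\<lambda>x. 0" 0 1]
      by (simp add: H2_norm_eq_bracket jet_energy_def)
  qed
  then have "H2_norm U (\<lambda>x. v x - v x) = 0" by simp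
  moreover have "v \<in> smooth_on_closure U" using v by (auto simp: smooth_on_closure_def)
  ultimately show ?thesis
    unfolding H2_vanishing_def using smooth_in_H2[OF U v] N by (auto intro!: bexI[of _ v] exI[of _ N])
qed

text \<open>Convolution commutes with the linear functionals whose squares make up the energy, so
  the mean-square contraction applies to each of them, in particular to the combination
  \<open>w\<close> of the two pure second derivatives.\<close>

lemma convolution_jet_energy_contraction:
  assumes m: "mollifier \<delta> \<rho>" and s: "-1 < \<sigma>" "\<sigma> < 1" "0 \<le> \<tau>"
    and i: "\<And>bs. bs \<in> jet_indices \<Longrightarrow> integrable lborel (u bs)"
    and i2: "\<And>bs. bs \<in> jet_indices \<Longrightarrow> integrable lborel (\<lambda>x. (u bs x)\<^sup>2)"
  shows "integrable lborel (\<lambda>x. jet_energy \<sigma> \<tau> (\<lambda>bs. convolution (u bs) \<rho> x))"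
    and "(LINT x|lborel. jet_energy \<sigma> \<tau> (\<lambda>bs. convolution (u bs) \<rho> x)) \<le> (LINT x|lborel. jet_energy \<sigma> \<tau> (\<lambda>bs. u bs x))"
proof -
  have c: "convolution (u bs) \<rho> \<in> borel_measurable lborel" "integrable lborel (\<lambda>x. (convolution (u bs) \<rho> x)\<^sup>2)"
    "(LINT x|lborel. (convolution (u bs) \<rho> x)\<^sup>2) \<le> (LINT x|lborel. (u bs x)\<^sup>2)" if "bs \<in> jet_indices" for bs
    using convolution_contraction[OF m i[OF that] i2[OF that]]
      borel_measurable_smooth[OF smooth_convolution[OF i[OF that] mollifier_smooth[OF m] mollifier_zero[OF m]]] by auto
  have um: "u bs \<in> borel_measurable lborel" if "bs \<in> jet_indices" for bs
    using i[OF that] by (rule borel_measurable_integrable)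
  have J: "[] \<in> jet_indices" "[ex] \<in> jet_indices" "[ey] \<in> jet_indices" "[ex, ex] \<in> jet_indices"
    "[ex, ey] \<in> jet_indices" "[ey, ex] \<in> jet_indices" "[ey, ey] \<in> jet_indices"
    by (auto simp: jet_indices_def)
  show "integrable lborel (\<lambda>x. jet_energy \<sigma> \<tau> (\<lambda>bs. convolution (u bs) \<rho> x))"
    using c by (intro integrable_jet_energy)
  define w where "w x = u [ex, ex] x + \<sigma> * u [ey, ey] x" for x
  have wi: "integrable lborel w" unfolding w_def using i[OF J(4)] i[OF J(7)] by simp
  have w2: "integrable lborel (\<lambda>x. (w x)\<^sup>2)" unfolding w_def
    by (rule integrable_square_add) (use um J i2 in \<open>auto simp: power_mult_distrib\<close>)
  note ker = integrable_convolution_kernel[OF _ mollifier_continuous[OF m] mollifier_zero[OF m]]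
  have cw_eq: "convolution w \<rho> x = convolution (u [ex, ex]) \<rho> x + \<sigma> * convolution (u [ey, ey]) \<rho> x" for x
    using ker[OF i[OF J(4)], where x = x] ker[OF i[OF J(7)], where x = x]
    by (simp add: convolution_def w_def distrib_right mult.assoc)
  from convolution_contraction(2)[OF m wi w2]
  have cw: "(LINT x|lborel. (convolution (u [ex, ex]) \<rho> x + \<sigma> * convolution (u [ey, ey]) \<rho> x)\<^sup>2)
      \<le> (LINT x|lborel. (u [ex, ex] x + \<sigma> * u [ey, ey] x)\<^sup>2)" unfolding cw_eq by (simp only: w_def)
  show "(LINT x|lborel. jet_energy \<sigma> \<tau> (\<lambda>bs. convolution (u bs) \<rho> x)) \<le> (LINT x|lborel. jet_energy \<sigma> \<tau> (\<lambda>bs. u bs x))"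
  proof -
    have 1: "(LINT x|lborel. jet_energy \<sigma> \<tau> (\<lambda>bs. u bs x)) =
      (LINT x|lborel. (u [ex, ex] x + \<sigma> * u [ey, ey] x)\<^sup>2) + (1 - \<sigma>\<^sup>2) * (LINT x|lborel. (u [ey, ey] x)\<^sup>2)
      + (1 - \<sigma>) * ((LINT x|lborel. (u [ex, ey] x)\<^sup>2) + (LINT x|lborel. (u [ey, ex] x)\<^sup>2))
      + \<tau> * ((LINT x|lborel. (u [ex] x)\<^sup>2) + (LINT x|lborel. (u [ey] x)\<^sup>2)) + (LINT x|lborel. (u [] x)\<^sup>2)"
      by (rule integral_jet_energy) (use um i2 in auto)
    have 2: "(LINT x|lborel. jet_energy \<sigma> \<tau> (\<lambda>bs. convolution (u bs) \<rho> x)) =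
      (LINT x|lborel. (convolution (u [ex, ex]) \<rho> x + \<sigma> * convolution (u [ey, ey]) \<rho> x)\<^sup>2)
      + (1 - \<sigma>\<^sup>2) * (LINT x|lborel. (convolution (u [ey, ey]) \<rho> x)\<^sup>2)
      + (1 - \<sigma>) * ((LINT x|lborel. (convolution (u [ex, ey]) \<rho> x)\<^sup>2) + (LINT x|lborel. (convolution (u [ey, ex]) \<rho> x)\<^sup>2))
      + \<tau> * ((LINT x|lborel. (convolution (u [ex]) \<rho> x)\<^sup>2) + (LINT x|lborel. (convolution (u [ey]) \<rho> x)\<^sup>2))
      + (LINT x|lborel. (convolution (u []) \<rho> x)\<^sup>2)"
      by (rule integral_jet_energy[where u = "\<lambda>bs. convolution (u bs) \<rho>"]) (use c in auto)
    show ?thesis unfolding 1 2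
      by (intro add_mono mult_left_mono cw c(3) J) (use s one_minus_sq_nonneg in auto)
  qed
qed

section \<open>Geometry of the dumbbell\<close>

text \<open>A straight segment in the boundary forces the local graph to be affine, so that the domain is
  a half disc near the midpoint of the segment.\<close>

lemma segment_in_frontier_half_ball:
  fixes U :: "(real \<times> real) set"
  assumes sb: "smooth_boundary U" and U: "open U" and seg: "{c} \<times> {-1<..<1} \<subseteq> frontier U"
  obtains r s where "r > 0" "s \<noteq> 0" "\<And>z. z \<in> ball (c, 0) r \<Longrightarrow> z \<in> U \<longleftrightarrow> 0 < s * (fst z - c)"
proof -
  have pf: "(c, 0) \<in> frontier U" using seg by auto
  obtain r0 and T :: "real \<times> real \<Rightarrow> real \<times> real" and \<gamma> :: "real \<Rightarrow> real" where r0: "r0 > 0" and T: "orthogonal_transformation T" and \<gamma>: "smooth \<gamma>"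
    and eq: "U \<inter> ball (c, 0) r0 = {z \<in> ball (c, 0) r0. \<gamma> (fst (T z)) < snd (T z)}"
    using bspec[OF sb[unfolded smooth_boundary_def] pf] by (elim exE conjE) (rule that, assumption+)
  have lT: "linear T" using T by (rule orthogonal_transformation_linear)
  have Tc: "continuous_on UNIV T" using lT by (simp add: linear_continuous_on linear_conv_bounded_linear)
  have nT: "norm (T z) = norm z" for z using T by (rule orthogonal_transformation_norm)
  have \<gamma>c: "continuous_on UNIV \<gamma>" using \<gamma> by (rule smooth_continuous_on)
  \<comment> \<open>A boundary point is not in the open set \<open>U\<close>, hence not above the
    graph; a point below the graph has a neighbourhood below it, which misses
    \<open>U\<close>.\<close>
  have on_graph: "\<gamma> (fst (T z)) = snd (T z)" if z: "z \<in> frontier U" "z \<in> ball (c, 0) r0" for z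
  proof -
    have "z \<notin> U" using z(1) U by (simp add: frontier_def interior_open)
    then have "\<not> \<gamma> (fst (T z)) < snd (T z)" using eq z(2) by blast
    moreover have "\<not> snd (T z) < \<gamma> (fst (T z))"
    proof
      assume l: "snd (T z) < \<gamma> (fst (T z))"
      let ?V = "ball (c, 0) r0 \<inter> {z. snd (T z) < \<gamma> (fst (T z))}"
      have "open {z. snd (T z) < \<gamma> (fst (T z))}"
        by (rule open_Collect_less[OF continuous_on_snd[OF Tc] continuous_on_compose2[OF \<gamma>c continuous_on_fst[OF Tc]]]) simp
      then have oV: "open ?V" using open_Int[OF open_ball] by blast
      have "z \<in> ?V" using l z(2) by blast
      moreover have "z \<in> closure U" using z(1) by (simp add: frontier_def)
      ultimately have "?V \<inter> U \<noteq> {}"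
        unfolding open_Int_closure_eq_empty[OF oV, of U, symmetric] by blast
      then obtain y where y: "y \<in> ?V" "y \<in> U" by blast
      then have "\<gamma> (fst (T y)) < snd (T y)" using eq by blast
      then show False using y(1) by simp
    qed
    ultimately show ?thesis by linarith
  qed
  define r1 where "r1 = min 1 r0"
  have r1: "0 < r1" "r1 \<le> 1" "r1 \<le> r0" using r0 by (auto simp: r1_def)
  \<comment> \<open>\<open>T\<close> maps the segment to a line through \<open>T (c, 0)\<close> with
    unit direction \<open>(p, q)\<close>. As it lies on the graph, \<gamma> is affine with slope
    \<open>q / p\<close> on an interval; a vertical direction is impossible for a graph.\<close>
  define p q where "p = fst (T (0, 1))" and "q = snd (T (0, 1))"
  have n1: "p\<^sup>2 + q\<^sup>2 = 1"
    using nT[of "(0, 1)"] by (simp add: p_def q_def norm_prod_def)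
  have Tline: "T (c, y) = T (c, 0) + y *\<^sub>R T (0, 1)" for y
  proof -
    have "T (c, y) = T ((c, 0) + y *\<^sub>R (0, 1))" by simp
    then show ?thesis using lT by (simp only: linear_add linear_cmul)
  qed
  have graph: "\<gamma> (fst (T (c, 0)) + y * p) = snd (T (c, 0)) + y * q" if y: "\<bar>y\<bar> < r1" for y
  proof -
    have "(c, y) \<in> {c} \<times> {-1<..<1}" using y r1 by auto
    then have "(c, y) \<in> frontier U" using seg by blast
    moreover have "(c, y) \<in> ball (c, 0) r0" using y r1 by (simp add: dist_norm norm_prod_def)
    ultimately show ?thesis using on_graph[of "(c, y)"] by (simp add: Tline[of y] p_def q_def)
  qed
  have p0: "p \<noteq> 0"
  proof
    assume "p = 0"
    then have "q = 0" using graph[of "r1 / 2"] graph[of 0] r1 by simp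
    with n1 \<open>p = 0\<close> show False by simp
  qed
  \<comment> \<open>This radius keeps \<open>fst (T w) / p\<close> below \<open>r1\<close>, the
    range in which \<gamma> is known.\<close>
  define r where "r = r1 * \<bar>p\<bar>"
  have "p\<^sup>2 \<le> 1" using n1 zero_le_power2[of q] by linarith
  then have p1: "\<bar>p\<bar> \<le> 1" by (simp add: abs_square_le_1)
  have r: "0 < r" "r \<le> r1"
    using r1 p0 p1 by (auto simp: r_def mult_left_le)
  \<comment> \<open>The height of \<open>T z\<close> above the graph is linear in
    \<open>z - (c, 0)\<close> and vanishes on vertical vectors; \<open>s\<close> is its value on the
    vector \<open>(1, 0)\<close>.\<close>
  define s where "s = snd (T (1, 0)) - q / p * fst (T (1, 0))"
  have half: "z \<in> U \<longleftrightarrow> 0 < s * (fst z - c)" if z: "z \<in> ball (c, 0) r" for z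
  proof -
    define w where "w = z - (c, 0)"
    have Tz: "T z = T (c, 0) + T w"
      using linear_add[OF lT, of "(c, 0)" w] by (simp add: w_def)
    have wn: "norm w < r" using z by (simp add: w_def dist_norm norm_minus_commute)
    define y where "y = fst (T w) / p"
    have "\<bar>fst (T w)\<bar> \<le> norm (T w)" by (metis norm_fst_le prod.collapse real_norm_def)
    then have "\<bar>fst (T w)\<bar> < r1 * \<bar>p\<bar>" using wn nT[of w] by (simp add: r_def)
    then have "\<bar>y\<bar> < r1" using p0 by (simp add: y_def abs_divide field_simps)
    from graph[OF this] have g: "\<gamma> (fst (T z)) = snd (T (c, 0)) + y * q"
      using p0 by (simp add: Tz y_def)
    have zb: "z \<in> ball (c, 0) r0" using z r r1 by simp
    have "z \<in> U \<longleftrightarrow> \<gamma> (fst (T z)) < snd (T z)" using eq zb by blast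
    also have "\<dots> \<longleftrightarrow> 0 < snd (T w) - y * q" unfolding g by (simp add: Tz)
    also have "snd (T w) - y * q = s * (fst z - c)"
    proof -
      have w_eq: "fst w *\<^sub>R (1, 0) + snd w *\<^sub>R (0, 1) = w" by (simp add: prod_eq_iff)
      have "T (fst w *\<^sub>R (1, 0) + snd w *\<^sub>R (0, 1)) = fst w *\<^sub>R T (1, 0) + snd w *\<^sub>R T (0, 1)"
        using lT by (simp only: linear_add linear_cmul)
      then have "T w = fst w *\<^sub>R T (1, 0) + snd w *\<^sub>R T (0, 1)" unfolding w_eq .
      then have "fst (T w) = fst w * fst (T (1, 0)) + snd w * p" "snd (T w) = fst w * snd (T (1, 0)) + snd w * q"
        by (simp_all add: p_def q_def)
      then have "snd (T w) - y * q = fst w * s"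
        using p0 by (simp add: y_def s_def field_simps)
      then show ?thesis by (simp add: w_def mult.commute)
    qed
    finally show ?thesis .
  qed
  have "s \<noteq> 0"
  proof
    assume "s = 0"
    then have "U \<inter> ball (c, 0) r = {}" using half by auto
    moreover have "(c, 0) \<in> closure U \<inter> ball (c, 0) r" using pf r by (simp add: frontier_def)
    moreover have "ball (c, 0) r \<inter> closure U = {} \<longleftrightarrow> ball (c, 0) r \<inter> U = {}"
      by (rule open_Int_closure_eq_empty[OF open_ball])
    ultimately show False by blast
  qed
  then show ?thesis using that r(1) half by blast
qed

text \<open>The half disc at each junction lies on the side away from the channel, since the ends
  avoid the closed box between them; testing one point of the axis decides the sign of
  \<open>s1\<close> and \<open>s2\<close>.\<close>

lemma dumbbell_ends_boxes:
  assumes d: "dumbbell_ends \<Omega>L \<Omega>R"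
  obtains r where "0 < r" "r < 1" "{-r<..<0} \<times> {-r<..<r} \<subseteq> \<Omega>L" "{1<..<1+r} \<times> {-r<..<r} \<subseteq> \<Omega>R"
proof -
  have L: "smooth_boundary \<Omega>L" "open \<Omega>L" "{0} \<times> {-1<..<1} \<subseteq> frontier \<Omega>L"
    and R: "smooth_boundary \<Omega>R" "open \<Omega>R" "{1} \<times> {-1<..<1} \<subseteq> frontier \<Omega>R"
    and e: "(\<Omega>L \<union> \<Omega>R) \<inter> ({0..1} \<times> {-1..1}) = {}"
    using d by (auto simp: dumbbell_ends_def bounded_smooth_domain_def)
  obtain r1 s1 where 1: "r1 > 0" "s1 \<noteq> 0" "\<And>z. z \<in> ball (0, 0) r1 \<Longrightarrow> z \<in> \<Omega>L \<longleftrightarrow> 0 < s1 * (fst z - 0)"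
    by (rule segment_in_frontier_half_ball[OF L]) blast
  obtain r2 s2 where 2: "r2 > 0" "s2 \<noteq> 0" "\<And>z. z \<in> ball (1, 0) r2 \<Longrightarrow> z \<in> \<Omega>R \<longleftrightarrow> 0 < s2 * (fst z - 1)"
    by (rule segment_in_frontier_half_ball[OF R]) blast
  have s1: "s1 < 0"
  proof (rule ccontr)
    assume "\<not> s1 < 0"
    define x where "x = min (r1 / 2) (1 / 2)"
    have x: "0 < x" "x < r1" "x \<le> 1" using 1(1) by (auto simp: x_def)
    have "(x, 0) \<in> \<Omega>L" using 1(3)[of "(x, 0)"] x \<open>\<not> s1 < 0\<close> 1(2) by (simp add: dist_norm norm_prod_def)
    moreover have "(x, 0) \<in> {0..1} \<times> {-1..1::real}" using x by auto
    ultimately show False using e by blast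
  qed
  have s2: "s2 > 0"
  proof (rule ccontr)
    assume "\<not> s2 > 0"
    define x where "x = min (r2 / 2) (1 / 2)"
    have x: "0 < x" "x < r2" "x \<le> 1" using 2(1) by (auto simp: x_def)
    have "(1 - x, 0) \<in> \<Omega>R" using 2(3)[of "(1 - x, 0)"] x \<open>\<not> s2 > 0\<close> 2(2) mult_neg_pos[of s2 x]
      by (simp add: dist_norm norm_prod_def)
    moreover have "(1 - x, 0) \<in> {0..1} \<times> {-1..1::real}" using x by auto
    ultimately show False using e by blast
  qed
  \<comment> \<open>Half of the smaller radius, because a point with both offsets below
    \<open>r\<close> is at distance below \<open>2 * r\<close> from the centre.\<close>
  define r where "r = min (min r1 r2) 1 / 2"
  have r: "0 < r" "r < 1" "2 * r \<le> r1" "2 * r \<le> r2" using 1(1) 2(1) by (auto simp: r_def)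
  have near: "dist (x, 0) (x', y) < 2 * r" if "\<bar>x' - x\<bar> < r" "\<bar>y\<bar> < r" for x x' y :: real
    using norm_Pair_le[of "x - x'" "- y"] that by (simp add: dist_norm)
  show ?thesis
  proof (rule that[of r])
    show "{-r<..<0} \<times> {-r<..<r} \<subseteq> \<Omega>L"
    proof
      fix z assume "z \<in> {-r<..<0} \<times> {-r<..<r}"
      then obtain x y where z: "z = (x, y)" "-r < x" "x < 0" "\<bar>y\<bar> < r" by auto
      then have "z \<in> ball (0, 0) r1" using near[of x 0 y] r by simp
      then show "z \<in> \<Omega>L" using 1(3) z s1 by (simp add: mult_neg_neg)
    qed
    show "{1<..<1+r} \<times> {-r<..<r} \<subseteq> \<Omega>R"
    proof
      fix z assume "z \<in> {1<..<1+r} \<times> {-r<..<r}"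
      then obtain x y where z: "z = (x, y)" "1 < x" "x < 1 + r" "\<bar>y\<bar> < r" by auto
      then have "z \<in> ball (1, 0) r2" using near[of x 1 y] r by simp
      then show "z \<in> \<Omega>R" using 2(3) z s2 by simp
    qed
  qed (use r in auto)
qed

section \<open>Cutoffs, traces and paths\<close>

lemma smooth_line_derivative:
  fixes W :: "real \<times> real \<Rightarrow> real"
  assumes "smooth W"
  shows "((\<lambda>t. W (p + t *\<^sub>R d)) has_real_derivative
     (fst d * partial_deriv (1, 0) W (p + t *\<^sub>R d) + snd d * partial_deriv (0, 1) W (p + t *\<^sub>R d))) (at t)"
proof -
  have 1: "((\<lambda>t. p + t *\<^sub>R d) has_derivative (\<lambda>h. h *\<^sub>R d)) (at t)"
    by (auto intro!: derivative_eq_intros)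
  have "((\<lambda>t. W (p + t *\<^sub>R d)) has_derivative
      (\<lambda>h. \<Sum>b\<in>Basis. ((h *\<^sub>R d) \<bullet> b) * partial_deriv b W (p + t *\<^sub>R d))) (at t)"
    by (rule has_derivative_compose[OF 1 smooth_has_derivative[OF assms]])
  then show ?thesis
    unfolding has_field_derivative_def
    by (rule has_derivative_eq_rhs) (simp add: fun_eq_iff Basis_prod_def algebra_simps inner_prod_def)
qed

text \<open>At a minimum point the square of \<open>w\<close> is at most its mean, which gives
  \<open>1 / l\<close>; the difference to any other point is the integral of
  \<open>2 * w * w'\<close>, which gives the summand 1.\<close>

lemma trace_estimate:
  fixes w w' :: "real \<Rightarrow> real"
  assumes d: "\<And>t. (w has_real_derivative w' t) (at t)" and c: "continuous_on UNIV w'"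
    and l: "0 < l" and y: "0 \<le> y" "y \<le> l"
  shows "(w y)\<^sup>2 \<le> (1 / l + 1) * integral {0..l} (\<lambda>t. (w t)\<^sup>2 + (w' t)\<^sup>2)"
proof -
  have wc: "continuous_on A w" for A
    using d DERIV_isCont continuous_at_imp_continuous_on by blast
  have w'c: "continuous_on A w'" for A using c continuous_on_subset by blast
  have "\<exists>m\<in>{0..l}. \<forall>t\<in>{0..l}. (w m)\<^sup>2 \<le> (w t)\<^sup>2"
    by (rule continuous_attains_inf) (use l wc in \<open>auto intro!: continuous_intros\<close>)
  then obtain m where m: "m \<in> {0..l}" "\<And>t. t \<in> {0..l} \<Longrightarrow> (w m)\<^sup>2 \<le> (w t)\<^sup>2" by blast
  let ?I = "integral {0..l} (\<lambda>t. (w t)\<^sup>2 + (w' t)\<^sup>2)"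
  have i: "(\<lambda>t. (w t)\<^sup>2 + (w' t)\<^sup>2) integrable_on {u..v}" for u v
    by (intro integrable_continuous_real continuous_intros wc w'c)
  have "l * (w m)\<^sup>2 = integral {0..l} (\<lambda>t. (w m)\<^sup>2)" using l by simp
  also have "\<dots> \<le> ?I"
  proof (rule integral_le)
    show "(\<lambda>t. (w m)\<^sup>2) integrable_on {0..l}" by (rule integrable_const_ivl)
    show "(w m)\<^sup>2 \<le> (w t)\<^sup>2 + (w' t)\<^sup>2" if "t \<in> {0..l}" for t
      using m(2)[OF that] by (simp add: add_increasing2)
  qed (rule i)
  finally have 1: "(w m)\<^sup>2 \<le> 1 / l * ?I" using l by (simp add: field_simps)
  have ftc: "\<bar>(w v)\<^sup>2 - (w u)\<^sup>2\<bar> \<le> ?I" if uv: "0 \<le> u" "u \<le> v" "v \<le> l" for u v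
  proof -
    have "((\<lambda>t. 2 * w t * w' t) has_integral (w v)\<^sup>2 - (w u)\<^sup>2) {u..v}"
    proof (rule fundamental_theorem_of_calculus[OF uv(2)])
      fix t
      have "((\<lambda>t. (w t)\<^sup>2) has_real_derivative 2 * w t * w' t) (at t)"
        by (auto intro!: derivative_eq_intros d)
      then show "((\<lambda>t. (w t)\<^sup>2) has_vector_derivative 2 * w t * w' t) (at t within {u..v})"
        by (simp add: has_real_derivative_iff_has_vector_derivative has_vector_derivative_at_within)
    qed
    then have "(w v)\<^sup>2 - (w u)\<^sup>2 = integral {u..v} (\<lambda>t. 2 * w t * w' t)" by (simp add: integral_unique)
    also have "\<bar>\<dots>\<bar> \<le> integral {u..v} (\<lambda>t. (w t)\<^sup>2 + (w' t)\<^sup>2)"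
      unfolding real_norm_def[symmetric]
    proof (rule integral_norm_bound_integral)
      show "(\<lambda>t. 2 * w t * w' t) integrable_on {u..v}"
        by (intro integrable_continuous_real continuous_intros wc w'c)
      show "norm (2 * w t * w' t) \<le> (w t)\<^sup>2 + (w' t)\<^sup>2" for t
        using zero_le_power2[of "\<bar>w t\<bar> - \<bar>w' t\<bar>"] by (simp add: power2_diff abs_mult)
    qed (use i in auto)
    also have "\<dots> \<le> ?I"
      by (rule integral_subset_le) (use uv i in auto)
    finally show ?thesis .
  qed
  have "\<bar>(w y)\<^sup>2 - (w m)\<^sup>2\<bar> \<le> ?I"
    using ftc[of m y] ftc[of y m] m(1) y by (cases "m \<le> y") (auto simp: abs_minus_commute)
  then show ?thesis using 1 by (simp add: algebra_simps)
qed

section \<open>Integrals over thin strips in the ends\<close>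

lemma integral_indicator_Icc:
  fixes f :: "real \<Rightarrow> real"
  assumes "continuous_on UNIV f"
  shows "integrable lborel (\<lambda>t. indicator {u..v} t * f t)"
    "(LINT t|lborel. indicator {u..v} t * f t) = integral {u..v} f"
proof -
  have "set_integrable lborel {u..v} f"
    by (rule borel_integrable_atLeastAtMost') (use assms continuous_on_subset in blast)
  then show "integrable lborel (\<lambda>t. indicator {u..v} t * f t)"
    "(LINT t|lborel. indicator {u..v} t * f t) = integral {u..v} f"
    using set_borel_integral_eq_integral(2)[of "{u..v}" f]
    by (simp_all add: set_integrable_def set_lebesgue_integral_def)
qed

lemma integrable_indicator_compact_mult:
  fixes f :: "'a::euclidean_space \<Rightarrow> real"
  assumes "compact K" "continuous_on UNIV f"
  shows "integrable lborel (\<lambda>z. indicator K z * f z)"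
proof -
  have "integrable lborel (\<lambda>z. indicator K z *\<^sub>R f z)"
    by (rule borel_integrable_compact[OF assms(1)]) (use assms(2) continuous_on_subset in blast)
  then show ?thesis by simp
qed

text \<open>On each vertical line the trace bound is the same at every height, so integrating it up
  to height \<open>Y\<close> yields the factor \<open>Y\<close>; Fubini's theorem assembles the
  lines.\<close>

lemma strip_estimate:
  fixes W :: "real \<times> real \<Rightarrow> real"
  assumes s: "smooth W" and Y: "0 \<le> Y" "Y \<le> l" "0 < l"
  shows "(LINT z|lborel. indicator ({p..q} \<times> {0..Y}) z * (W z)\<^sup>2)
    \<le> Y * (1 / l + 1) * (LINT z|lborel. indicator ({p..q} \<times> {0..l}) z * ((W z)\<^sup>2 + (partial_deriv (0, 1) W z)\<^sup>2))"
proof -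
  have "(0, 1) \<in> (Basis :: (real \<times> real) set)" by (simp add: Basis_prod_def)
  then have s2: "smooth (partial_deriv (0, 1) W)" using s smooth_partial_deriv by blast
  define G where "G z = (W z)\<^sup>2 + (partial_deriv (0, 1) W z)\<^sup>2" for z
  have Gc: "continuous_on UNIV G"
    unfolding G_def by (intro continuous_intros smooth_continuous_on s s2)
  have Wc: "continuous_on UNIV (\<lambda>z. (W z)\<^sup>2)" by (intro continuous_intros smooth_continuous_on s)
  have i1: "integrable (lborel \<Otimes>\<^sub>M lborel) (\<lambda>z. indicator ({p..q} \<times> {0..Y}) z * (W z)\<^sup>2)"
    unfolding lborel_prod by (intro integrable_indicator_compact_mult Wc compact_Times) auto
  have i2: "integrable (lborel \<Otimes>\<^sub>M lborel) (\<lambda>z. indicator ({p..q} \<times> {0..l}) z * G z)"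
    unfolding lborel_prod by (intro integrable_indicator_compact_mult Gc compact_Times) auto
  have "(LINT z|lborel. indicator ({p..q} \<times> {0..Y}) z * (W z)\<^sup>2)
     = (LINT x|lborel. LINT y|lborel. indicator ({p..q} \<times> {0..Y}) (x, y) * (W (x, y))\<^sup>2)"
    using lborel_pair.integral_fst'[OF i1] by (simp add: lborel_prod)
  also have "\<dots> \<le> (LINT x|lborel. Y * (1 / l + 1) * (LINT y|lborel. indicator ({p..q} \<times> {0..l}) (x, y) * G (x, y)))"
  proof (rule integral_mono)
    show "integrable lborel (\<lambda>x. LINT y|lborel. indicator ({p..q} \<times> {0..Y}) (x, y) * (W (x, y))\<^sup>2)"
      using lborel_pair.integrable_fst'[OF i1] by simp
    show "integrable lborel (\<lambda>x. Y * (1 / l + 1) * (LINT y|lborel. indicator ({p..q} \<times> {0..l}) (x, y) * G (x, y)))"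
      using lborel_pair.integrable_fst'[OF i2] by simp
    fix x :: real
    show "(LINT y|lborel. indicator ({p..q} \<times> {0..Y}) (x, y) * (W (x, y))\<^sup>2)
      \<le> Y * (1 / l + 1) * (LINT y|lborel. indicator ({p..q} \<times> {0..l}) (x, y) * G (x, y))"
    proof (cases "x \<in> {p..q}")
      case True
      define w where "w t = W (x, t)" for t
      define w' where "w' t = partial_deriv (0, 1) W (x, t)" for t
      have d: "(w has_real_derivative w' t) (at t)" for t
        using smooth_line_derivative[OF s, of "(x, 0)" "(0, 1)" t] by (simp add: w_def[abs_def] w'_def)
      have cx: "continuous_on UNIV (\<lambda>t. (x, t))" by (intro continuous_intros)
      have c: "continuous_on UNIV w'"
        unfolding w'_def using continuous_on_compose2[OF smooth_continuous_on[OF s2] cx, of UNIV] by simp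
      have wc: "continuous_on UNIV w"
        unfolding w_def using continuous_on_compose2[OF smooth_continuous_on[OF s] cx, of UNIV] by simp
      define C where "C = (1 / l + 1) * integral {0..l} (\<lambda>t. (w t)\<^sup>2 + (w' t)\<^sup>2)"
      have tr: "(w y)\<^sup>2 \<le> C" if "y \<in> {0..Y}" for y
        unfolding C_def by (rule trace_estimate[OF d c Y(3)]) (use that Y in auto)
      have "(LINT y|lborel. indicator ({p..q} \<times> {0..Y}) (x, y) * (W (x, y))\<^sup>2) = (LINT y|lborel. indicator {0..Y} y * (w y)\<^sup>2)"
        using True by (simp add: indicator_times w_def)
      also have "\<dots> \<le> (LINT y|lborel. indicator {0..Y} y * C)"
      proof (rule integral_mono)
        show "integrable lborel (\<lambda>y. indicator {0..Y} y * (w y)\<^sup>2)"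
          by (rule integral_indicator_Icc) (intro continuous_intros wc)
        show "integrable lborel (\<lambda>y. indicator {0..Y} y * C)"
          by (rule integral_indicator_Icc) (intro continuous_intros)
        show "indicator {0..Y} y * (w y)\<^sup>2 \<le> indicator {0..Y} y * C" for y
          using tr[of y] by (simp add: indicator_def)
      qed
      also have "\<dots> = Y * C" using Y by simp
      also have "integral {0..l} (\<lambda>t. (w t)\<^sup>2 + (w' t)\<^sup>2) = (LINT y|lborel. indicator {0..l} y * ((w y)\<^sup>2 + (w' y)\<^sup>2))"
        by (rule integral_indicator_Icc(2)[symmetric]) (intro continuous_intros wc c)
      then have "Y * C = Y * (1 / l + 1) * (LINT y|lborel. indicator ({p..q} \<times> {0..l}) (x, y) * G (x, y))"
        using True by (simp add: C_def G_def w_def w'_def indicator_times mult.assoc)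
      finally show ?thesis .
    qed (simp add: indicator_times)
  qed
  also have "\<dots> = Y * (1 / l + 1) * (LINT x|lborel. LINT y|lborel. indicator ({p..q} \<times> {0..l}) (x, y) * G (x, y))"
    by (rule Bochner_Integration.integral_mult_right_zero)
  also have "(LINT x|lborel. LINT y|lborel. indicator ({p..q} \<times> {0..l}) (x, y) * G (x, y))
      = (LINT z|lborel. indicator ({p..q} \<times> {0..l}) z * G z)"
    using lborel_pair.integral_fst'[OF i2] by (simp add: lborel_prod)
  finally show ?thesis by (simp only: G_def)
qed

section \<open>Horizontal cutoff functions\<close>

lemma partial_deriv_locally_constant:
  assumes "open S" "x \<in> S" "\<And>y. y \<in> S \<Longrightarrow> f y = (c::real)"
  shows "partial_deriv b f x = 0"
proof -
  have "(f has_derivative (\<lambda>h. 0)) (at x)"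
    by (rule has_derivative_transform_within_open[OF has_derivative_const[of c] assms(1,2)]) (simp add: assms(3))
  then show ?thesis by (rule partial_deriv_eq)
qed

text \<open>The constant is fixed before \<open>a\<close>: the cutoff is a product of two rescaled
  copies of one smooth step, and each horizontal derivative costs a factor \<open>1 / a\<close>.
  Vertical derivatives vanish because only the first coordinate enters.\<close>

lemma cutoff_exists:
  obtains C :: real where "C \<ge> 1" "\<And>a. 0 < a \<Longrightarrow> \<exists>\<xi> :: real \<times> real \<Rightarrow> real. smooth \<xi> \<and>
     (\<forall>z. 0 \<le> \<xi> z \<and> \<xi> z \<le> 1) \<and> (\<forall>z. fst z \<le> -2 * a \<or> 1 + 2 * a \<le> fst z \<longrightarrow> \<xi> z = 0) \<and>
     (\<forall>z. -a \<le> fst z \<and> fst z \<le> 1 + a \<longrightarrow> \<xi> z = 1) \<and> partial_deriv ey \<xi> = (\<lambda>z. 0) \<and>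
     partial_deriv ey (partial_deriv ex \<xi>) = (\<lambda>z. 0) \<and>
     (\<forall>z. \<bar>partial_deriv ex \<xi> z\<bar> \<le> C / a) \<and> (\<forall>z. \<bar>partial_deriv ex (partial_deriv ex \<xi>) z\<bar> \<le> C / a\<^sup>2) \<and>
     (\<forall>z. -a < fst z \<and> fst z < 1 + a \<longrightarrow> partial_deriv ex \<xi> z = 0 \<and> partial_deriv ex (partial_deriv ex \<xi>) z = 0)"
proof -
  obtain s :: "real \<Rightarrow> real" where s: "smooth s" "\<And>t. 0 \<le> s t" "\<And>t. s t \<le> 1"
    "\<And>t. t \<le> 0 \<Longrightarrow> s t = 0" "\<And>t. 1 \<le> t \<Longrightarrow> s t = 1"
    by (rule smooth_step_exists) blast
  define s1 where "s1 = partial_deriv 1 s"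
  define s2 where "s2 = partial_deriv 1 s1"
  have ss1: "smooth s1" unfolding s1_def by (rule smooth_partial_deriv[OF s(1)]) simp
  have ss2: "smooth s2" unfolding s2_def by (rule smooth_partial_deriv[OF ss1]) simp
  have z1: "s1 t = 0" if "t < 0 \<or> 1 < t" for t
    using that
  proof
    assume "t < 0"
    then show ?thesis unfolding s1_def
      by (intro partial_deriv_locally_constant[of "{..<0}" _ _ 0]) (auto intro: s(4))
  next
    assume "1 < t"
    then show ?thesis unfolding s1_def
      by (intro partial_deriv_locally_constant[of "{1<..}" _ _ 1]) (auto intro: s(5))
  qed
  have z2: "s2 t = 0" if "t < 0 \<or> 1 < t" for t
    using that
  proof
    assume "t < 0"
    then show ?thesis unfolding s2_def
      by (intro partial_deriv_locally_constant[of "{..<0}" _ _ 0]) (auto intro: z1)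
  next
    assume "1 < t"
    then show ?thesis unfolding s2_def
      by (intro partial_deriv_locally_constant[of "{1<..}" _ _ 0]) (auto intro: z1)
  qed
  obtain B1 where B1: "B1 \<ge> 0" "\<And>t. \<bar>s1 t\<bar> \<le> B1"
  proof (rule compact_support_bounded[of s1 2])
    show "continuous_on UNIV s1" using ss1 by (rule smooth_continuous_on)
    show "s1 z = 0" if "2 \<le> norm z" for z using that by (intro z1) auto
  qed blast
  obtain B2 where B2: "B2 \<ge> 0" "\<And>t. \<bar>s2 t\<bar> \<le> B2"
  proof (rule compact_support_bounded[of s2 2])
    show "continuous_on UNIV s2" using ss2 by (rule smooth_continuous_on)
    show "s2 z = 0" if "2 \<le> norm z" for z using that by (intro z2) auto
  qed blast
  \<comment> \<open>One constant for both orders: the first derivative of the product takes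
    \<open>2 * B1\<close>, the second \<open>2 * B2 + 2 * B1\<^sup>2\<close>.\<close>
  define C where "C = 1 + 2 * B1 + 2 * B2 + 2 * B1\<^sup>2"
  have C1: "C \<ge> 1" using B1(1) B2(1) by (simp add: C_def)
  show ?thesis
  proof (rule that[OF C1])
    fix a :: real assume a: "0 < a"
    define A where "A k = (\<lambda>z::real \<times> real. k * fst z)" for k :: real
    have bA: "bounded_linear (A k)" for k
      unfolding A_def by (rule bounded_linear_compose[OF bounded_linear_mult_right bounded_linear_fst])
    have Ax: "A k ex = k *\<^sub>R 1" and Ay: "A k ey = 0 *\<^sub>R 1" for k by (simp_all add: A_def)
    \<comment> \<open>The copy \<open>p s\<close> rises from 0 at \<open>fst z = -2 * a\<close> to 1
      at \<open>-a\<close>, and \<open>q s\<close> falls from 1 at \<open>1 + a\<close> to 0 at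
      \<open>1 + 2 * a\<close>.\<close>
    define p where "p f z = (f (2 + A (1 / a) z) :: real)" for f :: "real \<Rightarrow> real" and z
    define q where "q f z = (f (2 + 1 / a + A (- 1 / a) z) :: real)" for f :: "real \<Rightarrow> real" and z
    have sp: "smooth (p f)" and sq: "smooth (q f)" if "smooth f" for f
      using smooth_compose_affine[OF that bA] unfolding p_def q_def by auto
    have px: "partial_deriv ex (p f) = (\<lambda>z. 1 / a * p (partial_deriv 1 f) z)"
      and py: "partial_deriv ey (p f) = (\<lambda>z. 0)"
      and qx: "partial_deriv ex (q f) = (\<lambda>z. - 1 / a * q (partial_deriv 1 f) z)"
      and qy: "partial_deriv ey (q f) = (\<lambda>z. 0)" if "smooth f" for f
      using partial_deriv_compose_affine[OF that bA Ax] partial_deriv_compose_affine[OF that bA Ay]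
      unfolding p_def q_def by auto
    define \<xi> where "\<xi> z = p s z * q s z" for z
    have s\<xi>: "smooth \<xi>" unfolding \<xi>_def by (intro smooth_mult sp sq s)
    have \<xi>y: "partial_deriv ey \<xi> = (\<lambda>z. 0)"
      unfolding \<xi>_def partial_deriv_mult[OF sp[OF s(1)] sq[OF s(1)]] py[OF s(1)] qy[OF s(1)] by simp
    have \<xi>x: "partial_deriv ex \<xi> = (\<lambda>z. - 1 / a * (p s z * q s1 z) + 1 / a * (p s1 z * q s z))"
      unfolding \<xi>_def partial_deriv_mult[OF sp[OF s(1)] sq[OF s(1)]] px[OF s(1)] qx[OF s(1)] s1_def
      by (simp add: fun_eq_iff algebra_simps)
    have pdadd: "partial_deriv b (\<lambda>z. c * f z + d * g z) = (\<lambda>z. c * partial_deriv b f z + d * partial_deriv b g z)"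
      if "smooth f" "smooth g" for b c d and f g :: "real \<times> real \<Rightarrow> real"
    proof
      fix z
      have "(f has_derivative frechet_derivative f (at z)) (at z)" "(g has_derivative frechet_derivative g (at z)) (at z)"
        using that smooth_differentiable frechet_derivative_works by blast+
      then have "((\<lambda>z. c * f z + d * g z) has_derivative (\<lambda>h. c * frechet_derivative f (at z) h + d * frechet_derivative g (at z) h)) (at z)"
        by (intro has_derivative_add has_derivative_mult_right)
      then show "partial_deriv b (\<lambda>z. c * f z + d * g z) z = c * partial_deriv b f z + d * partial_deriv b g z"
        by (subst partial_deriv_eq) (auto simp: partial_deriv_def)
    qed
    have \<xi>xx: "partial_deriv ex (partial_deriv ex \<xi>) =
        (\<lambda>z. (p s z * q s2 z - 2 * (p s1 z * q s1 z) + p s2 z * q s z) / a\<^sup>2)"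
      unfolding \<xi>x pdadd[OF smooth_mult[OF sp[OF s(1)] sq[OF ss1]] smooth_mult[OF sp[OF ss1] sq[OF s(1)]]]
        partial_deriv_mult[OF sp[OF s(1)] sq[OF ss1]] partial_deriv_mult[OF sp[OF ss1] sq[OF s(1)]]
        px[OF s(1)] qx[OF s(1)] px[OF ss1] qx[OF ss1] s1_def[symmetric] s2_def[symmetric]
      using a by (simp add: fun_eq_iff power2_eq_square field_simps)
    have \<xi>xy: "partial_deriv ey (partial_deriv ex \<xi>) = (\<lambda>z. 0)"
      unfolding \<xi>x pdadd[OF smooth_mult[OF sp[OF s(1)] sq[OF ss1]] smooth_mult[OF sp[OF ss1] sq[OF s(1)]]]
        partial_deriv_mult[OF sp[OF s(1)] sq[OF ss1]] partial_deriv_mult[OF sp[OF ss1] sq[OF s(1)]]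
        py[OF s(1)] qy[OF s(1)] py[OF ss1] qy[OF ss1]
      by simp
    have pr: "0 \<le> p s z" "p s z \<le> 1" "0 \<le> q s z" "q s z \<le> 1" for z using s(2,3) by (auto simp: p_def q_def)
    have b1: "\<bar>p s1 z\<bar> \<le> B1" "\<bar>q s1 z\<bar> \<le> B1" "\<bar>p s2 z\<bar> \<le> B2" "\<bar>q s2 z\<bar> \<le> B2" for z
      using B1(2) B2(2) by (auto simp: p_def q_def)
    have bx: "\<bar>partial_deriv ex \<xi> z\<bar> \<le> C / a" for z
    proof -
      have "\<bar>p s z * q s1 z\<bar> \<le> 1 * B1" "\<bar>p s1 z * q s z\<bar> \<le> B1 * 1"
        unfolding abs_mult by (intro mult_mono; use pr[of z] b1[of z] B1 in simp)+
      then have "\<bar>- (p s z * q s1 z) + p s1 z * q s z\<bar> \<le> C"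
        using B1(1) B2(1) zero_le_power2[of B1] unfolding C_def by linarith
      then have "\<bar>- (p s z * q s1 z) + p s1 z * q s z\<bar> / a \<le> C / a" using a by (simp add: divide_right_mono)
      moreover have "partial_deriv ex \<xi> z = (- (p s z * q s1 z) + p s1 z * q s z) / a"
        unfolding \<xi>x using a by (simp add: field_simps)
      ultimately show ?thesis using a by simp
    qed
    have bxx: "\<bar>partial_deriv ex (partial_deriv ex \<xi>) z\<bar> \<le> C / a\<^sup>2" for z
    proof -
      have 1: "\<bar>p s z * q s2 z\<bar> \<le> 1 * B2" "\<bar>p s2 z * q s z\<bar> \<le> B2 * 1"
        unfolding abs_mult by (intro mult_mono; use pr[of z] b1[of z] B2 in simp)+
      have 2: "\<bar>p s1 z * q s1 z\<bar> \<le> B1 * B1"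
        unfolding abs_mult by (intro mult_mono; use b1[of z] B1 in simp)
      have "\<bar>p s z * q s2 z - 2 * (p s1 z * q s1 z) + p s2 z * q s z\<bar> \<le> C"
        using 1 2 B1(1) B2(1) unfolding C_def power2_eq_square by linarith
      then show ?thesis unfolding \<xi>xx using a by (simp add: divide_right_mono)
    qed
    have k1: "2 + fst z / a = (2 * a + fst z) / a" and k2: "2 + 1 / a - fst z / a = (1 + 2 * a - fst z) / a" for z :: "real \<times> real"
      using a by (simp_all add: field_simps)
    have zero: "\<xi> z = 0" if "fst z \<le> -2 * a \<or> 1 + 2 * a \<le> fst z" for z
      using that
    proof
      assume "fst z \<le> -2 * a"
      then have "2 + fst z / a \<le> 0" unfolding k1 using a by (simp add: divide_nonpos_pos)
      then show ?thesis using s(4) by (simp add: \<xi>_def p_def A_def)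
    next
      assume "1 + 2 * a \<le> fst z"
      then have "2 + 1 / a - fst z / a \<le> 0" unfolding k2 using a by (simp add: divide_nonpos_pos)
      then show ?thesis using s(4) by (simp add: \<xi>_def q_def A_def)
    qed
    have one: "\<xi> z = 1" if "-a \<le> fst z \<and> fst z \<le> 1 + a" for z
    proof -
      have "1 \<le> 2 + fst z / a" "1 \<le> 2 + 1 / a - fst z / a" unfolding k1 k2 using a that by (simp_all add: pos_le_divide_eq)
      then show ?thesis using s(5) by (simp add: \<xi>_def q_def p_def A_def)
    qed
    have mid: "partial_deriv ex \<xi> z = 0 \<and> partial_deriv ex (partial_deriv ex \<xi>) z = 0" if "-a < fst z \<and> fst z < 1 + a" for z
    proof -
      have "1 < 2 + fst z / a" "1 < 2 + 1 / a - fst z / a" unfolding k1 k2 using a that by (simp_all add: pos_less_divide_eq)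
      then have "p s1 z = 0" "q s1 z = 0" "p s2 z = 0" "q s2 z = 0"
        using z1 z2 by (simp_all add: p_def q_def A_def)
      then have "partial_deriv ex \<xi> z = 0" "partial_deriv ex (partial_deriv ex \<xi>) z = 0"
        unfolding \<xi>xx unfolding \<xi>x by simp_all
      then show ?thesis by simp
    qed
    have "0 \<le> \<xi> z \<and> \<xi> z \<le> 1" for z
      using pr[of z] mult_mono[of "p s z" 1 "q s z" 1] by (simp add: \<xi>_def)
    with s\<xi> zero one \<xi>y \<xi>xy bx bxx mid show "\<exists>\<xi> :: real \<times> real \<Rightarrow> real. smooth \<xi> \<and>
     (\<forall>z. 0 \<le> \<xi> z \<and> \<xi> z \<le> 1) \<and> (\<forall>z. fst z \<le> -2 * a \<or> 1 + 2 * a \<le> fst z \<longrightarrow> \<xi> z = 0) \<and>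
     (\<forall>z. -a \<le> fst z \<and> fst z \<le> 1 + a \<longrightarrow> \<xi> z = 1) \<and> partial_deriv ey \<xi> = (\<lambda>z. 0) \<and>
     partial_deriv ey (partial_deriv ex \<xi>) = (\<lambda>z. 0) \<and>
     (\<forall>z. \<bar>partial_deriv ex \<xi> z\<bar> \<le> C / a) \<and> (\<forall>z. \<bar>partial_deriv ex (partial_deriv ex \<xi>) z\<bar> \<le> C / a\<^sup>2) \<and>
     (\<forall>z. -a < fst z \<and> fst z < 1 + a \<longrightarrow> partial_deriv ex \<xi> z = 0 \<and> partial_deriv ex (partial_deriv ex \<xi>) z = 0)"
      by (intro exI[of _ \<xi>]) blast
  qed
qed

text \<open>\<open>squeeze \<kappa> c s\<close> stretches the channel across both junctions into the two ends, and contracts it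
  vertically about the height \<open>c\<close> so that the image stays inside the dumbbell.\<close>

definition squeeze :: "real \<Rightarrow> real \<Rightarrow> real \<Rightarrow> real \<times> real \<Rightarrow> real \<times> real" where
  "squeeze \<kappa> c s z = (- 3 * s, c * (\<kappa> * s)) + ((1 + 6 * s) * fst z, (1 - \<kappa> * s) * snd z)"

text \<open>As \<open>t\<close> grows the image of a point moves along a straight segment that
  starts at the point itself, so the change of a function under the squeeze is an integral of its
  gradient along that segment.\<close>

lemma squeeze_line:
  "squeeze \<kappa> c (t * s) z = z + t *\<^sub>R (s * (6 * fst z - 3), s * (\<kappa> * (c - snd z)))"
  by (simp add: squeeze_def prod_eq_iff algebra_simps)

lemma squeeze_lebesgue:
  fixes \<phi> :: "real \<times> real \<Rightarrow> real"
  assumes s: "0 < 1 + 6 * s" "0 < 1 - \<kappa> * s" and i: "integrable lborel \<phi>"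
  shows "integrable lborel (\<lambda>z. \<phi> (squeeze \<kappa> c s z))"
    and "(1 + 6 * s) * (1 - \<kappa> * s) * (LINT z|lborel. \<phi> (squeeze \<kappa> c s z)) = (LINT z|lborel. \<phi> z)"
proof -
  define d where "d j = (if j = ex then 1 + 6 * s else 1 - \<kappa> * s)" for j :: "real \<times> real"
  define T where "T = squeeze \<kappa> c s"
  have T: "T = (\<lambda>x. (- 3 * s, c * (\<kappa> * s)) + (\<Sum>j\<in>Basis. (d j * (x \<bullet> j)) *\<^sub>R j))"
    by (simp add: T_def squeeze_def fun_eq_iff Basis_plane d_def inner_prod_def)
  have Tm [measurable]: "T \<in> borel \<rightarrow>\<^sub>M borel" unfolding T by simp
  define J where "J = (1 + 6 * s) * (1 - \<kappa> * s)"
  have J: "J > 0" using s by (simp add: J_def)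
  have Jp: "(\<Prod>j\<in>Basis. \<bar>d j\<bar>) = J" using s by (simp add: Basis_plane d_def J_def)
  have "lborel = density (distr lborel borel T) (\<lambda>_. (\<Prod>j\<in>Basis. \<bar>d j\<bar>))"
    unfolding T by (rule lborel_affine_euclidean) (use s in \<open>auto simp: d_def\<close>)
  then have eq: "lborel = density (distr lborel borel T) (\<lambda>_. ennreal J)" by (simp add: Jp)
  have pm [measurable]: "\<phi> \<in> borel_measurable borel" using borel_measurable_integrable[OF i] by simp
  have "integrable (density (distr lborel borel T) (\<lambda>_. ennreal J)) \<phi>" using i eq by simp
  then have "integrable (distr lborel borel T) (\<lambda>z. J *\<^sub>R \<phi> z)"
    using J by (subst (asm) integrable_density) auto
  then have "integrable lborel (\<lambda>z. J *\<^sub>R \<phi> (T z))"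
    by (subst (asm) integrable_distr_eq) auto
  then show "integrable lborel (\<lambda>z. \<phi> (squeeze \<kappa> c s z))" using J by (simp add: T_def)
  have "(LINT z|lborel. \<phi> z) = (LINT z|density (distr lborel borel T) (\<lambda>_. ennreal J). \<phi> z)"
    using eq by simp
  also have "\<dots> = (LINT z|distr lborel borel T. J *\<^sub>R \<phi> z)"
    using J by (intro integral_density) auto
  also have "\<dots> = (LINT z|lborel. J *\<^sub>R \<phi> (T z))"
    by (rule integral_distr) auto
  finally show "(1 + 6 * s) * (1 - \<kappa> * s) * (LINT z|lborel. \<phi> (squeeze \<kappa> c s z)) = (LINT z|lborel. \<phi> z)"
    by (simp add: J_def T_def)
qed

text \<open>The Jacobian is at least \<open>1 - \<kappa> * s\<close>, and \<open>1 + 2 * t\<close>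
  dominates \<open>1 / (1 - t)\<close> for \<open>t\<close> between 0 and
  \<open>1 / 2\<close>.\<close>

lemma squeeze_integral_le:
  fixes \<phi> :: "real \<times> real \<Rightarrow> real"
  assumes s: "0 \<le> s" "0 \<le> \<kappa>" "\<kappa> * s \<le> 1 / 2" and i: "integrable lborel \<phi>" and nn: "\<And>z. 0 \<le> \<phi> z"
  shows "(LINT z|lborel. \<phi> (squeeze \<kappa> c s z)) \<le> (1 + 2 * (\<kappa> * s)) * (LINT z|lborel. \<phi> z)"
proof -
  have True: "0 \<le> \<kappa> * s" using s by simp
  define I where "I = (LINT z|lborel. \<phi> (squeeze \<kappa> c s z))"
  have I: "0 \<le> I" using nn by (simp add: I_def)
  have e: "(1 + 6 * s) * (1 - \<kappa> * s) * I = (LINT z|lborel. \<phi> z)"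
    unfolding I_def by (rule squeeze_lebesgue(2)[OF _ _ i]) (use s in auto)
  have "(1 - \<kappa> * s) \<le> (1 + 6 * s) * (1 - \<kappa> * s)"
    using mult_right_mono[of 1 "1 + 6 * s" "1 - \<kappa> * s"] s by simp
  moreover have "1 \<le> (1 + 2 * (\<kappa> * s)) * (1 - \<kappa> * s)"
    using mult_nonneg_nonneg[OF True, of "1 - 2 * (\<kappa> * s)"] s by (simp add: algebra_simps)
  ultimately have "1 \<le> (1 + 2 * (\<kappa> * s)) * ((1 + 6 * s) * (1 - \<kappa> * s))"
    using mult_left_mono[of "1 - \<kappa> * s" "(1 + 6 * s) * (1 - \<kappa> * s)" "1 + 2 * (\<kappa> * s)"] True by linarith
  from mult_right_mono[OF this I] show ?thesis
    unfolding e[symmetric] I_def[symmetric] by (simp add: mult.assoc)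
qed

text \<open>Cauchy-Schwarz on the unit interval, written as nonnegativity of the variance of
  \<open>h'\<close>.\<close>

lemma derivative_L2_bound:
  fixes h h' :: "real \<Rightarrow> real"
  assumes d: "\<And>t. (h has_real_derivative h' t) (at t)" and c: "continuous_on UNIV h'"
  shows "(h 1 - h 0)\<^sup>2 \<le> integral {0..1} (\<lambda>t. (h' t)\<^sup>2)"
proof -
  define m where "m = h 1 - h 0"
  have c': "continuous_on A h'" for A using c continuous_on_subset by blast
  have hi: "(h' has_integral m) {0..1}"
    unfolding m_def
    by (rule fundamental_theorem_of_calculus)
      (use d in \<open>auto simp: has_real_derivative_iff_has_vector_derivative intro: has_vector_derivative_at_within\<close>)
  have i1: "h' integrable_on {0..1}" "(\<lambda>t. (h' t)\<^sup>2) integrable_on {0..1}"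
    by (intro integrable_continuous_real continuous_intros c')+
  have "0 \<le> integral {0..1} (\<lambda>t. (h' t - m)\<^sup>2)"
    by (rule integral_nonneg) (auto intro!: integrable_continuous_real continuous_intros c')
  also have "(\<lambda>t. (h' t - m)\<^sup>2) = (\<lambda>t. (h' t)\<^sup>2 - 2 * m * h' t + m\<^sup>2)"
    by (simp add: fun_eq_iff power2_eq_square algebra_simps)
  also have "integral {0..1} \<dots> = integral {0..1} (\<lambda>t. (h' t)\<^sup>2) - 2 * m * m + m\<^sup>2"
  proof -
    have "((\<lambda>t. (h' t)\<^sup>2 - 2 * m * h' t + m\<^sup>2) has_integral
        (integral {0..1} (\<lambda>t. (h' t)\<^sup>2) - 2 * m * m + m\<^sup>2)) {0..1}"
      using has_integral_add[OF has_integral_diff[OF integrable_integral[OF i1(2)] has_integral_mult_right[OF hi, of "2 * m"]]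
          has_integral_const_real[of "m\<^sup>2" 0 1]] by simp
    then show ?thesis by (rule integral_unique)
  qed
  finally show ?thesis by (simp add: m_def[symmetric] power2_eq_square)
qed

text \<open>The squared increment along a segment is at most its squared length, bounded by
  \<open>(3 + \<kappa>)\<^sup>2 * a\<^sup>2\<close>, times the mean square of the gradient on it.
  For fixed \<open>t\<close> the points reached are an affine image of \<open>K\<close>, and the
  change of variables costs at most a factor 2. Hence \<open>P\<close> must contain the whole
  segments and not only their ends.\<close>

lemma path_estimate:
  fixes U :: "real \<times> real \<Rightarrow> real"
  assumes s: "smooth U" and K: "compact K" and P: "compact P" and a: "0 < a" "0 \<le> \<kappa>" "\<kappa> * a \<le> 1 / 2"
    and KP: "\<And>z t. z \<in> K \<Longrightarrow> 0 \<le> t \<Longrightarrow> t \<le> 1 \<Longrightarrow> squeeze \<kappa> c (t * a) z \<in> P"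
    and Kb: "\<And>z. z \<in> K \<Longrightarrow> 0 \<le> fst z \<and> fst z \<le> 1 \<and> \<bar>c - snd z\<bar> \<le> 1"
  shows "(LINT z|lborel. indicator K z * (U (squeeze \<kappa> c a z) - U z)\<^sup>2)
    \<le> 2 * (3 + \<kappa>)\<^sup>2 * a\<^sup>2 * (LINT z|lborel. indicator P z * ((partial_deriv ex U z)\<^sup>2 + (partial_deriv ey U z)\<^sup>2))"
proof -
  define G where "G z = (partial_deriv ex U z)\<^sup>2 + (partial_deriv ey U z)\<^sup>2" for z
  have sx: "smooth (partial_deriv ex U)" and sy: "smooth (partial_deriv ey U)"
    using smooth_partial_deriv[OF s] by (auto simp: Basis_plane)
  have Gc: "continuous_on A G" for A
    unfolding G_def by (intro continuous_intros smooth_continuous_on sx sy)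
  have G0: "0 \<le> G z" for z by (simp add: G_def)
  define D where "D = (3 + \<kappa>)\<^sup>2 * a\<^sup>2"
  have D: "0 \<le> D" by (simp add: D_def)
  define B where "B = (LINT z|lborel. indicator P z * G z)"
  define H where "H t z = G (squeeze \<kappa> c (t * a) z)" for t z
  have sqc: "continuous_on UNIV (\<lambda>p. squeeze \<kappa> c (fst p * a) (snd p))"
    unfolding squeeze_def by (intro continuous_intros)
  have Hc: "continuous_on UNIV (\<lambda>p. H (fst p) (snd p))"
    unfolding H_def by (rule continuous_on_compose2[OF Gc[of UNIV] sqc]) simp
  have Hct: "continuous_on UNIV (\<lambda>t. H t z)" for z
    using continuous_on_compose2[OF Hc, of UNIV "\<lambda>t. (t, z)"] by (simp add: continuous_on_Pair)
  have Hcz: "continuous_on UNIV (H t)" for t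
    using continuous_on_compose2[OF Hc, of UNIV "\<lambda>z. (t, z)"] by (simp add: continuous_on_Pair)
  have pw: "(U (squeeze \<kappa> c a z) - U z)\<^sup>2 \<le> D * integral {0..1} (\<lambda>t. H t z)" if z: "z \<in> K" for z
  proof -
    define d where "d = (a * (6 * fst z - 3), a * (\<kappa> * (c - snd z)))"
    have sl: "squeeze \<kappa> c (t * a) z = z + t *\<^sub>R d" for t unfolding d_def by (rule squeeze_line)
    define h where "h t = U (z + t *\<^sub>R d)" for t
    define h' where "h' t = fst d * partial_deriv ex U (z + t *\<^sub>R d) + snd d * partial_deriv ey U (z + t *\<^sub>R d)" for t
    have dh: "(h has_real_derivative h' t) (at t)" for t
      unfolding h_def h'_def by (rule smooth_line_derivative[OF s])
    have lc: "continuous_on UNIV (\<lambda>t. z + t *\<^sub>R d)" by (intro continuous_intros)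
    have hc: "continuous_on UNIV h'"
      unfolding h'_def
      by (intro continuous_intros continuous_on_compose2[OF smooth_continuous_on[OF sx] lc, of UNIV]
          continuous_on_compose2[OF smooth_continuous_on[OF sy] lc, of UNIV]) auto
    have d2: "(fst d)\<^sup>2 + (snd d)\<^sup>2 \<le> D"
    proof -
      have "\<bar>6 * fst z - 3\<bar> \<le> \<bar>3\<bar>" using Kb[OF z] by auto
      then have 1: "(6 * fst z - 3)\<^sup>2 \<le> 3\<^sup>2" by (rule abs_le_square_iff[THEN iffD1])
      have "\<bar>c - snd z\<bar> \<le> \<bar>1\<bar>" using Kb[OF z] by auto
      then have "(c - snd z)\<^sup>2 \<le> 1\<^sup>2" by (rule abs_le_square_iff[THEN iffD1])
      then have 2: "\<kappa>\<^sup>2 * (c - snd z)\<^sup>2 \<le> \<kappa>\<^sup>2 * 1" by (intro mult_left_mono) auto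
      have "(6 * fst z - 3)\<^sup>2 + \<kappa>\<^sup>2 * (c - snd z)\<^sup>2 \<le> (3 + \<kappa>)\<^sup>2"
        using 1 2 a(2) by (simp add: power2_sum)
      then have "a\<^sup>2 * ((6 * fst z - 3)\<^sup>2 + \<kappa>\<^sup>2 * (c - snd z)\<^sup>2) \<le> a\<^sup>2 * (3 + \<kappa>)\<^sup>2"
        by (rule mult_left_mono) simp
      then show ?thesis by (simp add: d_def D_def power_mult_distrib distrib_left mult_ac)
    qed
    have bound: "(h' t)\<^sup>2 \<le> D * H t z" for t
    proof -
      have cs: "(x1 * y1 + x2 * y2)\<^sup>2 \<le> (x1\<^sup>2 + x2\<^sup>2) * (y1\<^sup>2 + y2\<^sup>2)" for x1 x2 y1 y2 :: real
        using zero_le_power2[of "x1 * y2 - x2 * y1"] by (simp add: power2_eq_square algebra_simps)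
      have "(h' t)\<^sup>2 \<le> ((fst d)\<^sup>2 + (snd d)\<^sup>2) * G (z + t *\<^sub>R d)"
        unfolding h'_def G_def by (rule cs)
      also have "\<dots> \<le> D * G (z + t *\<^sub>R d)" by (rule mult_right_mono[OF d2 G0])
      finally show ?thesis by (simp add: H_def sl)
    qed
    have "U (squeeze \<kappa> c a z) - U z = h 1 - h 0" using sl[of 1] by (simp add: h_def)
    then have "(U (squeeze \<kappa> c a z) - U z)\<^sup>2 \<le> integral {0..1} (\<lambda>t. (h' t)\<^sup>2)"
      using derivative_L2_bound[OF dh hc] by simp
    also have "\<dots> \<le> integral {0..1} (\<lambda>t. D * H t z)"
    proof (rule integral_le)
      show "(\<lambda>t. (h' t)\<^sup>2) integrable_on {0..1}"
        using hc continuous_on_subset by (intro integrable_continuous_real continuous_intros) blast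
      show "(\<lambda>t. D * H t z) integrable_on {0..1}"
        using Hct continuous_on_subset by (intro integrable_continuous_real continuous_intros) blast
    qed (rule bound)
    finally show ?thesis by simp
  qed
  have i2: "integrable (lborel \<Otimes>\<^sub>M lborel) (\<lambda>p. indicator ({0..1} \<times> K) p * H (fst p) (snd p))"
    unfolding lborel_prod by (intro integrable_indicator_compact_mult Hc compact_Times K) auto
  define f where "f t z = indicator {0..1::real} t * (indicator K z * H t z)" for t z
  have i3: "integrable (lborel \<Otimes>\<^sub>M lborel) (case_prod f)"
  proof -
    have "case_prod f = (\<lambda>p. indicator ({0..1} \<times> K) p * H (fst p) (snd p))"
      by (auto simp: f_def fun_eq_iff indicator_times)
    then show ?thesis using i2 by simp
  qed
  have "(LINT z|lborel. indicator K z * (U (squeeze \<kappa> c a z) - U z)\<^sup>2) \<le> (LINT z|lborel. D * (LINT t|lborel. f t z))"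
  proof (rule integral_mono)
    show "integrable lborel (\<lambda>z. indicator K z * (U (squeeze \<kappa> c a z) - U z)\<^sup>2)"
    proof (rule integrable_indicator_compact_mult[OF K])
      have "continuous_on UNIV (squeeze \<kappa> c a)" unfolding squeeze_def by (intro continuous_intros)
      then have "continuous_on UNIV (\<lambda>z. U (squeeze \<kappa> c a z))"
        using continuous_on_compose2[OF smooth_continuous_on[OF s, of UNIV]] by blast
      from continuous_on_power[OF continuous_on_diff[OF this smooth_continuous_on[OF s]]]
      show "continuous_on UNIV (\<lambda>z. (U (squeeze \<kappa> c a z) - U z)\<^sup>2)" .
    qed
    show "integrable lborel (\<lambda>z. D * (LINT t|lborel. f t z))"
      using lborel_pair.integrable_snd[OF i3] by simp
    fix z
    have "(LINT t|lborel. f t z) = indicator K z * (LINT t|lborel. indicator {0..1} t * H t z)"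
      unfolding f_def by (simp add: mult.left_commute)
    also have "(LINT t|lborel. indicator {0..1} t * H t z) = integral {0..1} (\<lambda>t. H t z)"
      by (rule integral_indicator_Icc(2)[OF Hct])
    finally show "indicator K z * (U (squeeze \<kappa> c a z) - U z)\<^sup>2 \<le> D * (LINT t|lborel. f t z)"
      using pw[of z] by (cases "z \<in> K") auto
  qed
  also have "\<dots> = D * (LINT z|lborel. LINT t|lborel. f t z)" by (rule Bochner_Integration.integral_mult_right_zero)
  also have "(LINT z|lborel. LINT t|lborel. f t z) = (LINT t|lborel. LINT z|lborel. f t z)"
    by (rule lborel_pair.Fubini_integral[OF i3])
  also have "\<dots> \<le> (LINT t|lborel. indicator {0..1::real} t * (2 * B))"
  proof (rule integral_mono)
    show "integrable lborel (\<lambda>t. LINT z|lborel. f t z)" using lborel_pair.integrable_fst[OF i3] by simp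
    show "integrable lborel (\<lambda>t. indicator {0..1::real} t * (2 * B))"
      by (rule integral_indicator_Icc) (intro continuous_intros)
    fix t :: real
    have iP: "integrable lborel (\<lambda>z. indicator P z * G z)" by (rule integrable_indicator_compact_mult[OF P Gc])
    have B0: "0 \<le> B" unfolding B_def using G0 by (intro integral_nonneg_AE) auto
    show "(LINT z|lborel. f t z) \<le> indicator {0..1} t * (2 * B)"
    proof (cases "t \<in> {0..1}")
      case True
      have ta: "0 \<le> t * a" "\<kappa> * (t * a) \<le> 1 / 2"
      proof -
        have "t * (\<kappa> * a) \<le> 1 * (\<kappa> * a)" by (rule mult_right_mono) (use True a in auto)
        then show "\<kappa> * (t * a) \<le> 1 / 2" using a by (simp add: mult.left_commute)
      qed (use True a in auto)
      have sq: "0 < 1 + 6 * (t * a)" "0 < 1 - \<kappa> * (t * a)" using ta by auto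
      have "(LINT z|lborel. f t z) = (LINT z|lborel. indicator K z * H t z)" using True by (simp add: f_def)
      also have "\<dots> \<le> (LINT z|lborel. indicator P (squeeze \<kappa> c (t * a) z) * G (squeeze \<kappa> c (t * a) z))"
      proof (rule integral_mono)
        show "integrable lborel (\<lambda>z. indicator K z * H t z)" by (rule integrable_indicator_compact_mult[OF K Hcz])
        show "integrable lborel (\<lambda>z. indicator P (squeeze \<kappa> c (t * a) z) * G (squeeze \<kappa> c (t * a) z))"
          by (rule squeeze_lebesgue(1)[OF sq iP])
        fix z
        show "indicator K z * H t z \<le> indicator P (squeeze \<kappa> c (t * a) z) * G (squeeze \<kappa> c (t * a) z)"
          using KP[of z t] True G0 by (cases "z \<in> K") (auto simp: H_def)
      qed
      also have "\<dots> \<le> (1 + 2 * (\<kappa> * (t * a))) * B"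
        unfolding B_def by (rule squeeze_integral_le[OF ta(1) a(2) ta(2) iP]) (use G0 in simp)
      also have "\<dots> \<le> 2 * B" by (rule mult_right_mono[OF _ B0]) (use ta in simp)
      finally show ?thesis using True by simp
    qed (simp add: f_def)
  qed
  also have "\<dots> = 2 * B" by simp
  finally have "(LINT z|lborel. indicator K z * (U (squeeze \<kappa> c a z) - U z)\<^sup>2) \<le> D * (2 * B)"
    using D by (simp add: mult_left_mono)
  then show ?thesis by (simp add: D_def B_def G_def mult_ac)
qed

text \<open>The strip bound is applied to \<open>U\<close> and both first derivatives. Their squares
  and those of their vertical derivatives all occur in the full jet, the vertical derivative of
  \<open>U\<close> twice; this is the factor 2.\<close>

lemma strip_jet_estimate:
  fixes U :: "real \<times> real \<Rightarrow> real"
  assumes s: "smooth U" and Y: "0 \<le> Y" "Y \<le> l" "0 < l"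
  shows "(LINT z|lborel. indicator ({p..q} \<times> {0..Y}) z * ((U z)\<^sup>2 + (partial_deriv ex U z)\<^sup>2 + (partial_deriv ey U z)\<^sup>2))
    \<le> 2 * Y * (1 / l + 1) * (LINT z|lborel. indicator ({p..q} \<times> {0..l}) z * jet_energy 0 1 (\<lambda>bs. foldr partial_deriv bs U z))"
proof -
  let ?S = "{p..q} \<times> {0..Y}" and ?Q = "{p..q} \<times> {0..l}"
  have sx: "smooth (partial_deriv ex U)" and sy: "smooth (partial_deriv ey U)"
    using smooth_partial_deriv[OF s] by (auto simp: Basis_plane)
  have sm: "smooth (foldr partial_deriv bs U)" if "bs \<in> jet_indices" for bs
    using smooth_iterated_partial_deriv[OF s] that jet_indices_iff by blast
  have J: "[ex] \<in> jet_indices" "[ey] \<in> jet_indices" "[ex, ex] \<in> jet_indices"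
    "[ex, ey] \<in> jet_indices" "[ey, ex] \<in> jet_indices" "[ey, ey] \<in> jet_indices" by (auto simp: jet_indices_def)
  have iS: "integrable lborel (\<lambda>z. indicator ?S z * (f z)\<^sup>2)" "integrable lborel (\<lambda>z. indicator ?Q z * (f z)\<^sup>2)"
    if "smooth f" for f
    by (intro integrable_indicator_compact_mult compact_Times continuous_intros smooth_continuous_on that; simp)+
  let ?I = "\<lambda>f. LINT z|lborel. indicator ?Q z * (f z)\<^sup>2"
  have est: "(LINT z|lborel. indicator ?S z * (W z)\<^sup>2) \<le> Y * (1 / l + 1) * (?I W + ?I (partial_deriv ey W))"
    if W: "smooth W" for W
  proof -
    have sW: "smooth (partial_deriv ey W)" using smooth_partial_deriv[OF W] by (auto simp: Basis_plane)
    have "(LINT z|lborel. indicator ?Q z * ((W z)\<^sup>2 + (partial_deriv ey W z)\<^sup>2)) = ?I W + ?I (partial_deriv ey W)"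
      unfolding distrib_left using iS[OF W] iS[OF sW] by simp
    then show ?thesis using strip_estimate[OF W Y, of p q] by simp
  qed
  have "(LINT z|lborel. indicator ?S z * ((U z)\<^sup>2 + (partial_deriv ex U z)\<^sup>2 + (partial_deriv ey U z)\<^sup>2))
    = (LINT z|lborel. indicator ?S z * (U z)\<^sup>2) + (LINT z|lborel. indicator ?S z * (partial_deriv ex U z)\<^sup>2)
      + (LINT z|lborel. indicator ?S z * (partial_deriv ey U z)\<^sup>2)"
    unfolding distrib_left using iS(1)[OF s] iS(1)[OF sx] iS(1)[OF sy] by simp
  also have "\<dots> \<le> Y * (1 / l + 1) * ((?I U + ?I (partial_deriv ey U)) + (?I (partial_deriv ex U) + ?I (partial_deriv ey (partial_deriv ex U)))
      + (?I (partial_deriv ey U) + ?I (partial_deriv ey (partial_deriv ey U))))"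
    unfolding distrib_left[of "Y * (1 / l + 1)"] using est[OF s] est[OF sx] est[OF sy] unfolding distrib_left[of "Y * (1 / l + 1)"]
    by linarith
  also have "\<dots> \<le> Y * (1 / l + 1) * (2 * (LINT z|lborel. indicator ?Q z * jet_energy 0 1 (\<lambda>bs. foldr partial_deriv bs U z)))"
  proof (rule mult_left_mono)
    have I0: "0 \<le> ?I f" for f :: "real \<times> real \<Rightarrow> real" by (intro integral_nonneg_AE) auto
    have "(LINT z|lborel. indicator ?Q z * jet_energy 0 1 (\<lambda>bs. foldr partial_deriv bs U z))
       = ?I (partial_deriv ex (partial_deriv ex U)) + ?I (partial_deriv ey (partial_deriv ey U)) + ?I (partial_deriv ex (partial_deriv ey U))
        + ?I (partial_deriv ey (partial_deriv ex U)) + ?I (partial_deriv ex U) + ?I (partial_deriv ey U) + ?I U"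
      unfolding jet_energy_sum_squares distrib_left
      using iS(2)[OF s] iS(2)[OF sm[OF J(1)]] iS(2)[OF sm[OF J(2)]] iS(2)[OF sm[OF J(3)]] iS(2)[OF sm[OF J(4)]]
        iS(2)[OF sm[OF J(5)]] iS(2)[OF sm[OF J(6)]] by simp
    then show "?I U + ?I (partial_deriv ey U) + (?I (partial_deriv ex U) + ?I (partial_deriv ey (partial_deriv ex U)))
      + (?I (partial_deriv ey U) + ?I (partial_deriv ey (partial_deriv ey U)))
      \<le> 2 * (LINT z|lborel. indicator ?Q z * jet_energy 0 1 (\<lambda>bs. foldr partial_deriv bs U z))"
      using I0[of U] I0[of "partial_deriv ex U"] I0[of "partial_deriv ey (partial_deriv ex U)"]
        I0[of "partial_deriv ex (partial_deriv ex U)"] I0[of "partial_deriv ex (partial_deriv ey U)"]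
        I0[of "partial_deriv ey (partial_deriv ey U)"] by linarith
    show "0 \<le> Y * (1 / l + 1)" using Y by simp
  qed
  also have "Y * w * (2 * x) = 2 * Y * w * x" for w x :: real by simp
  finally show ?thesis .
qed

section \<open>Energy of the squeezed function\<close>

lemma partial_deriv_add:
  assumes "smooth f" "smooth g"
  shows "partial_deriv b (\<lambda>z. f z + g z) = (\<lambda>z. partial_deriv b f z + partial_deriv b g z)"
proof
  fix z
  have "(f has_derivative frechet_derivative f (at z)) (at z)" "(g has_derivative frechet_derivative g (at z)) (at z)"
    using assms smooth_differentiable frechet_derivative_works by blast+
  from has_derivative_add[OF this] show "partial_deriv b (\<lambda>z. f z + g z) z = partial_deriv b f z + partial_deriv b g z"
    by (subst partial_deriv_eq) (auto simp: partial_deriv_def)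
qed

definition squeeze_factor :: "real \<Rightarrow> real \<Rightarrow> (real \<times> real) list \<Rightarrow> real" where
  "squeeze_factor \<kappa> s bs = prod_list (map (\<lambda>b. if b = ex then 1 + 6 * s else 1 - \<kappa> * s) bs)"

lemma smooth_squeeze: "smooth w \<Longrightarrow> smooth (\<lambda>z. w (squeeze \<kappa> c s z))"
  and partial_deriv_squeeze: "smooth w \<Longrightarrow> b \<in> Basis \<Longrightarrow>
    partial_deriv b (\<lambda>z. w (squeeze \<kappa> c s z)) = (\<lambda>z. squeeze_factor \<kappa> s [b] * partial_deriv b w (squeeze \<kappa> c s z))"
proof -
  have bl: "bounded_linear (\<lambda>z::real \<times> real. ((1 + 6 * s) * fst z, (1 - \<kappa> * s) * snd z))"
    by (intro bounded_linear_Pair bounded_linear_compose[OF bounded_linear_mult_right] bounded_linear_fst bounded_linear_snd)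
  show "smooth (\<lambda>z. w (squeeze \<kappa> c s z))" if "smooth w"
    unfolding squeeze_def by (rule smooth_compose_affine[OF that bl])
  show "partial_deriv b (\<lambda>z. w (squeeze \<kappa> c s z)) = (\<lambda>z. squeeze_factor \<kappa> s [b] * partial_deriv b w (squeeze \<kappa> c s z))"
    if "smooth w" "b \<in> Basis"
    unfolding squeeze_def
    by (rule partial_deriv_compose_affine[OF that(1) bl]) (use that(2) in \<open>auto simp: Basis_plane squeeze_factor_def\<close>)
qed

lemma jet_squeeze:
  assumes "smooth w" "set bs \<subseteq> Basis"
  shows "foldr partial_deriv bs (\<lambda>z. w (squeeze \<kappa> c s z))
    = (\<lambda>z. squeeze_factor \<kappa> s bs * foldr partial_deriv bs w (squeeze \<kappa> c s z))"
  using assms(2)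
proof (induction bs)
  case (Cons b bs)
  have sm: "smooth (foldr partial_deriv bs w)" by (rule smooth_iterated_partial_deriv[OF assms(1)]) (use Cons in simp)
  have "squeeze_factor \<kappa> s (b # bs) = squeeze_factor \<kappa> s bs * squeeze_factor \<kappa> s [b]"
    by (simp add: squeeze_factor_def)
  moreover have "partial_deriv b (foldr partial_deriv bs w) z = foldr partial_deriv (b # bs) w z" for z by simp
  moreover have "b \<in> Basis" using Cons.prems by simp
  ultimately show ?case
    using Cons by (simp add: partial_deriv_cmult[OF smooth_squeeze[OF sm]] partial_deriv_squeeze[OF sm] mult.assoc)
qed (simp add: squeeze_factor_def)

text \<open>The Leibniz remainder: the product-rule terms with a derivative on \<xi>, for a cutoff
  that depends on the first coordinate alone.\<close>

definition cutoff_error :: "(real \<times> real \<Rightarrow> real) \<Rightarrow> (real \<times> real \<Rightarrow> real) \<Rightarrow> real \<times> real \<Rightarrow> (real \<times> real) list \<Rightarrow> real" where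
  "cutoff_error \<xi> U z bs = (if bs = [ex] then partial_deriv ex \<xi> z * U z
     else if bs = [ex, ex] then 2 * partial_deriv ex \<xi> z * partial_deriv ex U z + partial_deriv ex (partial_deriv ex \<xi>) z * U z
     else if bs = [ex, ey] \<or> bs = [ey, ex] then partial_deriv ex \<xi> z * partial_deriv ey U z else 0)"

lemma jet_cutoff:
  assumes x: "smooth \<xi>" and s: "smooth U" and y: "partial_deriv ey \<xi> = (\<lambda>z. 0)" "partial_deriv ey (partial_deriv ex \<xi>) = (\<lambda>z. 0)"
    and bs: "bs \<in> jet_indices"
  shows "foldr partial_deriv bs (\<lambda>z. \<xi> z * U z) z = \<xi> z * foldr partial_deriv bs U z + cutoff_error \<xi> U z bs"
proof -
  have xx: "smooth (partial_deriv ex \<xi>)" and sx: "smooth (partial_deriv ex U)" and sy: "smooth (partial_deriv ey U)"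
    using smooth_partial_deriv[OF x] smooth_partial_deriv[OF s] by (auto simp: Basis_plane)
  have py: "partial_deriv ey (\<lambda>z. \<xi> z * W z) = (\<lambda>z. \<xi> z * partial_deriv ey W z)" if "smooth W" for W
    using partial_deriv_mult[OF x that] y by simp
  have px: "partial_deriv ex (\<lambda>z. \<xi> z * U z) = (\<lambda>z. \<xi> z * partial_deriv ex U z + partial_deriv ex \<xi> z * U z)"
    by (rule partial_deriv_mult[OF x s])
  have pb: "partial_deriv b (\<lambda>z. \<xi> z * partial_deriv ex U z + partial_deriv ex \<xi> z * U z)
      = (\<lambda>z. (\<xi> z * partial_deriv b (partial_deriv ex U) z + partial_deriv b \<xi> z * partial_deriv ex U z)
         + (partial_deriv ex \<xi> z * partial_deriv b U z + partial_deriv b (partial_deriv ex \<xi>) z * U z))" for b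
    unfolding partial_deriv_add[OF smooth_mult[OF x sx] smooth_mult[OF xx s]]
      partial_deriv_mult[OF x sx] partial_deriv_mult[OF xx s] ..
  have pxy: "partial_deriv ex (\<lambda>z. \<xi> z * partial_deriv ey U z) = (\<lambda>z. \<xi> z * partial_deriv ex (partial_deriv ey U) z + partial_deriv ex \<xi> z * partial_deriv ey U z)"
    by (rule partial_deriv_mult[OF x sy])
  have ne: "ex \<noteq> ey" "ey \<noteq> ex" by simp_all
  note f = foldr.simps o_apply id_apply
  consider "bs = []" | "bs = [ex]" | "bs = [ey]" | "bs = [ex, ex]" | "bs = [ex, ey]" | "bs = [ey, ex]" | "bs = [ey, ey]"
    using bs unfolding jet_indices_def by blast
  then show ?thesis
  proof cases
    case 1
    show ?thesis unfolding 1 f by (simp add: cutoff_error_def)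
  next
    case 2
    show ?thesis unfolding 2 f px by (simp add: cutoff_error_def)
  next
    case 3
    show ?thesis unfolding 3 f py[OF s] by (simp add: cutoff_error_def ne)
  next
    case 4
    show ?thesis unfolding 4 f px pb by (simp add: cutoff_error_def)
  next
    case 5
    show ?thesis unfolding 5 f py[OF s] pxy by (simp add: cutoff_error_def ne)
  next
    case 6
    show ?thesis unfolding 6 f px pb y by (simp add: cutoff_error_def ne)
  next
    case 7
    show ?thesis unfolding 7 f py[OF s] py[OF sy] by (simp add: cutoff_error_def ne)
  qed
qed

lemma jet_energy_squares_le:
  assumes "\<And>bs. bs \<in> jet_indices \<Longrightarrow> (j bs)\<^sup>2 \<le> A * (k bs)\<^sup>2 + B * (l bs)\<^sup>2"
  shows "jet_energy 0 1 j \<le> A * jet_energy 0 1 k + B * jet_energy 0 1 l"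
proof -
  have "(j bs)\<^sup>2 \<le> A * (k bs)\<^sup>2 + B * (l bs)\<^sup>2" if "bs \<in> jet_indices" for bs by (rule assms[OF that])
  then have "(j [])\<^sup>2 \<le> A * (k [])\<^sup>2 + B * (l [])\<^sup>2" "(j [ex])\<^sup>2 \<le> A * (k [ex])\<^sup>2 + B * (l [ex])\<^sup>2"
    "(j [ey])\<^sup>2 \<le> A * (k [ey])\<^sup>2 + B * (l [ey])\<^sup>2" "(j [ex,ex])\<^sup>2 \<le> A * (k [ex,ex])\<^sup>2 + B * (l [ex,ex])\<^sup>2"
    "(j [ex,ey])\<^sup>2 \<le> A * (k [ex,ey])\<^sup>2 + B * (l [ex,ey])\<^sup>2" "(j [ey,ex])\<^sup>2 \<le> A * (k [ey,ex])\<^sup>2 + B * (l [ey,ex])\<^sup>2"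
    "(j [ey,ey])\<^sup>2 \<le> A * (k [ey,ey])\<^sup>2 + B * (l [ey,ey])\<^sup>2"
    by (simp_all add: jet_indices_def)
  then show ?thesis unfolding jet_energy_sum_squares distrib_left by linarith
qed

text \<open>As \<open>a\<close> is at most 1, the bound on the second derivative of \<xi> also
  covers the first. The 8 is the squared coefficient 2 of the cross term, doubled when the sum is
  split.\<close>

lemma cutoff_error_le:
  assumes a: "0 < a" "a \<le> 1" and b: "\<bar>partial_deriv ex \<xi> z\<bar> \<le> C / a" "\<bar>partial_deriv ex (partial_deriv ex \<xi>) z\<bar> \<le> C / a\<^sup>2"
  shows "jet_energy 0 1 (cutoff_error \<xi> U z)
    \<le> 8 * (C / a\<^sup>2)\<^sup>2 * ((U z)\<^sup>2 + (partial_deriv ex U z)\<^sup>2 + (partial_deriv ey U z)\<^sup>2)"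
proof -
  define X where "X = partial_deriv ex \<xi> z"
  define XX where "XX = partial_deriv ex (partial_deriv ex \<xi>) z"
  define D where "D = (C / a\<^sup>2)\<^sup>2"
  have C: "0 \<le> C / a" using b(1) abs_ge_zero order_trans by blast
  have "0 \<le> C" using C a(1) by (simp add: zero_le_divide_iff)
  then have "C / a \<le> C / a\<^sup>2"
    using a by (intro divide_left_mono) (auto simp: power2_eq_square mult_left_le)
  moreover have "0 \<le> C / a\<^sup>2" using \<open>0 \<le> C\<close> by simp
  ultimately have "\<bar>X\<bar> \<le> \<bar>C / a\<^sup>2\<bar>" "\<bar>XX\<bar> \<le> \<bar>C / a\<^sup>2\<bar>"
    using b unfolding X_def XX_def by linarith+
  then have sq: "X\<^sup>2 \<le> D" "XX\<^sup>2 \<le> D" unfolding D_def by (simp_all only: abs_le_square_iff)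
  have m: "X\<^sup>2 * t\<^sup>2 \<le> D * t\<^sup>2" "XX\<^sup>2 * t\<^sup>2 \<le> D * t\<^sup>2" for t :: real by (intro mult_right_mono sq; simp)+
  have "(2 * X * partial_deriv ex U z + XX * U z)\<^sup>2 \<le> 2 * (2 * X * partial_deriv ex U z)\<^sup>2 + 2 * (XX * U z)\<^sup>2"
    using square_add_le[of 1 "2 * X * partial_deriv ex U z" "XX * U z"] by simp
  also have "\<dots> \<le> 8 * (D * (partial_deriv ex U z)\<^sup>2) + 2 * (D * (U z)\<^sup>2)"
    using m[of "partial_deriv ex U z"] m[of "U z"] by (simp add: power_mult_distrib)
  finally have 1: "(2 * X * partial_deriv ex U z + XX * U z)\<^sup>2 \<le> 8 * (D * (partial_deriv ex U z)\<^sup>2) + 2 * (D * (U z)\<^sup>2)" .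
  have D0: "0 \<le> D * (U z)\<^sup>2" "0 \<le> D * (partial_deriv ey U z)\<^sup>2" by (simp_all add: D_def)
  have "jet_energy 0 1 (cutoff_error \<xi> U z)
    = (2 * X * partial_deriv ex U z + XX * U z)\<^sup>2 + 2 * (X\<^sup>2 * (partial_deriv ey U z)\<^sup>2) + X\<^sup>2 * (U z)\<^sup>2"
    by (simp add: jet_energy_sum_squares cutoff_error_def X_def XX_def power_mult_distrib)
  also have "\<dots> \<le> 8 * (D * (U z)\<^sup>2) + 8 * (D * (partial_deriv ex U z)\<^sup>2) + 8 * (D * (partial_deriv ey U z)\<^sup>2)"
    using 1 m(1)[of "U z"] m(1)[of "partial_deriv ey U z"] D0 by linarith
  finally show ?thesis by (simp add: D_def[symmetric] algebra_simps)
qed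

text \<open>With \<open>e = (6 + \<kappa>) * s\<close> each one-dimensional factor is within
  \<open>e\<close> of 1, and a product of two within \<open>2 * e + e\<^sup>2\<close>, at most
  \<open>3 * e\<close> as \<open>e\<close> is at most 1.\<close>

lemma squeeze_factor_bounds:
  assumes a: "0 < s" "0 \<le> \<kappa>" "(6 + \<kappa>) * s \<le> 1" and bs: "bs \<in> jet_indices"
  shows "(squeeze_factor \<kappa> s bs - 1)\<^sup>2 \<le> 9 * ((6 + \<kappa>) * s)\<^sup>2" "(squeeze_factor \<kappa> s bs)\<^sup>2 \<le> 16"
proof -
  define e where "e = (6 + \<kappa>) * s"
  have e: "0 \<le> e" "e \<le> 1" using a by (auto simp: e_def)
  have ks: "0 \<le> \<kappa> * s" using a by simp
  have p: "\<bar>6 * s\<bar> \<le> e" "\<bar>- (\<kappa> * s)\<bar> \<le> e" using a ks by (auto simp: e_def distrib_right)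
  have two: "\<bar>(1 + x) * (1 + y) - 1\<bar> \<le> 3 * e" if "\<bar>x\<bar> \<le> e" "\<bar>y\<bar> \<le> e" for x y
  proof -
    have "\<bar>x\<bar> * \<bar>y\<bar> \<le> 1 * e" by (rule mult_mono) (use that e in auto)
    moreover have "(1 + x) * (1 + y) - 1 = x + y + x * y" by (simp add: algebra_simps)
    ultimately show ?thesis using that by (simp add: abs_mult[symmetric])
  qed
  have "\<bar>squeeze_factor \<kappa> s bs - 1\<bar> \<le> 3 * e"
  proof -
    have sf: "squeeze_factor \<kappa> s [ex] = 1 + 6 * s" "squeeze_factor \<kappa> s [ey] = 1 + - (\<kappa> * s)" "squeeze_factor \<kappa> s [] = 1"
      "squeeze_factor \<kappa> s [b, c] = squeeze_factor \<kappa> s [b] * squeeze_factor \<kappa> s [c]" for b c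
      by (simp_all add: squeeze_factor_def)
    consider "bs = []" | "bs = [ex]" | "bs = [ey]" | "bs = [ex, ex]" | "bs = [ex, ey]" | "bs = [ey, ex]" | "bs = [ey, ey]"
      using bs unfolding jet_indices_def by blast
    then show ?thesis
    proof cases
      case 2
      show ?thesis unfolding 2 sf using p(1) e by linarith
    next
      case 3
      show ?thesis unfolding 3 sf using p(2) e by linarith
    next
      case 4
      show ?thesis unfolding 4 sf by (rule two[OF p(1) p(1)])
    next
      case 5
      show ?thesis unfolding 5 sf by (rule two[OF p(1) p(2)])
    next
      case 6
      show ?thesis unfolding 6 sf by (rule two[OF p(2) p(1)])
    next
      case 7
      show ?thesis unfolding 7 sf by (rule two[OF p(2) p(2)])
    qed (use e in \<open>simp add: sf\<close>)
  qed
  then have b: "\<bar>squeeze_factor \<kappa> s bs - 1\<bar> \<le> \<bar>3 * e\<bar>" "\<bar>squeeze_factor \<kappa> s bs\<bar> \<le> \<bar>4\<bar>" using e by auto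
  from b(1)[THEN abs_le_square_iff[THEN iffD1]] show "(squeeze_factor \<kappa> s bs - 1)\<^sup>2 \<le> 9 * ((6 + \<kappa>) * s)\<^sup>2"
    by (simp add: e_def power_mult_distrib)
  from b(2)[THEN abs_le_square_iff[THEN iffD1]] show "(squeeze_factor \<kappa> s bs)\<^sup>2 \<le> 16" by simp
qed

text \<open>The jet is written as \<open>x * j + E\<close>. The remainder \<open>E\<close> collects
  the deviation of the scaling factors from 1, whose square is O(\<open>a\<^sup>2\<close>), and the
  cutoff error. Young's inequality multiplies both by at most \<open>2 / a\<close>, which leaves
  O(\<open>a\<close>) for the former.\<close>

lemma squeezed_jet_energy_le:
  assumes s: "-1 < \<sigma>" "\<sigma> < 1" "0 \<le> \<tau>" and a: "0 < a" "a \<le> 1" "0 \<le> \<kappa>" "(6 + \<kappa>) * a \<le> 1"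
    and x: "0 \<le> x" "x \<le> 1"
  shows "jet_energy \<sigma> \<tau> (\<lambda>bs. squeeze_factor \<kappa> a bs * (x * j bs + y bs))
    \<le> (1 + a) * jet_energy \<sigma> \<tau> j + 36 * (3 + \<tau>) * (6 + \<kappa>)\<^sup>2 * a * jet_energy 0 1 j + 64 * (3 + \<tau>) / a * jet_energy 0 1 y"
proof -
  let ?f = "squeeze_factor \<kappa> a"
  define E where "E bs = (?f bs - 1) * (x * j bs) + ?f bs * y bs" for bs
  have x2: "x\<^sup>2 \<le> 1" using x by (simp add: power_le_one)
  have N: "jet_energy 0 1 E \<le> 18 * ((6 + \<kappa>) * a)\<^sup>2 * jet_energy 0 1 j + 32 * jet_energy 0 1 y"
  proof (rule jet_energy_squares_le)
    fix bs assume bs: "bs \<in> jet_indices"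
    note fb = squeeze_factor_bounds[OF a(1,3,4) bs]
    have "(E bs)\<^sup>2 \<le> 2 * ((?f bs - 1) * (x * j bs))\<^sup>2 + 2 * (?f bs * y bs)\<^sup>2"
      using square_add_le[of 1 "(?f bs - 1) * (x * j bs)" "?f bs * y bs"] by (simp add: E_def)
    moreover have "((?f bs - 1) * (x * j bs))\<^sup>2 \<le> 9 * ((6 + \<kappa>) * a)\<^sup>2 * (j bs)\<^sup>2"
    proof -
      have "x\<^sup>2 * (j bs)\<^sup>2 \<le> 1 * (j bs)\<^sup>2" by (rule mult_right_mono[OF x2]) simp
      then have "(?f bs - 1)\<^sup>2 * (x\<^sup>2 * (j bs)\<^sup>2) \<le> 9 * ((6 + \<kappa>) * a)\<^sup>2 * (j bs)\<^sup>2"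
        by (intro mult_mono fb) auto
      then show ?thesis by (simp add: power_mult_distrib)
    qed
    moreover have "(?f bs * y bs)\<^sup>2 \<le> 16 * (y bs)\<^sup>2"
      unfolding power_mult_distrib by (rule mult_right_mono[OF fb(2)]) simp
    ultimately show "(E bs)\<^sup>2 \<le> 18 * ((6 + \<kappa>) * a)\<^sup>2 * (j bs)\<^sup>2 + 32 * (y bs)\<^sup>2" by linarith
  qed
  have nn: "0 \<le> jet_energy 0 1 k" for k by (simp add: jet_energy_sum_squares)
  have "(\<lambda>bs. ?f bs * (x * j bs + y bs)) = (\<lambda>bs. x * j bs + E bs)"
    by (simp add: E_def fun_eq_iff algebra_simps)
  then have A: "jet_energy \<sigma> \<tau> (\<lambda>bs. ?f bs * (x * j bs + y bs))
      \<le> (1 + a) * jet_energy \<sigma> \<tau> (\<lambda>bs. x * j bs) + (1 + 1 / a) * jet_energy \<sigma> \<tau> E"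
    using jet_energy_add_le[OF s a(1), of "\<lambda>bs. x * j bs" E] by simp
  have B: "(1 + a) * jet_energy \<sigma> \<tau> (\<lambda>bs. x * j bs) \<le> (1 + a) * jet_energy \<sigma> \<tau> j"
  proof (rule mult_left_mono)
    show "jet_energy \<sigma> \<tau> (\<lambda>bs. x * j bs) \<le> jet_energy \<sigma> \<tau> j"
      unfolding jet_energy_scale using mult_right_mono[OF x2 jet_energy_nonneg[OF s, of j]] by simp
  qed (use a in simp)
  have C: "(1 + 1 / a) * jet_energy \<sigma> \<tau> E
      \<le> 2 / a * ((3 + \<tau>) * (18 * ((6 + \<kappa>) * a)\<^sup>2 * jet_energy 0 1 j + 32 * jet_energy 0 1 y))"
  proof (rule mult_mono)
    show "1 + 1 / a \<le> 2 / a" using a by (simp add: field_simps)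
    show "jet_energy \<sigma> \<tau> E \<le> (3 + \<tau>) * (18 * ((6 + \<kappa>) * a)\<^sup>2 * jet_energy 0 1 j + 32 * jet_energy 0 1 y)"
      using jet_energy_le_sum_squares[OF s, of E] mult_left_mono[OF N, of "3 + \<tau>"] s(3) by linarith
  qed (use a jet_energy_nonneg[OF s] in auto)
  have alg: "2 / a * (t * (18 * (k * a)\<^sup>2 * n + 32 * m)) = 36 * t * k\<^sup>2 * a * n + 64 * t / a * m" for t k n m
    using a(1) by (simp add: field_simps power2_eq_square)
  show ?thesis using A B C[unfolded alg] by linarith
qed

lemma jet_energy_cong: "(\<And>bs. bs \<in> jet_indices \<Longrightarrow> j bs = k bs) \<Longrightarrow> jet_energy \<sigma> \<tau> j = jet_energy \<sigma> \<tau> k"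
  by (simp add: jet_energy_def jet_indices_def)

lemma continuous_on_jet_energy:
  assumes "smooth U"
  shows "continuous_on A (\<lambda>z. jet_energy \<sigma> \<tau> (\<lambda>bs. foldr partial_deriv bs U z))"
proof -
  have "continuous_on A (foldr partial_deriv bs U)" if "bs \<in> jet_indices" for bs
    using smooth_iterated_partial_deriv[OF assms] that jet_indices_iff smooth_continuous_on by blast
  then have "continuous_on A (foldr partial_deriv [] U)" "continuous_on A (foldr partial_deriv [ex] U)"
    "continuous_on A (foldr partial_deriv [ey] U)" "continuous_on A (foldr partial_deriv [ex, ex] U)"
    "continuous_on A (foldr partial_deriv [ex, ey] U)" "continuous_on A (foldr partial_deriv [ey, ex] U)"
    "continuous_on A (foldr partial_deriv [ey, ey] U)"
    unfolding jet_indices_def by blast+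
  then show ?thesis unfolding jet_energy_def by (intro continuous_intros)
qed

section \<open>Energy and mean-square distance over the channel\<close>

lemma integral_indicator_mono:
  fixes f :: "'a::euclidean_space \<Rightarrow> real"
  assumes "compact K" "compact P" "K \<subseteq> P" "continuous_on UNIV f" "\<And>z. 0 \<le> f z"
  shows "(LINT z|lborel. indicator K z * f z) \<le> (LINT z|lborel. indicator P z * f z)"
  by (rule integral_mono[OF integrable_indicator_compact_mult[OF assms(1,4)] integrable_indicator_compact_mult[OF assms(2,4)]])
    (use assms(3,5) in \<open>auto simp: indicator_def\<close>)

lemma ends_jet_estimate:
  fixes U :: "real \<times> real \<Rightarrow> real"
  assumes s: "smooth U" and Y: "0 \<le> Y" "Y \<le> l" "0 < l" and K: "compact K"
    and strips: "K \<subseteq> {p..q} \<times> {0..Y} \<union> {p'..q'} \<times> {0..Y}"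
    and P: "compact P" "{p..q} \<times> {0..l} \<subseteq> P" "{p'..q'} \<times> {0..l} \<subseteq> P"
    and M: "(LINT z|lborel. indicator P z * jet_energy 0 1 (\<lambda>bs. foldr partial_deriv bs U z)) \<le> M"
  shows "(LINT z|lborel. indicator K z * ((U z)\<^sup>2 + (partial_deriv ex U z)\<^sup>2 + (partial_deriv ey U z)\<^sup>2))
    \<le> 4 * Y * (1 / l + 1) * M"
proof -
  let ?f = "\<lambda>z. (U z)\<^sup>2 + (partial_deriv ex U z)\<^sup>2 + (partial_deriv ey U z)\<^sup>2"
  let ?N = "\<lambda>z. jet_energy 0 1 (\<lambda>bs. foldr partial_deriv bs U z)"
  have sx: "smooth (partial_deriv ex U)" and sy: "smooth (partial_deriv ey U)"
    using smooth_partial_deriv[OF s] by (auto simp: Basis_plane)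
  have c: "continuous_on UNIV ?f" by (intro continuous_intros smooth_continuous_on s sx sy)
  have f0: "0 \<le> ?f z" for z by simp
  have N0: "0 \<le> ?N z" for z by (simp add: jet_energy_sum_squares)
  have w: "0 \<le> 2 * Y * (1 / l + 1)" using Y by simp
  have one: "(LINT z|lborel. indicator ({p..q} \<times> {0..Y}) z * ?f z) \<le> 2 * Y * (1 / l + 1) * M"
    if "{p..q} \<times> {0..l} \<subseteq> P" for p q
  proof -
    have "(LINT z|lborel. indicator ({p..q} \<times> {0..l}) z * ?N z) \<le> (LINT z|lborel. indicator P z * ?N z)"
      by (rule integral_indicator_mono[OF _ P(1) that continuous_on_jet_energy[OF s] N0]) (intro compact_Times compact_Icc)
    then have "2 * Y * (1 / l + 1) * (LINT z|lborel. indicator ({p..q} \<times> {0..l}) z * ?N z) \<le> 2 * Y * (1 / l + 1) * M"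
      using M w by (intro mult_left_mono) auto
    with strip_jet_estimate[OF s Y, of p q] show ?thesis by linarith
  qed
  have i: "integrable lborel (\<lambda>z. indicator ({p..q} \<times> {0..Y}) z * ?f z)" for p q
    by (rule integrable_indicator_compact_mult[OF _ c]) (intro compact_Times compact_Icc)
  have "(LINT z|lborel. indicator K z * ?f z)
      \<le> (LINT z|lborel. indicator ({p..q} \<times> {0..Y}) z * ?f z + indicator ({p'..q'} \<times> {0..Y}) z * ?f z)"
  proof (rule integral_mono)
    show "integrable lborel (\<lambda>z. indicator K z * ?f z)" by (rule integrable_indicator_compact_mult[OF K c])
    show "integrable lborel (\<lambda>z. indicator ({p..q} \<times> {0..Y}) z * ?f z + indicator ({p'..q'} \<times> {0..Y}) z * ?f z)"
      by (rule Bochner_Integration.integrable_add[OF i i])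
    fix z
    have "(indicator K z :: real) \<le> indicator ({p..q} \<times> {0..Y}) z + indicator ({p'..q'} \<times> {0..Y}) z"
      using strips by (auto simp: indicator_def)
    from mult_right_mono[OF this f0[of z]]
    show "indicator K z * ?f z \<le> indicator ({p..q} \<times> {0..Y}) z * ?f z + indicator ({p'..q'} \<times> {0..Y}) z * ?f z"
      by (simp only: distrib_right)
  qed
  also have "\<dots> = (LINT z|lborel. indicator ({p..q} \<times> {0..Y}) z * ?f z) + (LINT z|lborel. indicator ({p'..q'} \<times> {0..Y}) z * ?f z)"
    by (rule Bochner_Integration.integral_add[OF i i])
  also have "\<dots> \<le> 2 * Y * (1 / l + 1) * M + 2 * Y * (1 / l + 1) * M"
    by (rule add_mono[OF one[OF P(2)] one[OF P(3)]])
  also have "2 * Y * w * M + 2 * Y * w * M = 4 * Y * w * M" for w by simp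
  finally show ?thesis .
qed

text \<open>The pointwise bound is phrased at the image point, so a single change of variables
  handles the whole estimate. The cutoff error is charged only to the part \<open>S\<close> of the
  image inside the ends, where the strip bound is available.\<close>

lemma squeezed_energy_le:
  fixes U \<xi> :: "real \<times> real \<Rightarrow> real"
  assumes R: "open R" "R \<subseteq> ball 0 r0" and s: "smooth U"
    and q: "-1 < \<sigma>" "\<sigma> < 1" "0 \<le> \<tau>" and a: "0 < a" "a \<le> 1" "0 \<le> \<kappa>" "(6 + \<kappa>) * a \<le> 1" "\<kappa> * a \<le> 1 / 2"
    and x: "smooth \<xi>" "\<And>z. 0 \<le> \<xi> z \<and> \<xi> z \<le> 1" "partial_deriv ey \<xi> = (\<lambda>z. 0)" "partial_deriv ey (partial_deriv ex \<xi>) = (\<lambda>z. 0)"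
      "\<And>z. \<bar>partial_deriv ex \<xi> z\<bar> \<le> C / a" "\<And>z. \<bar>partial_deriv ex (partial_deriv ex \<xi>) z\<bar> \<le> C / a\<^sup>2"
      "\<And>z. -a < fst z \<Longrightarrow> fst z < 1 + a \<Longrightarrow> partial_deriv ex \<xi> z = 0 \<and> partial_deriv ex (partial_deriv ex \<xi>) z = 0"
    and K: "compact K" "\<And>z. z \<in> R \<Longrightarrow> squeeze \<kappa> c a z \<in> K"
    and strips: "K \<inter> {z. fst z \<le> -a \<or> 1 + a \<le> fst z} \<subseteq> {-3*a..-a} \<times> {0..Y} \<union> {1+a..1+3*a} \<times> {0..Y}"
    and Y: "0 \<le> Y" "Y \<le> l" "0 < l"
    and P: "compact P" "K \<subseteq> P" "{-3*a..-a} \<times> {0..l} \<subseteq> P" "{1+a..1+3*a} \<times> {0..l} \<subseteq> P"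
    and E: "(LINT z|lborel. indicator P z * jet_energy \<sigma> \<tau> (\<lambda>bs. foldr partial_deriv bs U z)) \<le> E"
    and M: "(LINT z|lborel. indicator P z * jet_energy 0 1 (\<lambda>bs. foldr partial_deriv bs U z)) \<le> M"
  shows "(H2_bracket \<sigma> \<tau> R (\<lambda>z. \<xi> (squeeze \<kappa> c a z) * U (squeeze \<kappa> c a z)))\<^sup>2
    \<le> (1 + 2 * (\<kappa> * a)) * ((1 + a) * E + 36 * (3 + \<tau>) * (6 + \<kappa>)\<^sup>2 * a * M
        + 64 * (3 + \<tau>) / a * (8 * (C / a\<^sup>2)\<^sup>2) * (4 * Y * (1 / l + 1) * M))"
proof -
  let ?T = "squeeze \<kappa> c a"
  define v where "v z = \<xi> (?T z) * U (?T z)" for z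
  define w where "w z = \<xi> z * U z" for z
  define S where "S = {z::real \<times> real. fst z \<le> -a \<or> 1 + a \<le> fst z}"
  define Q where "Q z = jet_energy \<sigma> \<tau> (\<lambda>bs. foldr partial_deriv bs U z)" for z
  define N where "N z = jet_energy 0 1 (\<lambda>bs. foldr partial_deriv bs U z)" for z
  define M0 where "M0 z = (U z)\<^sup>2 + (partial_deriv ex U z)\<^sup>2 + (partial_deriv ey U z)\<^sup>2" for z
  define c1 where "c1 = 36 * (3 + \<tau>) * (6 + \<kappa>)\<^sup>2 * a"
  define c2 where "c2 = 64 * (3 + \<tau>) / a * (8 * (C / a\<^sup>2)\<^sup>2)"
  have c12: "0 \<le> c1" "0 \<le> c2" using q a by (simp_all add: c1_def c2_def)
  have sw: "smooth w" unfolding w_def by (rule smooth_mult[OF x(1) s])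
  have v_eq: "v = (\<lambda>z. w (?T z))" by (simp add: v_def w_def fun_eq_iff)
  have sv: "smooth v" unfolding v_eq by (rule smooth_squeeze[OF sw])
  have nn: "0 \<le> Q z" "0 \<le> N z" "0 \<le> M0 z" for z
    by (simp_all add: Q_def N_def M0_def jet_energy_nonneg[OF q] jet_energy_sum_squares)
  have sx: "smooth (partial_deriv ex U)" and sy: "smooth (partial_deriv ey U)"
    using smooth_partial_deriv[OF s] by (auto simp: Basis_plane)
  have cQ: "continuous_on UNIV Q" and cN: "continuous_on UNIV N" and cM: "continuous_on UNIV M0"
    unfolding Q_def N_def M0_def
    by (intro continuous_on_jet_energy[OF s] continuous_intros smooth_continuous_on s sx sy)+
  have "closed S"
    unfolding S_def by (intro closed_Collect_disj closed_Collect_le continuous_intros)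
  then have KS: "compact (K \<inter> S)" using K(1) by (rule compact_Int_closed[rotated])
  have iQ: "integrable lborel (\<lambda>z. indicator K z * Q z)" by (rule integrable_indicator_compact_mult[OF K(1) cQ])
  have iN: "integrable lborel (\<lambda>z. indicator K z * N z)" by (rule integrable_indicator_compact_mult[OF K(1) cN])
  have iM: "integrable lborel (\<lambda>z. indicator (K \<inter> S) z * M0 z)" by (rule integrable_indicator_compact_mult[OF KS cM])
  \<comment> \<open>The indicators confine the majorant to \<open>K\<close>, a subset of the set
    \<open>P\<close> on which the energies of \<open>U\<close> are bounded; elsewhere
    \<open>U\<close> is not controlled.\<close>
  define \<Phi> where "\<Phi> z = (1 + a) * (indicator K z * Q z) + c1 * (indicator K z * N z) + c2 * (indicator (K \<inter> S) z * M0 z)" for z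
  have i\<Phi>: "integrable lborel \<Phi>" unfolding \<Phi>_def using iQ iN iM by simp
  have \<Phi>0: "0 \<le> \<Phi> z" for z
    unfolding \<Phi>_def using nn[of z] c12 a by (intro add_nonneg_nonneg mult_nonneg_nonneg) auto
  have pw: "jet_energy \<sigma> \<tau> (\<lambda>bs. foldr partial_deriv bs v z) \<le> \<Phi> (?T z)" if z: "z \<in> R" for z
  proof -
    have "jet_energy \<sigma> \<tau> (\<lambda>bs. foldr partial_deriv bs v z)
      = jet_energy \<sigma> \<tau> (\<lambda>bs. squeeze_factor \<kappa> a bs * (\<xi> (?T z) * foldr partial_deriv bs U (?T z) + cutoff_error \<xi> U (?T z) bs))"
    proof (rule jet_energy_cong)
      fix bs assume bs: "bs \<in> jet_indices"
      then have "set bs \<subseteq> Basis" using jet_indices_iff by blast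
      from fun_cong[OF jet_squeeze[OF sw this], of \<kappa> c a z] jet_cutoff[OF x(1) s x(3,4) bs, of "?T z"]
      show "foldr partial_deriv bs v z = squeeze_factor \<kappa> a bs * (\<xi> (?T z) * foldr partial_deriv bs U (?T z) + cutoff_error \<xi> U (?T z) bs)"
        by (simp add: v_eq w_def[abs_def])
    qed
    also have "\<dots> \<le> (1 + a) * Q (?T z) + c1 * N (?T z) + 64 * (3 + \<tau>) / a * jet_energy 0 1 (cutoff_error \<xi> U (?T z))"
      unfolding Q_def N_def c1_def by (rule squeezed_jet_energy_le[OF q a(1-4)]) (use x(2) in auto)
    also have "64 * (3 + \<tau>) / a * jet_energy 0 1 (cutoff_error \<xi> U (?T z)) \<le> c2 * (indicator S (?T z) * M0 (?T z))"
    proof (cases "?T z \<in> S")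
      case True
      have "jet_energy 0 1 (cutoff_error \<xi> U (?T z)) \<le> 8 * (C / a\<^sup>2)\<^sup>2 * M0 (?T z)"
        unfolding M0_def by (rule cutoff_error_le[OF a(1,2) x(5,6)])
      then have "64 * (3 + \<tau>) / a * jet_energy 0 1 (cutoff_error \<xi> U (?T z)) \<le> 64 * (3 + \<tau>) / a * (8 * (C / a\<^sup>2)\<^sup>2 * M0 (?T z))"
        using q a by (intro mult_left_mono) auto
      then show ?thesis using True by (simp add: c2_def)
    next
      case False
      then have "partial_deriv ex \<xi> (?T z) = 0 \<and> partial_deriv ex (partial_deriv ex \<xi>) (?T z) = 0"
        by (intro x(7)) (auto simp: S_def)
      then show ?thesis using False by (simp add: jet_energy_sum_squares cutoff_error_def)
    qed
    also have "(1 + a) * Q (?T z) + c1 * N (?T z) + c2 * (indicator S (?T z) * M0 (?T z)) = \<Phi> (?T z)"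
      using K(2)[OF z] by (simp add: \<Phi>_def indicator_def)
    finally show ?thesis by simp
  qed
  note br = H2_bracket_square_smooth[OF R sv q]
  have "(H2_bracket \<sigma> \<tau> R v)\<^sup>2 \<le> (LINT z|lborel. \<Phi> (?T z))"
    unfolding br(1)
  proof (rule integral_mono[OF br(2)])
    show "integrable lborel (\<lambda>z. \<Phi> (?T z))" by (rule squeeze_lebesgue(1)[OF _ _ i\<Phi>]) (use a in auto)
    show "indicator R z * jet_energy \<sigma> \<tau> (\<lambda>bs. foldr partial_deriv bs v z) \<le> \<Phi> (?T z)" for z
      using pw[of z] \<Phi>0[of "?T z"] by (cases "z \<in> R") auto
  qed
  also have "\<dots> \<le> (1 + 2 * (\<kappa> * a)) * (LINT z|lborel. \<Phi> z)"
    by (rule squeeze_integral_le[OF _ a(3,5) i\<Phi> \<Phi>0]) (use a in simp)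
  also have "\<dots> \<le> (1 + 2 * (\<kappa> * a)) * ((1 + a) * E + c1 * M + c2 * (4 * Y * (1 / l + 1) * M))"
  proof (rule mult_left_mono)
    have "(LINT z|lborel. \<Phi> z) = (1 + a) * (LINT z|lborel. indicator K z * Q z) + c1 * (LINT z|lborel. indicator K z * N z)
        + c2 * (LINT z|lborel. indicator (K \<inter> S) z * M0 z)"
      unfolding \<Phi>_def using iQ iN iM by simp
    also have "\<dots> \<le> (1 + a) * E + c1 * M + c2 * (4 * Y * (1 / l + 1) * M)"
    proof (intro add_mono mult_left_mono)
      show "(LINT z|lborel. indicator K z * Q z) \<le> E"
        using integral_indicator_mono[OF K(1) P(1,2) cQ nn(1)] E unfolding Q_def by linarith
      show "(LINT z|lborel. indicator K z * N z) \<le> M"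
        using integral_indicator_mono[OF K(1) P(1,2) cN nn(2)] M unfolding N_def by linarith
      show "(LINT z|lborel. indicator (K \<inter> S) z * M0 z) \<le> 4 * Y * (1 / l + 1) * M"
        unfolding M0_def by (rule ends_jet_estimate[OF s Y KS _ P(1,3,4) M]) (use strips in \<open>simp add: S_def\<close>)
    qed (use a c12 in auto)
    finally show "(LINT z|lborel. \<Phi> z) \<le> (1 + a) * E + c1 * M + c2 * (4 * Y * (1 / l + 1) * M)" .
  qed (use a in simp)
  finally show ?thesis by (simp only: v_def[abs_def] c1_def c2_def)
qed

text \<open>On \<open>K'\<close> the difference splits into the mollification error, the
  displacement of \<open>U\<close> along the segments, and the part removed by the cutoff. Segments
  starting near the boundary of the channel may leave the region where \<open>U\<close> is
  controlled; so off \<open>K'\<close> a crude bound by \<open>u0\<close> and its squeezed copy is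
  used, small by the choice of \<open>K'\<close>.\<close>

lemma squeezed_L2_close:
  fixes U \<xi> u0 :: "real \<times> real \<Rightarrow> real"
  assumes R: "open R" and s: "smooth U" and a: "0 < a" "a \<le> 1" "0 \<le> \<kappa>" "\<kappa> * a \<le> 1 / 2"
    and u0: "u0 \<in> borel_measurable borel" "integrable lborel (\<lambda>z. (u0 z)\<^sup>2)"
    and close: "integrable lborel (\<lambda>z. (u0 z - U z)\<^sup>2)" "(LINT z|lborel. (u0 z - U z)\<^sup>2) \<le> a"
    and x: "smooth \<xi>" "\<And>z. 0 \<le> \<xi> z \<and> \<xi> z \<le> 1" "\<And>z. -a < fst z \<Longrightarrow> fst z < 1 + a \<Longrightarrow> \<xi> z = 1"
    and K: "compact K" "\<And>z. z \<in> R \<Longrightarrow> squeeze \<kappa> c a z \<in> K"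
    and strips: "K \<inter> {z. fst z \<le> -a \<or> 1 + a \<le> fst z} \<subseteq> {-3*a..-a} \<times> {0..Y} \<union> {1+a..1+3*a} \<times> {0..Y}"
    and Y: "0 \<le> Y" "Y \<le> l" "0 < l"
    and P: "compact P" "{-3*a..-a} \<times> {0..l} \<subseteq> P" "{1+a..1+3*a} \<times> {0..l} \<subseteq> P"
    and M: "(LINT z|lborel. indicator P z * jet_energy 0 1 (\<lambda>bs. foldr partial_deriv bs U z)) \<le> M"
    and K': "compact K'" "K' \<subseteq> R" "\<And>z t. z \<in> K' \<Longrightarrow> 0 \<le> t \<Longrightarrow> t \<le> 1 \<Longrightarrow> squeeze \<kappa> c (t * a) z \<in> P"
      "\<And>z. z \<in> K' \<Longrightarrow> 0 \<le> fst z \<and> fst z \<le> 1 \<and> \<bar>c - snd z\<bar> \<le> 1"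
      "(LINT z|lborel. indicator (R - K') z * ((u0 z)\<^sup>2 + (u0 (squeeze \<kappa> c a z))\<^sup>2)) \<le> a"
  shows "(LINT z|lborel. indicator R z * (u0 z - \<xi> (squeeze \<kappa> c a z) * U (squeeze \<kappa> c a z))\<^sup>2)
    \<le> 15 * a + 6 * (3 + \<kappa>)\<^sup>2 * a\<^sup>2 * M + 24 * Y * (1 / l + 1) * M"
proof -
  let ?T = "squeeze \<kappa> c a"
  define S where "S = {z::real \<times> real. fst z \<le> -a \<or> 1 + a \<le> fst z}"
  define f1 where "f1 z = (u0 z - U z)\<^sup>2" for z
  define f2 where "f2 z = indicator K' z * (U (?T z) - U z)\<^sup>2" for z
  define f3 where "f3 z = indicator (K \<inter> S) z * (U z)\<^sup>2" for z
  define f4 where "f4 z = indicator (R - K') z * ((u0 z)\<^sup>2 + (u0 (?T z))\<^sup>2)" for z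
  have nn: "0 \<le> f1 z" "0 \<le> f2 z" "0 \<le> f3 z" "0 \<le> f4 z" for z by (simp_all add: f1_def f2_def f3_def f4_def)
  have pos: "0 < 1 + 6 * a" "0 < 1 - \<kappa> * a" using a by auto
  have two: "1 + 2 * (\<kappa> * a) \<le> 2" using a by simp
  have [measurable]: "u0 \<in> borel_measurable borel" "U \<in> borel_measurable borel" "\<xi> \<in> borel_measurable borel"
    using u0(1) borel_measurable_smooth[OF s] borel_measurable_smooth[OF x(1)] by auto
  have [measurable]: "R \<in> sets borel" "K' \<in> sets borel" using R K'(1) by (auto simp: borel_compact)
  have Tc: "continuous_on UNIV ?T" unfolding squeeze_def by (intro continuous_intros)
  then have [measurable]: "?T \<in> borel_measurable borel" by (rule borel_measurable_continuous_onI)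
  have "closed S"
    unfolding S_def by (intro closed_Collect_disj closed_Collect_le continuous_intros)
  then have KS: "compact (K \<inter> S)" using K(1) by (rule compact_Int_closed[rotated])
  have cU2: "continuous_on UNIV (\<lambda>z. (U z)\<^sup>2)" by (intro continuous_intros smooth_continuous_on s)
  have i1: "integrable lborel f1" unfolding f1_def by (rule close(1))
  have cUT: "continuous_on UNIV (\<lambda>z. (U (?T z) - U z)\<^sup>2)"
    using continuous_on_power[OF continuous_on_diff[OF continuous_on_compose2[OF smooth_continuous_on[OF s] Tc subset_UNIV] smooth_continuous_on[OF s]]] .
  have i2: "integrable lborel f2" unfolding f2_def by (rule integrable_indicator_compact_mult[OF K'(1) cUT])
  have i3: "integrable lborel f3" unfolding f3_def by (rule integrable_indicator_compact_mult[OF KS cU2])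
  have iu: "integrable lborel (\<lambda>z. (u0 z)\<^sup>2 + (u0 (?T z))\<^sup>2)"
    using u0(2) squeeze_lebesgue(1)[OF pos u0(2)] by simp
  have i4: "integrable lborel f4" unfolding f4_def
    by (rule Bochner_Integration.integrable_bound[OF iu]) (auto simp: indicator_def)
  have i1T: "integrable lborel (\<lambda>z. f1 (?T z))" by (rule squeeze_lebesgue(1)[OF pos i1])
  have i3T: "integrable lborel (\<lambda>z. f3 (?T z))" by (rule squeeze_lebesgue(1)[OF pos i3])
  \<comment> \<open>The weight 3 comes from splitting into three squares on \<open>K'\<close>, the
    weight 4 from two successive splittings into two off \<open>K'\<close>.\<close>
  define F where "F z = 3 * f1 z + 3 * f2 z + 3 * f3 (?T z) + 4 * f4 z + 4 * f1 (?T z)" for z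
  have iF: "integrable lborel F" unfolding F_def using i1 i2 i4 i1T i3T by simp
  have pw: "indicator R z * (u0 z - \<xi> (?T z) * U (?T z))\<^sup>2 \<le> F z" for z
  proof (cases "z \<in> R")
    case zR: True
    have three: "(p + q + r)\<^sup>2 \<le> 3 * p\<^sup>2 + 3 * q\<^sup>2 + 3 * r\<^sup>2" for p q r :: real
      using zero_le_power2[of "p - q"] zero_le_power2[of "p - r"] zero_le_power2[of "q - r"]
      by (simp add: power2_eq_square algebra_simps)
    have dbl: "(p - q)\<^sup>2 \<le> 2 * p\<^sup>2 + 2 * q\<^sup>2" for p q :: real
      using zero_le_power2[of "p + q"] by (simp add: power2_eq_square algebra_simps)
    note n = nn(1)[of z] nn(2)[of z] nn(3)[of "?T z"] nn(4)[of z] nn(1)[of "?T z"]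
    show ?thesis
    proof (cases "z \<in> K'")
      case True
      have "((1 - \<xi> (?T z)) * U (?T z))\<^sup>2 \<le> f3 (?T z)"
      proof (cases "?T z \<in> S")
        case TS: True
        have "(1 - \<xi> (?T z))\<^sup>2 \<le> 1" using x(2)[of "?T z"] by (simp add: power_le_one)
        then have "(1 - \<xi> (?T z))\<^sup>2 * (U (?T z))\<^sup>2 \<le> 1 * (U (?T z))\<^sup>2" by (rule mult_right_mono) simp
        then show ?thesis using TS K(2)[OF zR] by (simp add: f3_def power_mult_distrib)
      next
        case False
        then have "\<xi> (?T z) = 1" by (intro x(3)) (auto simp: S_def)
        then show ?thesis using nn(3) by simp
      qed
      moreover have "(u0 z - \<xi> (?T z) * U (?T z))\<^sup>2 \<le> 3 * f1 z + 3 * f2 z + 3 * ((1 - \<xi> (?T z)) * U (?T z))\<^sup>2"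
        using three[of "u0 z - U z" "U z - U (?T z)" "(1 - \<xi> (?T z)) * U (?T z)"] True
        by (simp add: f1_def f2_def algebra_simps power2_commute)
      ultimately show ?thesis using zR n unfolding F_def by simp
    next
      case False
      have "(u0 z - \<xi> (?T z) * U (?T z))\<^sup>2 \<le> 2 * (u0 z)\<^sup>2 + 2 * (\<xi> (?T z) * U (?T z))\<^sup>2" by (rule dbl)
      moreover have "(\<xi> (?T z) * U (?T z))\<^sup>2 \<le> (U (?T z))\<^sup>2"
      proof -
        have "(\<xi> (?T z))\<^sup>2 \<le> 1" using x(2)[of "?T z"] by (simp add: power_le_one)
        then have "(\<xi> (?T z))\<^sup>2 * (U (?T z))\<^sup>2 \<le> 1 * (U (?T z))\<^sup>2" by (rule mult_right_mono) simp
        then show ?thesis by (simp add: power_mult_distrib)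
      qed
      moreover have "(U (?T z))\<^sup>2 \<le> 2 * (u0 (?T z))\<^sup>2 + 2 * f1 (?T z)"
        using dbl[of "u0 (?T z)" "u0 (?T z) - U (?T z)"] by (simp add: f1_def)
      moreover have "f4 z = (u0 z)\<^sup>2 + (u0 (?T z))\<^sup>2" using zR False by (simp add: f4_def)
      moreover have "0 \<le> (u0 z)\<^sup>2" by simp
      ultimately have "(u0 z - \<xi> (?T z) * U (?T z))\<^sup>2 \<le> 4 * f4 z + 4 * f1 (?T z)" by linarith
      then show ?thesis using zR n unfolding F_def by simp
    qed
  next
    case False
    have "0 \<le> F z" unfolding F_def using nn(1)[of z] nn(2)[of z] nn(3)[of "?T z"] nn(4)[of z] nn(1)[of "?T z"] by linarith
    then show ?thesis using False by simp
  qed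
  have iL: "integrable lborel (\<lambda>z. indicator R z * (u0 z - \<xi> (?T z) * U (?T z))\<^sup>2)"
  proof (rule Bochner_Integration.integrable_bound[OF iF])
    show "AE z in lborel. norm (indicator R z * (u0 z - \<xi> (?T z) * U (?T z))\<^sup>2) \<le> norm (F z)"
    proof (intro AE_I2)
      fix z
      have "norm (indicator R z * (u0 z - \<xi> (?T z) * U (?T z))\<^sup>2) = indicator R z * (u0 z - \<xi> (?T z) * U (?T z))\<^sup>2"
        by simp
      with pw[of z] show "norm (indicator R z * (u0 z - \<xi> (?T z) * U (?T z))\<^sup>2) \<le> norm (F z)" by simp
    qed
  qed measurable
  have "(LINT z|lborel. indicator R z * (u0 z - \<xi> (?T z) * U (?T z))\<^sup>2) \<le> (LINT z|lborel. F z)"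
    by (rule integral_mono[OF iL iF pw])
  also have "\<dots> = 3 * (LINT z|lborel. f1 z) + 3 * (LINT z|lborel. f2 z) + 3 * (LINT z|lborel. f3 (?T z))
      + 4 * (LINT z|lborel. f4 z) + 4 * (LINT z|lborel. f1 (?T z))"
    unfolding F_def using i1 i2 i4 i1T i3T by simp
  also have "\<dots> \<le> 3 * a + 3 * (2 * (3 + \<kappa>)\<^sup>2 * a\<^sup>2 * M) + 3 * (2 * (4 * Y * (1 / l + 1) * M)) + 4 * a + 4 * (2 * a)"
  proof (intro add_mono mult_left_mono)
    have sx: "smooth (partial_deriv ex U)" and sy: "smooth (partial_deriv ey U)"
      using smooth_partial_deriv[OF s] by (auto simp: Basis_plane)
    show "(LINT z|lborel. f1 z) \<le> a" unfolding f1_def by (rule close(2))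
    show "(LINT z|lborel. f4 z) \<le> a" unfolding f4_def by (rule K'(5))
    have "(LINT z|lborel. f1 (?T z)) \<le> (1 + 2 * (\<kappa> * a)) * (LINT z|lborel. f1 z)"
      by (rule squeeze_integral_le[OF _ a(3,4) i1 nn(1)]) (use a in simp)
    also have "\<dots> \<le> 2 * a"
      by (rule mult_mono) (use close(2) two nn(1) a in \<open>auto simp: f1_def\<close>)
    finally show "(LINT z|lborel. f1 (?T z)) \<le> 2 * a" .
    have "(LINT z|lborel. f3 (?T z)) \<le> (1 + 2 * (\<kappa> * a)) * (LINT z|lborel. f3 z)"
      by (rule squeeze_integral_le[OF _ a(3,4) i3 nn(3)]) (use a in simp)
    also have "\<dots> \<le> 2 * (4 * Y * (1 / l + 1) * M)"
    proof (rule mult_mono[OF two])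
      have "(LINT z|lborel. f3 z) \<le> (LINT z|lborel. indicator (K \<inter> S) z * ((U z)\<^sup>2 + (partial_deriv ex U z)\<^sup>2 + (partial_deriv ey U z)\<^sup>2))"
      proof (rule integral_mono[OF i3])
        show "integrable lborel (\<lambda>z. indicator (K \<inter> S) z * ((U z)\<^sup>2 + (partial_deriv ex U z)\<^sup>2 + (partial_deriv ey U z)\<^sup>2))"
          by (intro integrable_indicator_compact_mult[OF KS] continuous_intros smooth_continuous_on s sx sy)
      qed (auto simp: f3_def indicator_def)
      also have "\<dots> \<le> 4 * Y * (1 / l + 1) * M"
        by (rule ends_jet_estimate[OF s Y KS _ P M]) (use strips in \<open>simp add: S_def\<close>)
      finally show "(LINT z|lborel. f3 z) \<le> 4 * Y * (1 / l + 1) * M" .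
    qed (use nn(3) in auto)
    finally show "(LINT z|lborel. f3 (?T z)) \<le> 2 * (4 * Y * (1 / l + 1) * M)" .
    have "(LINT z|lborel. f2 z) \<le> 2 * (3 + \<kappa>)\<^sup>2 * a\<^sup>2
        * (LINT z|lborel. indicator P z * ((partial_deriv ex U z)\<^sup>2 + (partial_deriv ey U z)\<^sup>2))"
      unfolding f2_def by (rule path_estimate[OF s K'(1) P(1) a(1,3,4) K'(3,4)])
    also have "\<dots> \<le> 2 * (3 + \<kappa>)\<^sup>2 * a\<^sup>2 * M"
    proof (rule mult_left_mono)
      have "(LINT z|lborel. indicator P z * ((partial_deriv ex U z)\<^sup>2 + (partial_deriv ey U z)\<^sup>2))
          \<le> (LINT z|lborel. indicator P z * jet_energy 0 1 (\<lambda>bs. foldr partial_deriv bs U z))"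
      proof (rule integral_mono)
        show "integrable lborel (\<lambda>z. indicator P z * ((partial_deriv ex U z)\<^sup>2 + (partial_deriv ey U z)\<^sup>2))"
          by (intro integrable_indicator_compact_mult[OF P(1)] continuous_intros smooth_continuous_on sx sy)
        show "integrable lborel (\<lambda>z. indicator P z * jet_energy 0 1 (\<lambda>bs. foldr partial_deriv bs U z))"
          by (rule integrable_indicator_compact_mult[OF P(1) continuous_on_jet_energy[OF s]])
        show "indicator P z * ((partial_deriv ex U z)\<^sup>2 + (partial_deriv ey U z)\<^sup>2)
            \<le> indicator P z * jet_energy 0 1 (\<lambda>bs. foldr partial_deriv bs U z)" for z
          by (rule mult_left_mono) (simp_all add: jet_energy_sum_squares)
      qed
      then show "(LINT z|lborel. indicator P z * ((partial_deriv ex U z)\<^sup>2 + (partial_deriv ey U z)\<^sup>2)) \<le> M"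
        using M by linarith
    qed simp
    finally show "(LINT z|lborel. f2 z) \<le> 2 * (3 + \<kappa>)\<^sup>2 * a\<^sup>2 * M" .
  qed auto
  also have "3 * a + 3 * (2 * (3 + \<kappa>)\<^sup>2 * a\<^sup>2 * M) + 3 * (2 * (4 * Y * (1 / l + 1) * M)) + 4 * a + 4 * (2 * a)
      = 15 * a + 6 * (3 + \<kappa>)\<^sup>2 * a\<^sup>2 * M + 24 * Y * (1 / l + 1) * M" by simp
  finally show ?thesis .
qed

section \<open>The H-condition\<close>

lemma C2_unit_interval_Lipschitz:
  assumes "C2_unit_interval g"
  obtains G where "0 \<le> G" "\<And>x y. x \<in> {0..1} \<Longrightarrow> y \<in> {0..1} \<Longrightarrow> \<bar>g x - g y\<bar> \<le> G * \<bar>x - y\<bar>"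
proof -
  obtain g' g'' where d: "\<And>x. x \<in> {0..1} \<Longrightarrow> (g has_real_derivative g' x) (at x within {0..1})"
    "\<And>x. x \<in> {0..1} \<Longrightarrow> (g' has_real_derivative g'' x) (at x within {0..1})"
    using assms unfolding C2_unit_interval_def by blast
  have "continuous_on {0..1} g'"
    unfolding continuous_on_eq_continuous_within using d(2) DERIV_continuous by blast
  then have "bounded (g' ` {0..1})" by (intro compact_imp_bounded compact_continuous_image) auto
  then obtain G where G: "\<And>x. x \<in> {0..1} \<Longrightarrow> \<bar>g' x\<bar> \<le> G" unfolding bounded_iff by fastforce
  have "0 \<le> G" using G[of 0] by force
  moreover have "\<bar>g x - g y\<bar> \<le> G * \<bar>x - y\<bar>" if "x \<in> {0..1}" "y \<in> {0..1}" for x y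
    using field_differentiable_bound[OF convex_real_interval(5), of 0 1 g g' G x y] d(1) G that by simp
  ultimately show ?thesis by (rule that)
qed

text \<open>The condition \<open>3 * a < r\<close> keeps the stretched channel inside the boxes of
  the ends; \<open>a * B \<le> r / 2\<close> with \<open>\<epsilon> \<le> a\<close> keeps the strips
  below the height \<open>r / 2\<close> at which the trace inequality is applied. The last
  conclusion later turns a factor 1 + O(\<open>a\<close>) into an additive error.\<close>

lemma dumbbell_estimate:
  fixes \<Omega> :: "(real \<times> real) set"
  assumes q: "-1 < \<sigma>" "\<sigma> < 1" "0 \<le> \<tau>"
    and \<Omega>: "open \<Omega>" "bounded \<Omega>"
    and r: "0 < r" "r < 1" "{-r<..<0} \<times> {-r<..<r} \<subseteq> \<Omega>" "{1<..<1+r} \<times> {-r<..<r} \<subseteq> \<Omega>"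
    and G: "0 \<le> G" "\<And>x y. x \<in> {0..1} \<Longrightarrow> y \<in> {0..1} \<Longrightarrow> \<bar>g x - g y\<bar> \<le> G * \<bar>x - y\<bar>"
    and m: "0 < m" "\<And>x. x \<in> {0..1} \<Longrightarrow> m \<le> g x" and B: "\<And>x. x \<in> {0..1} \<Longrightarrow> g x \<le> B"
    and \<kappa>: "\<kappa> * m = 6 * G + 2" "0 \<le> \<kappa>"
    and a: "0 < a" "a \<le> 1" "(6 + \<kappa>) * a \<le> 1" "\<kappa> * a \<le> 1 / 2" "3 * a < r" "a * B \<le> r / 2"
    and \<epsilon>: "0 < \<epsilon>" "\<epsilon> \<le> a" "\<And>x. x \<in> {0..1} \<Longrightarrow> \<epsilon> * g x \<le> 1"
    and x: "smooth \<xi>" "\<And>z. 0 \<le> \<xi> z \<and> \<xi> z \<le> 1" "\<And>z. fst z \<le> -2 * a \<or> 1 + 2 * a \<le> fst z \<Longrightarrow> \<xi> z = 0"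
      "\<And>z. -a \<le> fst z \<and> fst z \<le> 1 + a \<Longrightarrow> \<xi> z = 1"
      "partial_deriv ey \<xi> = (\<lambda>z. 0)" "partial_deriv ey (partial_deriv ex \<xi>) = (\<lambda>z. 0)"
      "\<And>z. \<bar>partial_deriv ex \<xi> z\<bar> \<le> C / a" "\<And>z. \<bar>partial_deriv ex (partial_deriv ex \<xi>) z\<bar> \<le> C / a\<^sup>2"
      "\<And>z. -a < fst z \<Longrightarrow> fst z < 1 + a \<Longrightarrow> partial_deriv ex \<xi> z = 0 \<and> partial_deriv ex (partial_deriv ex \<xi>) z = 0"
    and u: "u \<in> H2 (dumbbell \<Omega> g \<epsilon>)" "H2_norm (dumbbell \<Omega> g \<epsilon>) u \<le> M"
  obtains v where "v \<in> H2_vanishing (channel g \<epsilon>) (junctions g \<epsilon>)"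
    "(L2_norm (channel g \<epsilon>) (\<lambda>z. u z - v z))\<^sup>2 \<le> 15 * a + 6 * (3 + \<kappa>)\<^sup>2 * a\<^sup>2 * M\<^sup>2 + 24 * (\<epsilon> * B) * (1 / (r / 2) + 1) * M\<^sup>2"
    "(H2_bracket \<sigma> \<tau> (channel g \<epsilon>) v)\<^sup>2 \<le> (1 + 2 * (\<kappa> * a)) * ((1 + a) * (H2_bracket \<sigma> \<tau> (dumbbell \<Omega> g \<epsilon>) u)\<^sup>2
      + 36 * (3 + \<tau>) * (6 + \<kappa>)\<^sup>2 * a * M\<^sup>2 + 64 * (3 + \<tau>) / a * (8 * (C / a\<^sup>2)\<^sup>2) * (4 * (\<epsilon> * B) * (1 / (r / 2) + 1) * M\<^sup>2))"
    "(H2_bracket \<sigma> \<tau> (dumbbell \<Omega> g \<epsilon>) u)\<^sup>2 \<le> (3 + \<tau>) * M\<^sup>2"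
proof -
  define D where "D = dumbbell \<Omega> g \<epsilon>"
  define R where "R = channel g \<epsilon>"
  \<comment> \<open>Extending \<open>g\<close> by its end values keeps its bounds and Lipschitz
    constant and lets one formula prolong the channel into the ends.\<close>
  define gt where "gt x = g (max 0 (min 1 x))" for x
  define Y where "Y = \<epsilon> * B"
  define l where "l = r / 2"
  \<comment> \<open>Half the minimal height: contraction towards it lifts points off the floor and
    lowers points at the ceiling, wherever they lie along the channel.\<close>
  define c where "c = \<epsilon> * m / 2"
  let ?T = "squeeze \<kappa> c a"
  have gt_m: "m \<le> gt x" and gt_B: "gt x \<le> B" and gt_1: "\<epsilon> * gt x \<le> 1" for x
    unfolding gt_def by (rule m B \<epsilon>, simp)+
  have gt_eq: "gt x = g x" if "0 \<le> x" "x \<le> 1" for x using that by (simp add: gt_def)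
  have gt_lip: "\<bar>gt x - gt y\<bar> \<le> G * \<bar>x - y\<bar>" for x y
  proof -
    have "\<bar>gt x - gt y\<bar> \<le> G * \<bar>max 0 (min 1 x) - max 0 (min 1 y)\<bar>"
      unfolding gt_def by (rule G(2)) auto
    also have "\<dots> \<le> G * \<bar>x - y\<bar>" by (rule mult_left_mono[OF _ G(1)]) linarith
    finally show ?thesis .
  qed
  have gt_c: "continuous_on UNIV gt"
    by (rule lipschitz_on_continuous_on[of G]) (rule lipschitz_onI, use gt_lip G in \<open>auto simp: dist_real_def\<close>)
  have gt_pos: "0 < gt x" for x using m(1) gt_m[of x] by linarith
  have B0: "0 < B" using gt_pos[of 0] gt_B[of 0] by linarith
  have Y: "0 \<le> Y" "Y \<le> l" "0 < l"
  proof -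
    have "\<epsilon> * B \<le> a * B" using \<epsilon>(2) B0 by (intro mult_right_mono) auto
    then show "Y \<le> l" using a(6) by (simp add: Y_def l_def)
  qed (use \<epsilon> B0 r in \<open>auto simp: Y_def l_def\<close>)
  have eY: "\<epsilon> * gt x \<le> Y" for x
    unfolding Y_def using gt_B[of x] \<epsilon>(1) by (intro mult_left_mono) auto
  have lr: "l < r" using r by (simp add: l_def)
  \<comment> \<open>Channel, junctions and their prolongations into the boxes form one open set,
    which shows that the dumbbell is open across the junctions.\<close>
  define H where "H = {z::real \<times> real. -r < fst z \<and> fst z < 1 + r \<and> 0 < snd z \<and> snd z < \<epsilon> * gt (fst z)}"
  have gtf: "continuous_on UNIV (\<lambda>z::real \<times> real. \<epsilon> * gt (fst z))"
    by (intro continuous_on_mult_left continuous_on_compose2[OF gt_c continuous_on_fst[OF continuous_on_id]]) simp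
  have oH: "open H"
    unfolding H_def by (intro open_Collect_conj open_Collect_less gtf continuous_intros)
  have R_eq: "R = {z. 0 < fst z \<and> fst z < 1 \<and> 0 < snd z \<and> snd z < \<epsilon> * gt (fst z)}"
    unfolding R_def channel_def by (auto simp: gt_eq)
  have oR: "open R"
    unfolding R_eq by (intro open_Collect_conj open_Collect_less gtf continuous_intros)
  have D_eq: "D = \<Omega> \<union> H"
  proof
    have "channel g \<epsilon> \<subseteq> H" using R_eq r by (auto simp: R_def H_def)
    moreover have "junctions g \<epsilon> \<subseteq> H" using r by (auto simp: junctions_def H_def gt_eq)
    ultimately show "D \<subseteq> \<Omega> \<union> H" by (auto simp: D_def dumbbell_def)
    show "\<Omega> \<union> H \<subseteq> D"
    proof
      fix z assume "z \<in> \<Omega> \<union> H"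
      then show "z \<in> D"
      proof
        assume zH: "z \<in> H"
        obtain p y where z: "z = (p, y)" by (cases z)
        have h: "-r < p" "p < 1 + r" "0 < y" "y < \<epsilon> * gt p" using zH by (auto simp: H_def z)
        then have y: "y < r" using eY[of p] Y lr by linarith
        consider "p < 0" | "p = 0" | "0 < p" "p < 1" | "p = 1" | "1 < p" by linarith
        then show "z \<in> D"
        proof cases
          case 1
          then have "z \<in> {-r<..<0} \<times> {-r<..<r}" using h y r(1) by (simp add: z)
          then show ?thesis using r(3) by (auto simp: D_def dumbbell_def)
        next
          case 5
          then have "z \<in> {1<..<1+r} \<times> {-r<..<r}" using h y r(1) by (simp add: z)
          then show ?thesis using r(4) by (auto simp: D_def dumbbell_def)
        qed (use h gt_eq in \<open>auto simp: D_def dumbbell_def channel_def junctions_def z\<close>)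
      qed (simp add: D_def dumbbell_def)
    qed
  qed
  have oD: "open D" unfolding D_eq using \<Omega>(1) oH by (rule open_Un)
  have "H \<subseteq> {-r..1+r} \<times> {0..r}"
  proof
    fix z assume "z \<in> H"
    then show "z \<in> {-r..1+r} \<times> {0..r}" using eY[of "fst z"] Y lr by (cases z) (auto simp: H_def)
  qed
  then have "bounded H" by (rule bounded_subset[rotated]) (intro bounded_Times bounded_closed_interval; simp)
  then have "bounded D" unfolding D_eq using \<Omega>(2) by simp
  then obtain r0 where r0: "D \<subseteq> ball 0 r0" using bounded_subset_ballD by blast
  have RD: "R \<subseteq> D" by (auto simp: R_def D_def dumbbell_def)
  have Rr0: "R \<subseteq> ball 0 r0" using RD r0 by blast
  have sq_fst: "fst (squeeze \<kappa> c s z) = - 3 * s + (1 + 6 * s) * fst z"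
    and sq_snd: "snd (squeeze \<kappa> c s z) = c * (\<kappa> * s) + (1 - \<kappa> * s) * snd z" for s z
    by (simp_all add: squeeze_def)
  \<comment> \<open>Origin of \<kappa>: at the ceiling the contraction gains at least
    \<open>\<kappa> * s * \<epsilon> * m / 2\<close>, that is
    \<open>\<epsilon> * s * (3 * G + 1)\<close>, while a shift by at most \<open>3 * s\<close>
    lowers the ceiling by at most \<open>3 * G * \<epsilon> * s\<close>. The surplus
    \<open>\<epsilon> * s\<close> makes the inclusion strict.\<close>
  have sq_in: "squeeze \<kappa> c s z \<in> H \<and> -3 * s \<le> fst (squeeze \<kappa> c s z) \<and> fst (squeeze \<kappa> c s z) \<le> 1 + 3 * s"
    if s: "0 < s" "s \<le> a" and z: "0 \<le> fst z" "fst z \<le> 1" "0 \<le> snd z" "snd z \<le> \<epsilon> * gt (fst z)" for s z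
  proof -
    define p where "p = fst z"
    define y where "y = snd z"
    define p' where "p' = - 3 * s + (1 + 6 * s) * p"
    define y' where "y' = c * (\<kappa> * s) + (1 - \<kappa> * s) * y"
    have sp: "0 \<le> s * p" "s * p \<le> s" using s z mult_left_mono[of p 1 s] by (auto simp: p_def)
    have dp: "\<bar>p' - p\<bar> \<le> 3 * s" using sp by (simp add: p'_def algebra_simps abs_le_iff)
    have pr: "-3 * s \<le> p'" "p' \<le> 1 + 3 * s"
      using sp z by (simp_all add: p'_def p_def algebra_simps)
    have ks0: "\<kappa> * s \<le> \<kappa> * a" using s \<kappa>(2) by (intro mult_left_mono) auto
    then have ks: "0 \<le> \<kappa> * s" "\<kappa> * s \<le> 1 / 2" using s \<kappa>(2) a(4) by auto
    have "\<kappa> \<noteq> 0" using \<kappa>(1) G(1) by auto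
    then have "0 < c * (\<kappa> * s)" using \<epsilon>(1) m(1) s \<kappa>(2) by (simp add: c_def)
    then have y0: "0 < y'" unfolding y'_def using ks z by (simp add: y_def add_pos_nonneg)
    have h1: "(1 - \<kappa> * s) * y \<le> (1 - \<kappa> * s) * (\<epsilon> * gt p)"
      by (rule mult_left_mono) (use ks z in \<open>auto simp: y_def p_def\<close>)
    have "\<epsilon> * m \<le> \<epsilon> * gt p" using gt_m[of p] \<epsilon>(1) by (intro mult_left_mono) auto
    then have h2: "\<kappa> * s * (\<epsilon> * m) \<le> \<kappa> * s * (\<epsilon> * gt p)" by (rule mult_left_mono) (rule ks(1))
    have h3: "\<kappa> * s * (\<epsilon> * m) = \<epsilon> * s * (6 * G + 2)" unfolding \<kappa>(1)[symmetric] by simp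
    have "y' \<le> \<epsilon> * gt p - \<epsilon> * s * (6 * G + 2) / 2"
      unfolding y'_def c_def using h1 h2 unfolding h3[symmetric] by (simp add: algebra_simps)
    also have "\<dots> = \<epsilon> * (gt p - 3 * s * G) - \<epsilon> * s" by (simp add: algebra_simps)
    also have "\<dots> < \<epsilon> * (gt p - 3 * s * G)" using \<epsilon>(1) s by simp
    also have "\<dots> \<le> \<epsilon> * gt p'"
    proof (rule mult_left_mono)
      have "\<bar>gt p' - gt p\<bar> \<le> G * (3 * s)"
        using gt_lip[of p' p] mult_left_mono[OF dp G(1)] by linarith
      then show "gt p - 3 * s * G \<le> gt p'" by (simp add: abs_le_iff algebra_simps)
    qed (use \<epsilon> in simp)
    finally have y1: "y' < \<epsilon> * gt p'" .
    have "3 * s < r" using s a(5) by simp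
    then have "-r < p'" "p' < 1 + r" using pr by auto
    with y0 y1 pr show ?thesis
      unfolding H_def mem_Collect_eq sq_fst sq_snd p_def[symmetric] y_def[symmetric] p'_def[symmetric] y'_def[symmetric] by simp
  qed
  \<comment> \<open>The closed channel, so that its image is compact; by \<open>sq_in\<close> the
    image still lies in the open set \<open>H\<close>.\<close>
  define Q where "Q = {z::real \<times> real. 0 \<le> fst z \<and> fst z \<le> 1 \<and> 0 \<le> snd z \<and> snd z \<le> \<epsilon> * gt (fst z)}"
  have RQ: "R \<subseteq> Q" by (auto simp: R_eq Q_def)
  have cQ: "compact Q"
  proof -
    have "closed Q" unfolding Q_def by (intro closed_Collect_conj closed_Collect_le gtf continuous_intros)
    moreover have "Q \<subseteq> {0..1} \<times> {0..1}"
    proof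
      fix z assume "z \<in> Q"
      then show "z \<in> {0..1} \<times> {0..1}" using gt_1[of "fst z"] by (cases z) (auto simp: Q_def)
    qed
    then have "bounded Q" by (rule bounded_subset[rotated]) (intro bounded_Times bounded_closed_interval; simp)
    ultimately show ?thesis by (simp add: compact_eq_bounded_closed)
  qed
  have Tc: "continuous_on A ?T" for A unfolding squeeze_def by (intro continuous_intros)
  define K where "K = ?T ` Q"
  have cK: "compact K" unfolding K_def by (rule compact_continuous_image[OF Tc cQ])
  have KT: "?T z \<in> K" if "z \<in> R" for z using that RQ by (auto simp: K_def)
  have K_in: "z \<in> H \<and> -3 * a \<le> fst z \<and> fst z \<le> 1 + 3 * a" if "z \<in> K" for z
    using that sq_in[OF a(1) order_refl] by (auto simp: K_def Q_def)
  have strips: "K \<inter> {z. fst z \<le> -a \<or> 1 + a \<le> fst z} \<subseteq> {-3*a..-a} \<times> {0..Y} \<union> {1+a..1+3*a} \<times> {0..Y}"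
  proof
    fix z assume z: "z \<in> K \<inter> {z. fst z \<le> -a \<or> 1 + a \<le> fst z}"
    then have "0 \<le> snd z" "snd z \<le> Y" using K_in[of z] eY[of "fst z"] by (auto simp: H_def)
    then show "z \<in> {-3*a..-a} \<times> {0..Y} \<union> {1+a..1+3*a} \<times> {0..Y}"
      using z K_in[of z] by (cases z) auto
  qed
  obtain w where w: "\<And>bs. bs \<in> jet_indices \<Longrightarrow> borel_rep D (weak_jet D u bs) (w bs)"
    using weak_jet_rep_exists[OF oD, of u] u(1) unfolding D_def by blast
  have uD: "u \<in> H2 D" using u(1) by (simp add: D_def)
  have J0: "[] \<in> jet_indices" by (simp add: jet_indices_def)
  have wi: "integrable lborel (w bs)" and w2: "integrable lborel (\<lambda>z. (w bs z)\<^sup>2)" and wm: "w bs \<in> borel_measurable borel"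
    if "bs \<in> jet_indices" for bs
    using L2_borel_rep_integrable[OF oD r0 weak_jet_works(1)[OF uD that] w[OF that]]
      L2_borel_rep(1,2)[OF oD weak_jet_works(1)[OF uD that] w[OF that]] by auto
  define u0 where "u0 = w []"
  have ru: "borel_rep D u u0" using w[OF J0] by (simp add: u0_def weak_jet_def)
  have u0m: "u0 \<in> borel_measurable borel" and u02: "integrable lborel (\<lambda>z. (u0 z)\<^sup>2)"
    using wm[OF J0] w2[OF J0] by (simp_all add: u0_def)
  have pos: "0 < 1 + 6 * a" "0 < 1 - \<kappa> * a" using a by auto
  \<comment> \<open>An exhaustion of the channel by compact sets. The integrand includes the
    squeezed copy of \<open>u0\<close>, since off \<open>K'\<close> both have to be
    absorbed.\<close>
  obtain K' where K': "compact K'" "K' \<subseteq> R"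
    "(LINT z|lborel. indicator (R - K') z * ((u0 z)\<^sup>2 + (u0 (?T z))\<^sup>2)) \<le> a"
  proof -
    obtain E where E: "\<And>n::nat. compact (E n)" "\<And>n. E n \<subseteq> R" "\<And>n. E n \<subseteq> interior (E (Suc n))" "\<Union>(range E) = R"
      using open_Union_compact_subsets[OF oR] by metis
    define f where "f z = (u0 z)\<^sup>2 + (u0 (?T z))\<^sup>2" for z
    have fi: "integrable lborel f" unfolding f_def using u02 squeeze_lebesgue(1)[OF pos u02] by simp
    have mono: "E i \<subseteq> E j" if "i \<le> j" for i j
      by (rule lift_Suc_mono_le[OF _ that]) (use E(3) interior_subset in blast)
    have [measurable]: "f \<in> borel_measurable borel" using borel_measurable_integrable[OF fi] by simp
    have [measurable]: "R \<in> sets borel" "E n \<in> sets borel" for n using oR E(1) by (auto simp: borel_compact)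
    have f0: "0 \<le> f z" for z by (simp add: f_def)
    have "(\<lambda>n. LINT z|lborel. indicator (R - E n) z * f z) \<longlonglongrightarrow> (LINT z|(lborel::(real \<times> real) measure). 0)"
    proof (rule integral_dominated_convergence[OF _ _ fi])
      show "AE z in lborel. (\<lambda>n. indicator (R - E n) z * f z) \<longlonglongrightarrow> 0"
      proof (intro AE_I2 tendsto_eventually)
        fix z
        show "eventually (\<lambda>n. indicator (R - E n) z * f z = 0) sequentially"
        proof (cases "z \<in> R")
          case True
          then obtain n where "z \<in> E n" using E(4) by blast
          then show ?thesis unfolding eventually_sequentially
            using mono by (intro exI[of _ n]) (auto simp: indicator_def)
        qed simp
      qed
      show "AE z in lborel. norm (indicator (R - E n) z * f z) \<le> f z" for n
        using f0 by (intro AE_I2) (simp add: indicator_def)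
    qed measurable
    then have "eventually (\<lambda>n. (LINT z|lborel. indicator (R - E n) z * f z) < a) sequentially"
      using a(1) by (intro order_tendstoD(2)) auto
    then obtain n where "(LINT z|lborel. indicator (R - E n) z * f z) < a"
      unfolding eventually_sequentially by blast
    then show ?thesis using that[of "E n"] E(1,2) by (simp add: f_def)
  qed
  \<comment> \<open>\<open>P1\<close> is swept out by the segments starting in \<open>K'\<close>.
    \<open>P\<close> gathers every point at which the jets of \<open>U\<close> will be estimated;
    being compact in the open dumbbell, it leaves a positive distance as room for
    mollification.\<close>
  define P1 where "P1 = (\<lambda>p. squeeze \<kappa> c (fst p * a) (snd p)) ` ({0..1} \<times> K')"
  define P where "P = K \<union> P1 \<union> ({-3*a..-a} \<times> {0..l} \<union> {1+a..1+3*a} \<times> {0..l})"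
  have cP: "compact P"
  proof -
    have "compact P1" unfolding P1_def
      by (rule compact_continuous_image)
        (auto simp: squeeze_def intro!: continuous_intros compact_Times K'(1))
    then show ?thesis unfolding P_def by (intro compact_Un cK compact_Times compact_Icc)
  qed
  have PD: "P \<subseteq> D"
  proof -
    have "K \<subseteq> H" using K_in by blast
    moreover have "P1 \<subseteq> H"
    proof
      fix z assume "z \<in> P1"
      then obtain t k where tk: "0 \<le> t" "t \<le> 1" "k \<in> K'" "z = squeeze \<kappa> c (t * a) k" by (auto simp: P1_def)
      have kR: "k \<in> R" using tk K' by blast
      show "z \<in> H"
      proof (cases "t = 0")
        \<comment> \<open>For \<open>t = 0\<close> the squeeze is the identity and
          \<open>sq_in\<close> does not apply; the starting point lies in the channel
          anyway.\<close>
        case True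
        then have "z = k" using tk by (simp add: squeeze_def zero_prod_def[symmetric])
        then show ?thesis using kR r by (auto simp: R_eq H_def)
      next
        case False
        then have "0 < t * a" "t * a \<le> a" using tk a by (auto simp: mult_left_le_one_le)
        then show ?thesis using sq_in[of "t * a" k] kR RQ tk(4) by (auto simp: Q_def)
      qed
    qed
    moreover have "{-3*a..-a} \<times> {0..l} \<subseteq> {-r<..<0} \<times> {-r<..<r}" using a lr r by auto
    moreover have "{1+a..1+3*a} \<times> {0..l} \<subseteq> {1<..<1+r} \<times> {-r<..<r}" using a lr r by auto
    ultimately show ?thesis unfolding P_def D_eq using r(3,4) by blast
  qed
  obtain d where d: "d > 0" "\<And>z. z \<in> P \<Longrightarrow> cball z d \<subseteq> D" by (rule mollifier_room[OF cP oD PD]) blast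
  have u0z: "u0 z = 0" if "r0 \<le> norm z" for z
  proof -
    have "z \<notin> D" using that r0 by auto
    then show ?thesis using ru unfolding borel_rep_def by blast
  qed
  have "\<exists>\<delta>0>0. \<forall>\<delta>\<le>\<delta>0. \<forall>\<rho>. mollifier \<delta> \<rho> \<longrightarrow>
      integrable lborel (\<lambda>z. (u0 z - convolution u0 \<rho> z)\<^sup>2) \<and> (LINT z|lborel. (u0 z - convolution u0 \<rho> z)\<^sup>2) < a"
    by (rule convolution_converges_L2[OF u0m u02 _ a(1)]) (rule u0z)
  then obtain \<delta>0 where \<delta>0: "\<delta>0 > 0" "\<forall>\<delta>\<le>\<delta>0. \<forall>\<rho>. mollifier \<delta> \<rho> \<longrightarrow>
      integrable lborel (\<lambda>z. (u0 z - convolution u0 \<rho> z)\<^sup>2) \<and> (LINT z|lborel. (u0 z - convolution u0 \<rho> z)\<^sup>2) < a"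
    by blast
  define \<delta> where "\<delta> = min d \<delta>0"
  have "\<delta> > 0" using d \<delta>0 by (simp add: \<delta>_def)
  then obtain \<rho> :: "real \<times> real \<Rightarrow> real" where mo: "mollifier \<delta> \<rho>" by (rule mollifier_exists)
  define U where "U = convolution u0 \<rho>"
  have close: "integrable lborel (\<lambda>z. (u0 z - U z)\<^sup>2)" "(LINT z|lborel. (u0 z - U z)\<^sup>2) \<le> a"
    using \<delta>0(2)[rule_format, OF _ mo] by (auto simp: U_def \<delta>_def less_imp_le)
  have u0i: "integrable lborel u0" using wi[OF J0] by (simp add: u0_def)
  have sU: "smooth U" unfolding U_def by (rule smooth_convolution[OF u0i mollifier_smooth[OF mo] mollifier_zero[OF mo]])
  have jets: "foldr partial_deriv bs U z = convolution (w bs) \<rho> z" if z: "z \<in> P" and bs: "bs \<in> jet_indices" for z bs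
  proof -
    have uL: "u \<in> L2 D" using uD by (simp add: H2_def)
    have "cball z \<delta> \<subseteq> D" using d(2)[OF z] by (auto simp: \<delta>_def)
    moreover have "set bs \<subseteq> Basis" using bs jet_indices_iff by blast
    ultimately show ?thesis unfolding U_def
      by (intro iterated_partial_deriv_mollified[OF oD r0 uL ru weak_jet_works(1)[OF uD bs] w[OF bs] weak_jet_works(2)[OF uD bs] _ mo])
  qed
  have energy: "(LINT z|lborel. indicator P z * jet_energy s t (\<lambda>bs. foldr partial_deriv bs U z)) \<le> (H2_bracket s t D u)\<^sup>2"
    if st: "-1 < s" "s < 1" "0 \<le> t" for s t
  proof -
    note con = convolution_jet_energy_contraction[OF mo st wi w2]
    have "(LINT z|lborel. indicator P z * jet_energy s t (\<lambda>bs. foldr partial_deriv bs U z))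
        \<le> (LINT z|lborel. jet_energy s t (\<lambda>bs. convolution (w bs) \<rho> z))"
    proof (rule integral_mono[OF integrable_indicator_compact_mult[OF cP continuous_on_jet_energy[OF sU]] con(1)])
      fix z
      show "indicator P z * jet_energy s t (\<lambda>bs. foldr partial_deriv bs U z) \<le> jet_energy s t (\<lambda>bs. convolution (w bs) \<rho> z)"
      proof (cases "z \<in> P")
        case True
        then show ?thesis using jet_energy_cong[of "\<lambda>bs. foldr partial_deriv bs U z" "\<lambda>bs. convolution (w bs) \<rho> z"] jets by simp
      next
        case False
        then show ?thesis using jet_energy_nonneg[OF st] by simp
      qed
    qed
    also have "\<dots> \<le> (LINT z|lborel. jet_energy s t (\<lambda>bs. w bs z))" by (rule con(2))
    also have "\<dots> = (H2_bracket s t D u)\<^sup>2" by (rule H2_bracket_square(1)[OF oD uD w st, symmetric])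
    finally show ?thesis .
  qed
  have nM: "(H2_bracket 0 1 D u)\<^sup>2 \<le> M\<^sup>2"
  proof -
    have "0 \<le> H2_norm D u" by (simp add: H2_norm_def)
    then show ?thesis using u(2) by (simp add: D_def[symmetric] H2_norm_eq_bracket[symmetric] power_mono)
  qed
  have EM: "(LINT z|lborel. indicator P z * jet_energy 0 1 (\<lambda>bs. foldr partial_deriv bs U z)) \<le> M\<^sup>2"
    using energy[of 0 1] nM by simp
  have brM: "(H2_bracket \<sigma> \<tau> D u)\<^sup>2 \<le> (3 + \<tau>) * M\<^sup>2"
  proof -
    have b: "(H2_bracket s t D u)\<^sup>2 = (LINT z|lborel. jet_energy s t (\<lambda>bs. w bs z))"
        "integrable lborel (\<lambda>z. jet_energy s t (\<lambda>bs. w bs z))" if "-1 < s" "s < 1" "0 \<le> t" for s t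
      by (rule H2_bracket_square[OF oD uD _ that], rule w, assumption)+
    have "(H2_bracket \<sigma> \<tau> D u)\<^sup>2 \<le> (LINT z|lborel. (3 + \<tau>) * jet_energy 0 1 (\<lambda>bs. w bs z))"
      unfolding b(1)[OF q] by (rule integral_mono[OF b(2)[OF q] _ jet_energy_le_sum_squares[OF q]]) (use b(2)[of 0 1] in simp)
    also have "\<dots> = (3 + \<tau>) * (H2_bracket 0 1 D u)\<^sup>2" using b(1)[of 0 1] by simp
    also have "\<dots> \<le> (3 + \<tau>) * M\<^sup>2" using nM q(3) by (intro mult_left_mono) auto
    finally show ?thesis .
  qed
  define v where "v z = \<xi> (?T z) * U (?T z)" for z
  have sv: "smooth v" unfolding v_def by (intro smooth_mult smooth_squeeze x(1) sU)
  have Pb: "{-3*a..-a} \<times> {0..l} \<subseteq> P" "{1+a..1+3*a} \<times> {0..l} \<subseteq> P" "K \<subseteq> P" by (auto simp: P_def)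
  show ?thesis
  proof (rule that[of v])
    \<comment> \<open>The points whose squeezed image lies more than \<open>2 * a\<close> beyond a
      junction: \<open>- 3 * a + (1 + 6 * a) * x < - 2 * a\<close> means
      \<open>(1 + 6 * a) * x < a\<close>, which holds at \<open>x = 0\<close>.\<close>
    define N where "N = {z::real \<times> real. (1 + 6 * a) * fst z < a} \<union> {z. (1 + 6 * a) * (1 - fst z) < a}"
    show "v \<in> H2_vanishing (channel g \<epsilon>) (junctions g \<epsilon>)"
      unfolding R_def[symmetric]
    proof (rule smooth_in_H2_vanishing[OF oR Rr0 sv, of N])
      show "open N" unfolding N_def by (intro open_Un open_Collect_less continuous_intros)
      show "junctions g \<epsilon> \<subseteq> N" using a(1) by (auto simp: junctions_def N_def)
      fix z assume "z \<in> N"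
      then have "fst (?T z) \<le> -2 * a \<or> 1 + 2 * a \<le> fst (?T z)"
        unfolding N_def sq_fst by (auto simp: algebra_simps)
      then show "v z = 0" using x(3) by (simp add: v_def)
    qed
    show "(H2_bracket \<sigma> \<tau> (channel g \<epsilon>) v)\<^sup>2 \<le> (1 + 2 * (\<kappa> * a)) * ((1 + a) * (H2_bracket \<sigma> \<tau> (dumbbell \<Omega> g \<epsilon>) u)\<^sup>2
      + 36 * (3 + \<tau>) * (6 + \<kappa>)\<^sup>2 * a * M\<^sup>2 + 64 * (3 + \<tau>) / a * (8 * (C / a\<^sup>2)\<^sup>2) * (4 * (\<epsilon> * B) * (1 / (r / 2) + 1) * M\<^sup>2))"
      unfolding R_def[symmetric] D_def[symmetric] Y_def[symmetric] l_def[symmetric] v_def[abs_def]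
      by (rule squeezed_energy_le[OF oR Rr0 sU q a(1,2) \<kappa>(2) a(3,4) x(1,2,5-9) cK KT strips Y cP Pb(3,1,2) energy[OF q] EM])
    show "(H2_bracket \<sigma> \<tau> (dumbbell \<Omega> g \<epsilon>) u)\<^sup>2 \<le> (3 + \<tau>) * M\<^sup>2" using brM by (simp add: D_def)
    have "(L2_norm R (\<lambda>z. u z - v z))\<^sup>2 = (LINT z|lborel. indicator R z * (u0 z - v z)\<^sup>2)"
    proof -
      have [measurable]: "R \<in> sets borel" "v \<in> borel_measurable borel" "u0 \<in> borel_measurable borel"
        using oR borel_measurable_smooth[OF sv] u0m by auto
      have "u \<in> borel_measurable (lebesgue_on D)" using uD by (auto simp: H2_def L2_def)
      then have "u \<in> borel_measurable (lebesgue_on R)" using RD by (rule measurable_restrict_mono)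
      moreover have "v \<in> borel_measurable (lebesgue_on R)"
        by (rule borel_measurable_lebesgue_on_of_borel) measurable
      ultimately have m: "(\<lambda>z. (u z - v z)\<^sup>2) \<in> borel_measurable (lebesgue_on R)"
        by (intro borel_measurable_power borel_measurable_diff)
      have "borel_rep R (\<lambda>z. (u z - v z)\<^sup>2) (\<lambda>z. indicator R z * (u0 z - v z)\<^sup>2)"
        unfolding borel_rep_def
      proof (intro conjI)
        show "(\<lambda>z. indicator R z * (u0 z - v z)\<^sup>2) \<in> borel_measurable borel" by measurable
        have "AE z in lborel. z \<in> D \<longrightarrow> u z = u0 z" using ru by (simp add: borel_rep_def)
        then show "AE z in lborel. z \<in> R \<longrightarrow> (u z - v z)\<^sup>2 = indicator R z * (u0 z - v z)\<^sup>2"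
          by eventually_elim (use RD in auto)
      qed auto
      from borel_rep_integral(2)[OF oR m this] show ?thesis
        unfolding L2_norm_def by (subst real_sqrt_pow2) (auto intro!: integral_nonneg_AE)
    qed
    also have "\<dots> \<le> 15 * a + 6 * (3 + \<kappa>)\<^sup>2 * a\<^sup>2 * M\<^sup>2 + 24 * Y * (1 / l + 1) * M\<^sup>2"
      unfolding v_def
    proof (rule squeezed_L2_close[OF oR sU a(1,2) \<kappa>(2) a(4) u0m u02 close x(1,2) _ cK KT strips Y cP Pb(1,2) EM K'(1,2) _ _ K'(3)])
      show "\<xi> z = 1" if "-a < fst z" "fst z < 1 + a" for z using x(4)[of z] that by simp
      show "squeeze \<kappa> c (t * a) z \<in> P" if "z \<in> K'" "0 \<le> t" "t \<le> 1" for z t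
        unfolding P_def P1_def using that by (auto intro!: image_eqI[of _ _ "(t, z)"])
      show "0 \<le> fst z \<and> fst z \<le> 1 \<and> \<bar>c - snd z\<bar> \<le> 1" if "z \<in> K'" for z
      proof -
        have "z \<in> R" using that K'(2) by blast
        then have h: "0 < fst z" "fst z < 1" "0 < snd z" "snd z < \<epsilon> * gt (fst z)" by (auto simp: R_eq)
        have "\<epsilon> * m \<le> \<epsilon> * gt 0" using gt_m[of 0] \<epsilon>(1) by (intro mult_left_mono) auto
        then have "\<epsilon> * m \<le> 1" using gt_1[of 0] by linarith
        moreover have "0 \<le> \<epsilon> * m" using \<epsilon>(1) m(1) by simp
        ultimately have "0 \<le> c" "c \<le> 1" unfolding c_def by linarith+
        then show ?thesis using h gt_1[of "fst z"] by auto
      qed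
    qed
    finally show "(L2_norm (channel g \<epsilon>) (\<lambda>z. u z - v z))\<^sup>2 \<le> 15 * a + 6 * (3 + \<kappa>)\<^sup>2 * a\<^sup>2 * M\<^sup>2 + 24 * (\<epsilon> * B) * (1 / (r / 2) + 1) * M\<^sup>2"
      by (simp only: R_def Y_def l_def)
  qed
qed

section \<open>From a fixed width to the limit\<close>

lemma open_channel:
  assumes "continuous_on {0..1} g"
  shows "open (channel g \<epsilon>)"
proof -
  define gt where "gt x = g (max 0 (min 1 x))" for x
  have gtc: "continuous_on UNIV gt"
    unfolding gt_def by (rule continuous_on_compose2[OF assms]) (auto intro!: continuous_intros)
  have gtf: "continuous_on UNIV (\<lambda>z::real \<times> real. \<epsilon> * gt (fst z))"
    by (intro continuous_on_mult_left continuous_on_compose2[OF gtc continuous_on_fst[OF continuous_on_id]]) simp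
  have "open {z::real \<times> real. 0 < fst z \<and> fst z < 1 \<and> 0 < snd z \<and> snd z < \<epsilon> * gt (fst z)}"
    by (intro open_Collect_conj open_Collect_less gtf continuous_intros)
  also have "{z::real \<times> real. 0 < fst z \<and> fst z < 1 \<and> 0 < snd z \<and> snd z < \<epsilon> * gt (fst z)} = channel g \<epsilon>"
    unfolding channel_def by (auto simp: gt_def)
  finally show ?thesis .
qed

lemma bounded_channel:
  assumes "\<And>x. x \<in> {0..1} \<Longrightarrow> \<epsilon> * g x \<le> 1"
  shows "bounded (channel g \<epsilon>)"
proof (rule bounded_subset[of "{0..1} \<times> {0..1}"])
  show "bounded ({0..1::real} \<times> {0..1::real})" by (intro bounded_Times bounded_closed_interval; simp)
  show "channel g \<epsilon> \<subseteq> {0..1} \<times> {0..1}"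
  proof
    fix z assume "z \<in> channel g \<epsilon>"
    then show "z \<in> {0..1} \<times> {0..1}" using assms[of "fst z"] by (auto simp: channel_def)
  qed
qed

text \<open>The factor in front of \<open>e\<close> is 1 + O(\<open>a\<close>); as \<open>e\<close>
  is bounded by \<open>E0\<close>, the excess becomes an additive O(\<open>a\<close>), the form of
  the error term in the H-condition.\<close>

lemma estimate_arithmetic:
  fixes a e X Z E0 \<kappa> :: real
  assumes a: "0 < a" "a \<le> 1" and "0 \<le> \<kappa>" "0 \<le> X" "0 \<le> Z" "0 \<le> e" "e \<le> E0"
  shows "(1 + 2 * (\<kappa> * a)) * ((1 + a) * e + X * a + Z * a) \<le> e + ((4 * \<kappa> + 1) * E0 + (1 + 2 * \<kappa>) * (X + Z)) * a"
proof -
  have ka: "0 \<le> \<kappa> * a" "\<kappa> * a \<le> \<kappa>" using assms by (auto simp: mult_left_le)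
  have "(1 + 2 * (\<kappa> * a)) * (1 + a) \<le> 1 + (4 * \<kappa> + 1) * a"
    using mult_right_mono[OF ka(2), of a] a by (simp add: algebra_simps)
  from mult_right_mono[OF this assms(6)]
  have "(1 + 2 * (\<kappa> * a)) * (1 + a) * e \<le> e + (4 * \<kappa> + 1) * a * e" by (simp add: distrib_right)
  also have "(4 * \<kappa> + 1) * a * e \<le> (4 * \<kappa> + 1) * a * E0"
    using assms by (intro mult_left_mono) auto
  finally have 1: "(1 + 2 * (\<kappa> * a)) * (1 + a) * e \<le> e + (4 * \<kappa> + 1) * a * E0" by simp
  have 2: "(1 + 2 * (\<kappa> * a)) * ((X + Z) * a) \<le> (1 + 2 * \<kappa>) * ((X + Z) * a)"
    using ka assms by (intro mult_right_mono) auto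
  have "(1 + 2 * (\<kappa> * a)) * ((1 + a) * e + X * a + Z * a)
      = (1 + 2 * (\<kappa> * a)) * (1 + a) * e + (1 + 2 * (\<kappa> * a)) * ((X + Z) * a)" by (simp add: algebra_simps)
  also have "\<dots> \<le> e + (4 * \<kappa> + 1) * a * E0 + (1 + 2 * \<kappa>) * ((X + Z) * a)" using 1 2 by linarith
  finally show ?thesis by (simp add: algebra_simps)
qed

theorem theorem4:
  fixes \<Omega>L \<Omega>R :: "(real \<times> real) set" and g :: "real \<Rightarrow> real" and \<sigma> \<tau> \<epsilon>0 :: real
  assumes "-1 < \<sigma>" "\<sigma> < 1" "0 \<le> \<tau>"
    and "dumbbell_ends \<Omega>L \<Omega>R"
    and "C2_unit_interval g" "\<forall>x\<in>{0..1}. 0 < g x"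
    and "0 < \<epsilon>0" "\<forall>x\<in>{0..1}. \<epsilon>0 * g x \<le> 1"
    and "monotonicity_property g"
  shows "H_condition \<sigma> \<tau> (\<Omega>L \<union> \<Omega>R) g \<epsilon>0"
  unfolding H_condition_def
proof (intro allI impI)
  let ?\<Omega> = "\<Omega>L \<union> \<Omega>R"
  fix u :: "real \<Rightarrow> real \<times> real \<Rightarrow> real" and M :: real
  assume u: "\<forall>\<epsilon>\<in>{0<..<\<epsilon>0}. u \<epsilon> \<in> H2 (dumbbell ?\<Omega> g \<epsilon>) \<and> H2_norm (dumbbell ?\<Omega> g \<epsilon>) (u \<epsilon>) \<le> M"
  note q = assms(1-3)
  have \<Omega>: "open ?\<Omega>" "bounded ?\<Omega>"
    using assms(4) by (auto simp: dumbbell_ends_def bounded_smooth_domain_def)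
  obtain r where r: "0 < r" "r < 1" "{-r<..<0} \<times> {-r<..<r} \<subseteq> ?\<Omega>" "{1<..<1+r} \<times> {-r<..<r} \<subseteq> ?\<Omega>"
    by (rule dumbbell_ends_boxes[OF assms(4)]) blast
  obtain G where G: "0 \<le> G" "\<And>x y. x \<in> {0..1} \<Longrightarrow> y \<in> {0..1} \<Longrightarrow> \<bar>g x - g y\<bar> \<le> G * \<bar>x - y\<bar>"
    by (rule C2_unit_interval_Lipschitz[OF assms(5)]) blast
  have gc: "continuous_on {0..1} g"
    by (rule lipschitz_on_continuous_on[of G]) (rule lipschitz_onI, use G in \<open>auto simp: dist_real_def\<close>)
  obtain x1 where x1: "x1 \<in> {0..1}" "\<And>x. x \<in> {0..1} \<Longrightarrow> g x1 \<le> g x"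
    using continuous_attains_inf[OF compact_Icc _ gc] by fastforce
  obtain x2 where x2: "x2 \<in> {0..1}" "\<And>x. x \<in> {0..1} \<Longrightarrow> g x \<le> g x2"
    using continuous_attains_sup[OF compact_Icc _ gc] by fastforce
  define m where "m = g x1"
  define B where "B = g x2"
  have mB: "0 < m" "0 < B" using assms(6) x1(1) x2(1) by (auto simp: m_def B_def)
  define \<kappa> where "\<kappa> = (6 * G + 2) / m"
  have \<kappa>: "\<kappa> * m = 6 * G + 2" "0 \<le> \<kappa>" using mB G by (auto simp: \<kappa>_def)
  obtain C :: real where C: "C \<ge> 1" and cut: "\<And>a. 0 < a \<Longrightarrow> \<exists>\<xi> :: real \<times> real \<Rightarrow> real. smooth \<xi> \<and>
     (\<forall>z. 0 \<le> \<xi> z \<and> \<xi> z \<le> 1) \<and> (\<forall>z. fst z \<le> -2 * a \<or> 1 + 2 * a \<le> fst z \<longrightarrow> \<xi> z = 0) \<and>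
     (\<forall>z. -a \<le> fst z \<and> fst z \<le> 1 + a \<longrightarrow> \<xi> z = 1) \<and> partial_deriv ey \<xi> = (\<lambda>z. 0) \<and>
     partial_deriv ey (partial_deriv ex \<xi>) = (\<lambda>z. 0) \<and>
     (\<forall>z. \<bar>partial_deriv ex \<xi> z\<bar> \<le> C / a) \<and> (\<forall>z. \<bar>partial_deriv ex (partial_deriv ex \<xi>) z\<bar> \<le> C / a\<^sup>2) \<and>
     (\<forall>z. -a < fst z \<and> fst z < 1 + a \<longrightarrow> partial_deriv ex \<xi> z = 0 \<and> partial_deriv ex (partial_deriv ex \<xi>) z = 0)"
    by (rule cutoff_exists) blast
  define w where "w = 1 / (r / 2) + 1"
  have w: "0 < w" using r by (simp add: w_def add_pos_pos)
  define A1 where "A1 = 15 + 6 * (3 + \<kappa>)\<^sup>2 * M\<^sup>2 + 24 * B * w * M\<^sup>2"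
  define X where "X = 36 * (3 + \<tau>) * (6 + \<kappa>)\<^sup>2 * M\<^sup>2"
  \<comment> \<open>Here 2048 is \<open>64 * 8 * 4\<close>, the product of the numerical factors in
    the cutoff term.\<close>
  define Z where "Z = 2048 * (3 + \<tau>) * C\<^sup>2 * B * w * M\<^sup>2"
  define A2 where "A2 = (4 * \<kappa> + 1) * ((3 + \<tau>) * M\<^sup>2) + (1 + 2 * \<kappa>) * (X + Z)"
  \<comment> \<open>The second bound gives both \<open>(6 + \<kappa>) * a \<le> 1\<close> and
    \<open>\<kappa> * a \<le> 1 / 2\<close>, the third \<open>3 * a < r\<close>, the fourth
    \<open>a * B \<le> r / 2\<close>.\<close>
  define a1 where "a1 = min (min 1 (1 / (2 * (6 + \<kappa>)))) (min (r / 6) (r / (2 * B)))"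
  have a1: "0 < a1" using \<kappa> r mB by (simp add: a1_def)
  define good where "good \<epsilon> v \<longleftrightarrow> v \<in> H2_vanishing (channel g \<epsilon>) (junctions g \<epsilon>) \<and>
      (L2_norm (channel g \<epsilon>) (\<lambda>z. u \<epsilon> z - v z))\<^sup>2 \<le> A1 * root 6 \<epsilon> \<and>
      (H2_bracket \<sigma> \<tau> (channel g \<epsilon>) v)\<^sup>2 \<le> (H2_bracket \<sigma> \<tau> (dumbbell ?\<Omega> g \<epsilon>) (u \<epsilon>))\<^sup>2 + A2 * root 6 \<epsilon>" for \<epsilon> v
  have eg: "\<epsilon> * g x \<le> 1" if "0 < \<epsilon>" "\<epsilon> < \<epsilon>0" "x \<in> {0..1}" for \<epsilon> x
  proof -
    have "\<epsilon> * g x \<le> \<epsilon>0 * g x" using that assms(6) by (intro mult_right_mono) (auto simp: less_imp_le)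
    also have "\<dots> \<le> 1" using assms(8) that by blast
    finally show ?thesis .
  qed
  have main: "\<exists>v. good \<epsilon> v" if \<epsilon>: "0 < \<epsilon>" "\<epsilon> < \<epsilon>0" "\<epsilon> \<le> a1 ^ 6" for \<epsilon>
  proof -
    define a where "a = root 6 \<epsilon>"
    have a0: "0 < a" using \<epsilon> by (simp add: a_def)
    have a6: "a ^ 6 = \<epsilon>" using \<epsilon> by (simp add: a_def)
    \<comment> \<open>The rule compares powers with a successor exponent, hence 5 for the sixth
      power.\<close>
    have "a \<le> a1" by (rule power_le_imp_le_base[of _ 5]) (use \<epsilon>(3) a1 a6 in auto)
    then have a: "a \<le> 1" "a \<le> 1 / (2 * (6 + \<kappa>))" "a \<le> r / 6" "a \<le> r / (2 * B)" by (auto simp: a1_def)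
    have "2 * ((6 + \<kappa>) * a) \<le> 1" using a(2) \<kappa>(2) by (simp add: field_simps)
    moreover have "\<kappa> * a \<le> (6 + \<kappa>) * a" using a0 by (intro mult_right_mono) auto
    moreover have "0 \<le> (6 + \<kappa>) * a" using a0 \<kappa>(2) by simp
    ultimately have ak: "(6 + \<kappa>) * a \<le> 1" "\<kappa> * a \<le> 1 / 2" by linarith+
    have ar: "3 * a < r" "a * B \<le> r / 2" using a r(1) mB by (auto simp: field_simps)
    have ea: "\<epsilon> \<le> a" using power_decreasing[of 1 6 a] a0 a(1) a6 by simp
    have aa: "a\<^sup>2 \<le> a" using a0 a(1) by (simp add: power2_eq_square mult_left_le)
    obtain \<xi> :: "real \<times> real \<Rightarrow> real" where x: "smooth \<xi>" "\<And>z. 0 \<le> \<xi> z \<and> \<xi> z \<le> 1"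
      "\<And>z. fst z \<le> -2 * a \<or> 1 + 2 * a \<le> fst z \<Longrightarrow> \<xi> z = 0" "\<And>z. -a \<le> fst z \<and> fst z \<le> 1 + a \<Longrightarrow> \<xi> z = 1"
      "partial_deriv ey \<xi> = (\<lambda>z. 0)" "partial_deriv ey (partial_deriv ex \<xi>) = (\<lambda>z. 0)"
      "\<And>z. \<bar>partial_deriv ex \<xi> z\<bar> \<le> C / a" "\<And>z. \<bar>partial_deriv ex (partial_deriv ex \<xi>) z\<bar> \<le> C / a\<^sup>2"
      "\<And>z. -a < fst z \<Longrightarrow> fst z < 1 + a \<Longrightarrow> partial_deriv ex \<xi> z = 0 \<and> partial_deriv ex (partial_deriv ex \<xi>) z = 0"
      using cut[OF a0] by blast
    have u\<epsilon>: "u \<epsilon> \<in> H2 (dumbbell ?\<Omega> g \<epsilon>)" "H2_norm (dumbbell ?\<Omega> g \<epsilon>) (u \<epsilon>) \<le> M" using u \<epsilon> by auto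
    have gm: "m \<le> g x" and gB: "g x \<le> B" if "x \<in> {0..1}" for x using x1(2) x2(2) that by (auto simp: m_def B_def)
    obtain v where v: "v \<in> H2_vanishing (channel g \<epsilon>) (junctions g \<epsilon>)"
      "(L2_norm (channel g \<epsilon>) (\<lambda>z. u \<epsilon> z - v z))\<^sup>2 \<le> 15 * a + 6 * (3 + \<kappa>)\<^sup>2 * a\<^sup>2 * M\<^sup>2 + 24 * (\<epsilon> * B) * (1 / (r / 2) + 1) * M\<^sup>2"
      "(H2_bracket \<sigma> \<tau> (channel g \<epsilon>) v)\<^sup>2 \<le> (1 + 2 * (\<kappa> * a)) * ((1 + a) * (H2_bracket \<sigma> \<tau> (dumbbell ?\<Omega> g \<epsilon>) (u \<epsilon>))\<^sup>2
        + 36 * (3 + \<tau>) * (6 + \<kappa>)\<^sup>2 * a * M\<^sup>2 + 64 * (3 + \<tau>) / a * (8 * (C / a\<^sup>2)\<^sup>2) * (4 * (\<epsilon> * B) * (1 / (r / 2) + 1) * M\<^sup>2))"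
      "(H2_bracket \<sigma> \<tau> (dumbbell ?\<Omega> g \<epsilon>) (u \<epsilon>))\<^sup>2 \<le> (3 + \<tau>) * M\<^sup>2"
      by (rule dumbbell_estimate[OF q \<Omega> r G mB(1) gm gB \<kappa> a0 a(1) ak ar \<epsilon>(1) ea eg[OF \<epsilon>(1,2)] x u\<epsilon>]) blast
    have "6 * (3 + \<kappa>)\<^sup>2 * M\<^sup>2 * a\<^sup>2 \<le> 6 * (3 + \<kappa>)\<^sup>2 * M\<^sup>2 * a" using aa by (intro mult_left_mono) auto
    moreover have "24 * B * w * M\<^sup>2 * \<epsilon> \<le> 24 * B * w * M\<^sup>2 * a" using ea mB w by (intro mult_left_mono) auto
    ultimately have 1: "(L2_norm (channel g \<epsilon>) (\<lambda>z. u \<epsilon> z - v z))\<^sup>2 \<le> A1 * a"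
      using v(2) unfolding w_def[symmetric] A1_def by (simp add: algebra_simps)
    \<comment> \<open>Powers of \<open>a\<close>: -1 from Young's inequality, -4 from the squared
      second derivative of the cutoff, 6 from \<epsilon>; exactly one is left.\<close>
    have e1: "64 * (3 + \<tau>) / a * (8 * (C / a\<^sup>2)\<^sup>2) * (4 * (\<epsilon> * B) * w * M\<^sup>2) = Z * a"
      unfolding a6[symmetric] Z_def using a0 by (simp add: power_divide field_simps eval_nat_numeral)
    have e2: "36 * (3 + \<tau>) * (6 + \<kappa>)\<^sup>2 * a * M\<^sup>2 = X * a" by (simp add: X_def)
    have "(H2_bracket \<sigma> \<tau> (channel g \<epsilon>) v)\<^sup>2 \<le> (1 + 2 * (\<kappa> * a)) * ((1 + a) * (H2_bracket \<sigma> \<tau> (dumbbell ?\<Omega> g \<epsilon>) (u \<epsilon>))\<^sup>2 + X * a + Z * a)"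
      using v(3) unfolding w_def[symmetric] e1 e2 .
    also have "\<dots> \<le> (H2_bracket \<sigma> \<tau> (dumbbell ?\<Omega> g \<epsilon>) (u \<epsilon>))\<^sup>2 + A2 * a"
      unfolding A2_def by (rule estimate_arithmetic[OF a0 a(1) \<kappa>(2) _ _ _ v(4)])
        (use q mB w in \<open>auto simp: X_def Z_def\<close>)
    finally have "good \<epsilon> v" using v(1) 1 by (simp add: good_def a_def)
    then show ?thesis by blast
  qed
  have van: "(\<lambda>_. 0) \<in> H2_vanishing (channel g \<epsilon>) (junctions g \<epsilon>)" if e: "0 < \<epsilon>" "\<epsilon> < \<epsilon>0" for \<epsilon>
  proof -
    obtain r0 where "channel g \<epsilon> \<subseteq> ball 0 r0"
      using bounded_subset_ballD[OF bounded_channel[of \<epsilon> g]] eg[OF e] by blast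
    then show ?thesis by (rule smooth_in_H2_vanishing[OF open_channel[OF gc] _ smooth_const, of _ _ UNIV]) auto
  qed
  \<comment> \<open>Only small \<epsilon> matter for the limits, but membership is demanded on the
    whole range; the zero function is the default for the rest.\<close>
  define v where "v \<epsilon> = (if \<epsilon> \<le> a1 ^ 6 then SOME v. good \<epsilon> v else (\<lambda>_. 0))" for \<epsilon>
  have v: "good \<epsilon> (v \<epsilon>)" if "0 < \<epsilon>" "\<epsilon> < \<epsilon>0" "\<epsilon> \<le> a1 ^ 6" for \<epsilon>
    using someI_ex[OF main[OF that]] that by (simp add: v_def)
  \<comment> \<open>For larger \<epsilon> the error is the actual gap between the two sides, so the
    inequality holds there by definition.\<close>
  define \<rho> where "\<rho> \<epsilon> = (if \<epsilon> \<le> a1 ^ 6 then A2 * root 6 \<epsilon>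
      else (H2_bracket \<sigma> \<tau> (channel g \<epsilon>) (v \<epsilon>))\<^sup>2 - (H2_bracket \<sigma> \<tau> (dumbbell ?\<Omega> g \<epsilon>) (u \<epsilon>))\<^sup>2)" for \<epsilon>
  have "0 < min (a1 ^ 6) \<epsilon>0" using a1 assms(7) by simp
  from eventually_at_right_real[OF this]
  have ev: "eventually (\<lambda>\<epsilon>. 0 < \<epsilon> \<and> \<epsilon> < \<epsilon>0 \<and> \<epsilon> \<le> a1 ^ 6) (at_right 0)"
    by eventually_elim auto
  have lim: "((\<lambda>\<epsilon>. c * root 6 \<epsilon>) \<longlongrightarrow> 0) (at_right 0)" for c :: real
  proof -
    have "((\<lambda>\<epsilon>. c * root 6 \<epsilon>) \<longlongrightarrow> c * root 6 0) (at_right 0)"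
      by (intro tendsto_intros tendsto_real_root)
    then show ?thesis by simp
  qed
  show "\<exists>v. (\<forall>\<epsilon>\<in>{0<..<\<epsilon>0}. v \<epsilon> \<in> H2_vanishing (channel g \<epsilon>) (junctions g \<epsilon>)) \<and>
      ((\<lambda>\<epsilon>. L2_norm (channel g \<epsilon>) (\<lambda>z. u \<epsilon> z - v \<epsilon> z)) \<longlongrightarrow> 0) (at_right 0) \<and>
      (\<exists>\<rho>. (\<rho> \<longlongrightarrow> 0) (at_right 0) \<and>
        (\<forall>\<epsilon>\<in>{0<..<\<epsilon>0}. (H2_bracket \<sigma> \<tau> (channel g \<epsilon>) (v \<epsilon>))\<^sup>2
           \<le> (H2_bracket \<sigma> \<tau> (dumbbell ?\<Omega> g \<epsilon>) (u \<epsilon>))\<^sup>2 + \<rho> \<epsilon>))"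
  proof (intro exI[of _ v] exI[of _ \<rho>] conjI ballI)
    fix \<epsilon> assume "\<epsilon> \<in> {0<..<\<epsilon>0}"
    then have e: "0 < \<epsilon>" "\<epsilon> < \<epsilon>0" by auto
    show "v \<epsilon> \<in> H2_vanishing (channel g \<epsilon>) (junctions g \<epsilon>)"
      using v[OF e] van[OF e] by (cases "\<epsilon> \<le> a1 ^ 6") (auto simp: good_def v_def)
    show "(H2_bracket \<sigma> \<tau> (channel g \<epsilon>) (v \<epsilon>))\<^sup>2 \<le> (H2_bracket \<sigma> \<tau> (dumbbell ?\<Omega> g \<epsilon>) (u \<epsilon>))\<^sup>2 + \<rho> \<epsilon>"
      using v[OF e] by (cases "\<epsilon> \<le> a1 ^ 6") (auto simp: good_def \<rho>_def)
  next
    show "((\<lambda>\<epsilon>. L2_norm (channel g \<epsilon>) (\<lambda>z. u \<epsilon> z - v \<epsilon> z)) \<longlongrightarrow> 0) (at_right 0)"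
    proof (rule tendsto_sandwich[OF _ _ tendsto_const])
      show "eventually (\<lambda>\<epsilon>. 0 \<le> L2_norm (channel g \<epsilon>) (\<lambda>z. u \<epsilon> z - v \<epsilon> z)) (at_right 0)"
        by (simp add: L2_norm_def)
      show "eventually (\<lambda>\<epsilon>. L2_norm (channel g \<epsilon>) (\<lambda>z. u \<epsilon> z - v \<epsilon> z) \<le> sqrt (A1 * root 6 \<epsilon>)) (at_right 0)"
        using ev
      proof eventually_elim
        case (elim \<epsilon>)
        then have "(L2_norm (channel g \<epsilon>) (\<lambda>z. u \<epsilon> z - v \<epsilon> z))\<^sup>2 \<le> A1 * root 6 \<epsilon>" using v[of \<epsilon>] by (simp add: good_def)
        then show ?case by (rule real_le_rsqrt)
      qed
      show "((\<lambda>\<epsilon>. sqrt (A1 * root 6 \<epsilon>)) \<longlongrightarrow> 0) (at_right 0)"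
        using tendsto_real_sqrt[OF lim[of A1]] by simp
    qed
    show "(\<rho> \<longlongrightarrow> 0) (at_right 0)"
      by (rule Lim_transform_eventually[OF lim[of A2]]) (use ev in \<open>eventually_elim, simp add: \<rho>_def\<close>)
  qed
qed

end
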